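(* Let $w_1,\dots,w_n>0$ and $U=\max_i w_i/\min_i w_i$. The weighted random permutation problem can be solved (in expectation) with the work and span needed for integer sorting of $n$ items with keys from the range $0..O(n\ln(nU))$.
   Context: Weighted random permutation: output a permutation $(s_1,\dots,s_n)$ of $\{1,\dots,n\}$ generated by the process $\Pr[s_\ell=i]=w_i/(W-w_{s_1}-\dots-w_{s_{\ell-1}})$ for $i$ not among $s_1,\dots,s_{\ell-1}$, where $W=\sum_j w_j$ (i.e. weighted sampling without replacement with $k=n$). Work = total number of operations, span = parallel time with unboundedly many processors. *)

theory Defs
  imports "HOL-Probability.Probability"
begin

section \<open>A randomised work-span machine model\<close>

text \<open>
  Programs run on a synchronous parallel RAM with unit-cost real arithmetic.  Memory consists of
  arrays, named by natural numbers, of real cells; scalars are single cells.  Every expression node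
  and every elementary command costs one operation.  Processors are activated in a binary tree (an
  active processor can activate one further processor per time step), so that the use of \<open>p\<close>
  processors requires a start-up time of \<open>log\<^sub>2 p\<close>, charged once per run.
\<close>

type_synonym addr = "nat \<times> nat"
type_synonym store = "addr \<Rightarrow> real"
type_synonym log = "addr \<Rightarrow> real option"

datatype exp =
    Const int
  | Read nat exp
  | Add exp exp
  | Sub exp exp
  | Mul exp exp
  | Div exp exp
  | Floor exp
  | Ln exp
  | Exp exp
  | Less exp exp

text \<open>
  Array indices and loop bounds are rounded down, negative values to 0.  Truth values are 0 and 1;
  division by zero and logarithms of non-positive numbers take the values they have in HOL.
\<close>

abbreviation index :: "real \<Rightarrow> nat" where
  "index r \<equiv> nat \<lfloor>r\<rfloor>"

primrec val :: "exp \<Rightarrow> store \<Rightarrow> real" where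
  "val (Const z) \<sigma> = of_int z"
| "val (Read x e) \<sigma> = \<sigma> (x, index (val e \<sigma>))"
| "val (Add a b) \<sigma> = val a \<sigma> + val b \<sigma>"
| "val (Sub a b) \<sigma> = val a \<sigma> - val b \<sigma>"
| "val (Mul a b) \<sigma> = val a \<sigma> * val b \<sigma>"
| "val (Div a b) \<sigma> = val a \<sigma> / val b \<sigma>"
| "val (Floor a) \<sigma> = of_int \<lfloor>val a \<sigma>\<rfloor>"
| "val (Ln a) \<sigma> = ln (val a \<sigma>)"
| "val (Exp a) \<sigma> = exp (val a \<sigma>)"
| "val (Less a b) \<sigma> = (if val a \<sigma> < val b \<sigma> then 1 else 0)"

primrec cost :: "exp \<Rightarrow> nat" where
  "cost (Const z) = 1"
| "cost (Read x e) = 1 + cost e"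
| "cost (Add a b) = 1 + cost a + cost b"
| "cost (Sub a b) = 1 + cost a + cost b"
| "cost (Mul a b) = 1 + cost a + cost b"
| "cost (Div a b) = 1 + cost a + cost b"
| "cost (Floor a) = 1 + cost a"
| "cost (Ln a) = 1 + cost a"
| "cost (Exp a) = 1 + cost a"
| "cost (Less a b) = 1 + cost a + cost b"

text \<open>
  \<open>Assign x i e\<close> stores \<open>e\<close> in cell \<open>x[i]\<close>, \<open>Rand x i\<close> stores a fresh uniform deviate in \<open>x[i]\<close>, and
  \<open>Par x e c\<close> runs \<open>c\<close> in parallel for all values \<open>0, \<dots>, e - 1\<close> of the loop counter \<open>x[0]\<close>.
\<close>

datatype com =
    Skip
  | Assign nat exp exp
  | Rand nat exp
  | Seq com com
  | Cond exp com com
  | While exp com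
  | Par nat exp com

text \<open>
  A source of randomness supplies one deviate for every node of the (infinitely branching) tree
  of dynamic program points: different executions of subprograms get disjoint subtrees, so
  distinct draws are independent.
\<close>

type_synonym source = "nat list \<Rightarrow> real"

definition sub :: "nat \<Rightarrow> source \<Rightarrow> source" where
  "sub k \<omega> = (\<lambda>p. \<omega> (k # p))"

definition rand :: "source measure" where
  "rand = (\<Pi>\<^sub>M p\<in>UNIV. uniform_measure lborel {0..1})"

definition upd :: "store \<Rightarrow> log \<Rightarrow> store" where
  "upd \<sigma> L = (\<lambda>a. case L a of None \<Rightarrow> \<sigma> a | Some v \<Rightarrow> v)"

text \<open>Among conflicting writes of a parallel loop the one of the highest iteration prevails.\<close>

definition merge :: "nat \<Rightarrow> (nat \<Rightarrow> log) \<Rightarrow> log" where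
  "merge m Ls = foldl (++) Map.empty (map Ls [0..<m])"

text \<open>
  \<open>exec c \<omega> \<sigma> L k s p\<close>: started in store \<open>\<sigma>\<close> with randomness \<open>\<omega>\<close>, the program \<open>c\<close> terminates, has
  written the cells recorded in \<open>L\<close>, performs \<open>k\<close> operations, and takes \<open>s\<close> parallel time steps on
  \<open>p\<close> processors.  An iteration of a parallel loop sees the memory as it was before the loop,
  together with its own writes.
\<close>

inductive exec :: "com \<Rightarrow> source \<Rightarrow> store \<Rightarrow> log \<Rightarrow> nat \<Rightarrow> nat \<Rightarrow> nat \<Rightarrow> bool" where
  Skip: "exec Skip \<omega> \<sigma> Map.empty 1 1 1"
| Assign: "exec (Assign x i e) \<omega> \<sigma> [(x, index (val i \<sigma>)) \<mapsto> val e \<sigma>]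
    (1 + cost i + cost e) (1 + cost i + cost e) 1"
| Rand: "exec (Rand x i) \<omega> \<sigma> [(x, index (val i \<sigma>)) \<mapsto> \<omega> []] (1 + cost i) (1 + cost i) 1"
| Seq: "exec c1 (sub 0 \<omega>) \<sigma> L1 k1 s1 p1 \<Longrightarrow> exec c2 (sub 1 \<omega>) (upd \<sigma> L1) L2 k2 s2 p2 \<Longrightarrow>
    exec (Seq c1 c2) \<omega> \<sigma> (L1 ++ L2) (k1 + k2) (s1 + s2) (max p1 p2)"
| CondTrue: "val e \<sigma> \<noteq> 0 \<Longrightarrow> exec c1 \<omega> \<sigma> L k s p \<Longrightarrow>
    exec (Cond e c1 c2) \<omega> \<sigma> L (1 + cost e + k) (1 + cost e + s) p"
| CondFalse: "val e \<sigma> = 0 \<Longrightarrow> exec c2 \<omega> \<sigma> L k s p \<Longrightarrow>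
    exec (Cond e c1 c2) \<omega> \<sigma> L (1 + cost e + k) (1 + cost e + s) p"
| WhileFalse: "val e \<sigma> = 0 \<Longrightarrow> exec (While e c) \<omega> \<sigma> Map.empty (1 + cost e) (1 + cost e) 1"
| WhileTrue: "val e \<sigma> \<noteq> 0 \<Longrightarrow> exec c (sub 0 \<omega>) \<sigma> L1 k1 s1 p1 \<Longrightarrow>
    exec (While e c) (sub 1 \<omega>) (upd \<sigma> L1) L2 k2 s2 p2 \<Longrightarrow>
    exec (While e c) \<omega> \<sigma> (L1 ++ L2) (1 + cost e + k1 + k2) (1 + cost e + s1 + s2) (max p1 p2)"
| Par: "m = index (val e \<sigma>) \<Longrightarrow>
    (\<And>i. i < m \<Longrightarrow> exec c (sub i \<omega>) (\<sigma>((x, 0) := real i)) (Ls i) (ks i) (ss i) (ps i)) \<Longrightarrow>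
    exec (Par x e c) \<omega> \<sigma> (merge m Ls)
      (1 + cost e + m + (\<Sum>i<m. ks i))
      (1 + cost e + Max (insert 0 (ss ` {..<m})))
      (max 1 (\<Sum>i<m. ps i))"

lemma exec_deterministic:
  "exec c \<omega> \<sigma> L k s p \<Longrightarrow> exec c \<omega> \<sigma> L' k' s' p' \<Longrightarrow>
    L' = L \<and> k' = k \<and> s' = s \<and> p' = p"
proof (induction arbitrary: L' k' s' p' rule: exec.induct)
  case (Skip \<omega> \<sigma>)
  from Skip(1) show ?case by cases auto
next
  case (Assign x i e \<omega> \<sigma>)
  from Assign(1) show ?case by cases auto
next
  case (Rand x i \<omega> \<sigma>)
  from Rand(1) show ?case by cases auto
next
  case (Seq c1 \<omega> \<sigma> L1 k1 s1 p1 c2 L2 k2 s2 p2)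
  from Seq.prems show ?case
  proof cases
    case S: (Seq M1 j1 r1 q1 M2 j2 r2 q2)
    have 1: "M1 = L1" "j1 = k1" "r1 = s1" "q1 = p1"
      using Seq.IH(1)[OF S(5)] by blast+
    have "M2 = L2" "j2 = k2" "r2 = s2" "q2 = p2"
      using Seq.IH(2)[OF S(6)[unfolded 1]] by blast+
    with S(1-4) 1 show ?thesis by blast
  qed
next
  case (CondTrue e \<sigma> c1 \<omega> L k s p c2)
  from CondTrue.prems show ?case
  proof cases
    case T: (CondTrue j r)
    from CondTrue.IH[OF T(4)] T(1,2) show ?thesis by blast
  next
    case (CondFalse j r)
    with CondTrue.hyps show ?thesis by blast
  qed
next
  case (CondFalse e \<sigma> c2 \<omega> L k s p c1)
  from CondFalse.prems show ?case
  proof cases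
    case (CondTrue j r)
    with CondFalse.hyps show ?thesis by blast
  next
    case F: (CondFalse j r)
    from CondFalse.IH[OF F(4)] F(1,2) show ?thesis by blast
  qed
next
  case (WhileFalse e \<sigma> c \<omega>)
  from WhileFalse.prems show ?case
  proof cases
    case F: WhileFalse
    from F(1-4) show ?thesis by blast
  next
    case (WhileTrue M1 j1 r1 q1 M2 j2 r2 q2)
    with WhileFalse.hyps show ?thesis by blast
  qed
next
  case (WhileTrue e \<sigma> c \<omega> L1 k1 s1 p1 L2 k2 s2 p2)
  from WhileTrue.prems show ?case
  proof cases
    case WhileFalse
    with WhileTrue.hyps show ?thesis by blast
  next
    case W: (WhileTrue M1 j1 r1 q1 M2 j2 r2 q2)
    have 1: "M1 = L1" "j1 = k1" "r1 = s1" "q1 = p1"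
      using WhileTrue.IH(1)[OF W(6)] by blast+
    have "M2 = L2" "j2 = k2" "r2 = s2" "q2 = p2"
      using WhileTrue.IH(2)[OF W(7)[unfolded 1]] by blast+
    with W(1-4) 1 show ?thesis by blast
  qed
next
  case (Par m e \<sigma> c \<omega> x Ls ks ss ps)
  from Par.prems show ?case
  proof cases
    case A: (Par m' Ls' ks' ss' ps')
    have mm: "m' = m" using A(5) Par.hyps(1) by simp
    have same: "Ls' i = Ls i" "ks' i = ks i" "ss' i = ss i" "ps' i = ps i" if "i < m" for i
      using Par.IH[OF that A(6)[unfolded mm, OF that]] by blast+
    have "map Ls' [0..<m] = map Ls [0..<m]" "ss' ` {..<m} = ss ` {..<m}"
      "sum ks' {..<m} = sum ks {..<m}" "sum ps' {..<m} = sum ps {..<m}"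
      using same by auto
    with A(1-4) show ?thesis unfolding mm merge_def by presburger
  qed
qed

definition produces :: "com \<Rightarrow> store \<Rightarrow> source \<Rightarrow> (store \<Rightarrow> bool) \<Rightarrow> bool" where
  "produces c \<sigma> \<omega> Q \<longleftrightarrow> (\<exists>L k s p. exec c \<omega> \<sigma> L k s p \<and> Q (upd \<sigma> L))"

text \<open>
  By determinism the following sets have at most one element; for a diverging run they are
  empty and the infimum is \<open>\<infinity>\<close>.
\<close>

definition run_work :: "com \<Rightarrow> store \<Rightarrow> source \<Rightarrow> ennreal" where
  "run_work c \<sigma> \<omega> = Inf {of_nat k | L k s p. exec c \<omega> \<sigma> L k s p}"

definition run_span :: "com \<Rightarrow> store \<Rightarrow> source \<Rightarrow> ennreal" where
  "run_span c \<sigma> \<omega> = Inf {of_nat (s + nat \<lceil>log 2 (real p)\<rceil>) | L k s p. exec c \<omega> \<sigma> L k s p}"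

lemma run_work_eq: "exec c \<omega> \<sigma> L k s p \<Longrightarrow> run_work c \<sigma> \<omega> = of_nat k"
proof -
  assume e: "exec c \<omega> \<sigma> L k s p"
  have "{of_nat k' | L' k' s' p'. exec c \<omega> \<sigma> L' k' s' p'} = {of_nat k :: ennreal}"
    using e exec_deterministic[OF e] by blast
  then show ?thesis by (simp add: run_work_def)
qed

lemma run_span_eq:
  "exec c \<omega> \<sigma> L k s p \<Longrightarrow> run_span c \<sigma> \<omega> = of_nat (s + nat \<lceil>log 2 (real p)\<rceil>)"
proof -
  assume e: "exec c \<omega> \<sigma> L k s p"
  have "{of_nat (s' + nat \<lceil>log 2 (real p')\<rceil>) | L' k' s' p'. exec c \<omega> \<sigma> L' k' s' p'} =
      {of_nat (s + nat \<lceil>log 2 (real p)\<rceil>) :: ennreal}"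
    using e exec_deterministic[OF e] by blast
  then show ?thesis unfolding run_span_def by simp
qed

definition expected_work :: "com \<Rightarrow> store \<Rightarrow> ennreal" where
  "expected_work c \<sigma> = (\<integral>\<^sup>+ \<omega>. run_work c \<sigma> \<omega> \<partial>rand)"

definition expected_span :: "com \<Rightarrow> store \<Rightarrow> ennreal" where
  "expected_span c \<sigma> = (\<integral>\<^sup>+ \<omega>. run_span c \<sigma> \<omega> \<partial>rand)"


section \<open>Integer sorting\<close>

text \<open>
  Input: \<open>n\<close> and the largest admissible key \<open>K\<close> in array 0, the keys in array 1.
  Output: in array 2, the (0-based) item numbers in order of non-decreasing keys.
\<close>

definition sort_input :: "nat \<Rightarrow> nat \<Rightarrow> (nat \<Rightarrow> nat) \<Rightarrow> store" where
  "sort_input n K key = (\<lambda>(x, i).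
     if (x, i) = (0, 0) then real n
     else if (x, i) = (0, 1) then real K
     else if x = 1 \<and> i < n then real (key i)
     else 0)"

definition sorted_output :: "nat \<Rightarrow> (nat \<Rightarrow> nat) \<Rightarrow> store \<Rightarrow> bool" where
  "sorted_output n key \<tau> \<longleftrightarrow>
     (\<exists>\<pi>. bij_betw \<pi> {..<n} {..<n} \<and> (\<forall>j<n. \<tau> (2, j) = real (\<pi> j)) \<and>
        (\<forall>i j. i < j \<and> j < n \<longrightarrow> key (\<pi> i) \<le> key (\<pi> j)))"

definition key_seqs :: "nat \<Rightarrow> nat \<Rightarrow> (nat \<Rightarrow> nat) set" where
  "key_seqs n K = {key. \<forall>i<n. key i \<le> K}"

definition integer_sorter :: "com \<Rightarrow> bool" where
  "integer_sorter S \<longleftrightarrow>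
     (\<forall>n\<ge>1. \<forall>K. \<forall>key\<in>key_seqs n K.
        AE \<omega> in rand. produces S (sort_input n K key) \<omega> (sorted_output n key))"

definition sort_work :: "com \<Rightarrow> nat \<Rightarrow> nat \<Rightarrow> ennreal" where
  "sort_work S n K = (SUP key\<in>key_seqs n K. expected_work S (sort_input n K key))"

definition sort_span :: "com \<Rightarrow> nat \<Rightarrow> nat \<Rightarrow> ennreal" where
  "sort_span S n K = (SUP key\<in>key_seqs n K. expected_span S (sort_input n K key))"


section \<open>Weighted random permutations\<close>

definition next_item :: "(nat \<Rightarrow> real) \<Rightarrow> nat \<Rightarrow> nat list \<Rightarrow> nat pmf" where
  "next_item w n t = embed_pmf (\<lambda>i.
     if i \<in> {1..n} - set t then w i / ((\<Sum>j = 1..n. w j) - (\<Sum>j\<leftarrow>t. w j)) else 0)"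

text \<open>The first \<open>l\<close> items of the permutation, in the order in which they are drawn.\<close>

primrec draws :: "(nat \<Rightarrow> real) \<Rightarrow> nat \<Rightarrow> nat \<Rightarrow> nat list pmf" where
  "draws w n 0 = return_pmf []"
| "draws w n (Suc l) = bind_pmf (draws w n l) (\<lambda>t. map_pmf (\<lambda>i. t @ [i]) (next_item w n t))"

definition weighted_random_permutation :: "(nat \<Rightarrow> real) \<Rightarrow> nat \<Rightarrow> nat list pmf" where
  "weighted_random_permutation w n = draws w n n"

lemma pmf_next_item:
  assumes w: "\<forall>i\<in>{1..n}. 0 < w i" and t: "distinct t" "set t \<subset> {1..n}"
  shows "pmf (next_item w n t) i =
    (if i \<in> {1..n} - set t then w i / ((\<Sum>j = 1..n. w j) - (\<Sum>j\<leftarrow>t. w j)) else 0)"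
proof -
  let ?R = "{1..n} - set t"
  let ?f = "\<lambda>i. if i \<in> ?R then w i / ((\<Sum>j = 1..n. w j) - (\<Sum>j\<leftarrow>t. w j)) else 0"
  have rest: "(\<Sum>j = 1..n. w j) - (\<Sum>j\<leftarrow>t. w j) = sum w ?R"
    using t by (simp add: sum_diff sum_list_distinct_conv_sum_set psubset_imp_subset)
  have pos: "0 < sum w ?R"
    using w t by (intro sum_pos) auto
  have nonneg: "0 \<le> ?f j" for j
    unfolding rest using w pos by (auto intro!: divide_nonneg_pos less_imp_le)
  have "(\<integral>\<^sup>+ j. ennreal (?f j) \<partial>count_space UNIV) = (\<integral>\<^sup>+ j. ennreal (?f j) \<partial>count_space ?R)"
    by (rule nn_integral_count_space_eq) auto
  also have "\<dots> = (\<Sum>j\<in>?R. ennreal (?f j))"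
    by (simp add: nn_integral_count_space_finite)
  also have "\<dots> = ennreal (\<Sum>j\<in>?R. ?f j)"
    by (intro sum_ennreal nonneg)
  also have "(\<Sum>j\<in>?R. ?f j) = (\<Sum>j\<in>?R. w j / sum w ?R)"
    unfolding rest by (rule sum.cong) auto
  also have "\<dots> = 1"
    using pos by (simp add: sum_divide_distrib[symmetric])
  finally have "(\<integral>\<^sup>+ j. ennreal (?f j) \<partial>count_space UNIV) = 1"
    by simp
  with nonneg show ?thesis
    unfolding next_item_def by (rule pmf_embed_pmf)
qed

text \<open>
  Input: \<open>n\<close> in array 0 and the weights of the items \<open>1, \<dots>, n\<close> in array 1.
  Output: the permutation in array 2.
\<close>

definition permutation_input :: "nat \<Rightarrow> (nat \<Rightarrow> real) \<Rightarrow> store" where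
  "permutation_input n w = (\<lambda>(x, i).
     if (x, i) = (0, 0) then real n
     else if x = 1 \<and> i < n then w (i + 1)
     else 0)"

definition permutation_output :: "nat list \<Rightarrow> store \<Rightarrow> bool" where
  "permutation_output t \<tau> \<longleftrightarrow> (\<forall>l<length t. \<tau> (2, l) = real (t ! l))"

definition positive_weights :: "nat \<Rightarrow> (nat \<Rightarrow> real) \<Rightarrow> bool" where
  "positive_weights n w \<longleftrightarrow> 1 \<le> n \<and> (\<forall>i\<in>{1..n}. 0 < w i)"

text \<open>
  The output has exactly the required distribution; in particular the program terminates with a
  permutation almost surely.
\<close>

definition solves_weighted_random_permutation :: "com \<Rightarrow> bool" where
  "solves_weighted_random_permutation P \<longleftrightarrow>
     (\<forall>n w. positive_weights n w \<longrightarrow>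
        (\<forall>t. length t = n \<longrightarrow>
           measure rand {\<omega>. produces P (permutation_input n w) \<omega> (permutation_output t)}
             = pmf (weighted_random_permutation w n) t))"

definition weight_ratio :: "nat \<Rightarrow> (nat \<Rightarrow> real) \<Rightarrow> real" where
  "weight_ratio n w = Max (w ` {1..n}) / Min (w ` {1..n})"

end

theory Submission
  imports Defs
begin

text \<open>
  Draw independent exponential times of rates \<open>w\<^sub>i\<close>; sorted by time, the items form the required
  permutation, since the probability of an order is an iterated integral that evaluates to the
  product of the quotients \<open>w\<^sub>i / (weight not drawn before)\<close>.  On a logarithmic scale the density
  of such a time is bounded, and all times lie in a range of length \<open>O(ln (n U))\<close> except for tails of
  probability \<open>O(1/n)\<close>.  Hence the integer keys obtained by rounding \<open>n\<close> times the logarithm and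
  clamping to \<open>0, \<dots>, 2 n ln (n U)\<close> take each value with probability at most \<open>3/n\<close>, so that the
  sum of \<open>2\<close> to the number of items sharing a key has expectation \<open>O(n)\<close>.  After integer sorting,
  every item scans its bucket for its final place; this costs expected work \<open>O(n)\<close> and span
  \<open>O(log n)\<close>.  Any sorter needs that much: all but one output cells have to be written, and
  \<open>p\<close> processors cost a start-up time of \<open>log\<^sub>2 p\<close>.
\<close>

section \<open>Measurability of program runs\<close>

text \<open>The logarithmic scale is what copes with weights of very different size: the logarithm
  of an exponential time has, whatever its rate, the density \<open>a * exp (- a)\<close> up to a
  shift, which is at most 1, so no bucket can become popular. The moment of
  \<open>2 ^ collisions\<close> serves twice: it dominates the sum of the bucket sizes, hence the
  work, and its logarithm dominates the largest one, hence the span, so that no separate tail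
  estimate arises. Sorting costs are worst cases over fixed keys, whereas the keys here are random;
  the two fit together because the times and the sorter draw from disjoint subtrees of the source,
  so the sorter can be charged for each key sequence separately. The sorter is an arbitrary program;
  the surrounding code survives it by keeping its data in arrays that the sorter cannot name.
  Exactness of the distribution needs only a lower bound for each permutation, since the required
  probabilities already sum to 1. The semantics is an inductive relation, from which measurability
  in the source cannot be read off; hence the functional reformulation \<open>den\<close>.\<close>

type_synonym result = "log \<times> (nat \<times> nat \<times> nat) option"

fun comb :: "nat \<Rightarrow> (nat \<times> nat \<times> nat) option \<Rightarrow> (nat \<times> nat \<times> nat) option \<Rightarrow> (nat \<times> nat \<times> nat) option" where
  "comb b (Some (k1, s1, p1)) (Some (k2, s2, p2)) = Some (b + k1 + k2, b + s1 + s2, max p1 p2)"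
| "comb b _ _ = None"

definition seqr :: "nat \<Rightarrow> result \<Rightarrow> result \<Rightarrow> result" where
  "seqr b r1 r2 = (fst r1 ++ fst r2, comb b (snd r1) (snd r2))"

definition comb_list :: "nat \<Rightarrow> (nat \<times> nat \<times> nat) option list \<Rightarrow> (nat \<times> nat \<times> nat) option" where
  "comb_list b xs = (if None \<in> set xs then None else
     Some (b + length xs + (\<Sum>x\<leftarrow>xs. fst (the x)),
       b + Max (insert 0 (set (map (\<lambda>x. fst (snd (the x))) xs))),
       max 1 (\<Sum>x\<leftarrow>xs. snd (snd (the x)))))"

text \<open>Unrolls a \<open>While\<close> loop with a fuel bound \<open>n\<close>; running out of
  fuel looks like divergence. Source and store come as a pair so that measurability can be stated on
  a product space.\<close>

primrec loop :: "exp \<Rightarrow> (source \<times> store \<Rightarrow> result) \<Rightarrow> nat \<Rightarrow> source \<times> store \<Rightarrow> result" where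
  "loop e f 0 x = (Map.empty, None)"
| "loop e f (Suc n) x = (if val e (snd x) = 0 then (Map.empty, Some (1 + cost e, 1 + cost e, 1))
     else seqr (1 + cost e) (f (sub 0 (fst x), snd x))
       (loop e f n (sub 1 (fst x), upd (snd x) (fst (f (sub 0 (fst x), snd x))))))"

text \<open>The resources of a diverging run are \<^const>\<open>None\<close>, its log is junk.\<close>

primrec den :: "com \<Rightarrow> source \<times> store \<Rightarrow> result" where
  "den Skip x = (Map.empty, Some (1, 1, 1))"
| "den (Assign y i e) x = ([(y, index (val i (snd x))) \<mapsto> val e (snd x)],
     Some (1 + cost i + cost e, 1 + cost i + cost e, 1))"
| "den (Rand y i) x = ([(y, index (val i (snd x))) \<mapsto> fst x []], Some (1 + cost i, 1 + cost i, 1))"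
| "den (Seq c1 c2) x = seqr 0 (den c1 (sub 0 (fst x), snd x))
     (den c2 (sub 1 (fst x), upd (snd x) (fst (den c1 (sub 0 (fst x), snd x)))))"
| "den (Cond e c1 c2) x = seqr (1 + cost e) (Map.empty, Some (0, 0, 0))
     (if val e (snd x) \<noteq> 0 then den c1 x else den c2 x)"
| "den (While e c) x = loop e (den c) (LEAST n. snd (loop e (den c) n x) \<noteq> None) x"
| "den (Par y e c) x =
     (merge (index (val e (snd x))) (\<lambda>i. fst (den c (sub i (fst x), (snd x)((y, 0) := real i)))),
      comb_list (1 + cost e) (map (\<lambda>i. snd (den c (sub i (fst x), (snd x)((y, 0) := real i))))
        [0..<index (val e (snd x))]))"

section \<open>Agreement of the functional semantics with \<open>exec\<close>\<close>

lemma comb_eq_Some: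
  "comb b r1 r2 = Some (k, s, p) \<longleftrightarrow> (\<exists>k1 s1 p1 k2 s2 p2. r1 = Some (k1, s1, p1) \<and>
     r2 = Some (k2, s2, p2) \<and> k = b + k1 + k2 \<and> s = b + s1 + s2 \<and> p = max p1 p2)"
  by (cases "(b, r1, r2)" rule: comb.cases) auto

text \<open>Extra fuel is left over once the loop has ended. Hence the choice of the least
  sufficient fuel in \<open>den\<close> is immaterial.\<close>

lemma loop_stable:
  "loop e f n x = (L, Some r) \<Longrightarrow> n \<le> m \<Longrightarrow> loop e f m x = (L, Some r)"
proof (induction n arbitrary: m x L r)
  case (Suc n)
  obtain m' where m: "m = Suc m'" "n \<le> m'"
    using Suc.prems(2) by (cases m) auto
  show ?case
  proof (cases "val e (snd x) = 0")
    case True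
    then show ?thesis using Suc.prems m by simp
  next
    case False
    let ?r1 = "f (sub 0 (fst x), snd x)"
    let ?y = "(sub 1 (fst x), upd (snd x) (fst ?r1))"
    obtain k s p where r: "r = (k, s, p)" by (cases r)
    have *: "seqr (1 + cost e) ?r1 (loop e f n ?y) = (L, Some (k, s, p))"
      using False Suc.prems r by simp
    then obtain r2 where "snd (loop e f n ?y) = Some r2"
      unfolding seqr_def by (auto simp: comb_eq_Some)
    then have "loop e f n ?y = (fst (loop e f n ?y), Some r2)"
      by (metis prod.collapse)
    from Suc.IH[OF this m(2)] have "loop e f m' ?y = loop e f n ?y"
      by (metis \<open>loop e f n ?y = (fst (loop e f n ?y), Some r2)\<close>)
    then show ?thesis using False * r m by simp
  qed
qed simp

lemma den_While_eq:
  "den (While e c) x = (L, Some r) \<longleftrightarrow> (\<exists>n. loop e (den c) n x = (L, Some r))"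
proof
  assume "\<exists>n. loop e (den c) n x = (L, Some r)"
  then obtain n where n: "loop e (den c) n x = (L, Some r)" by blast
  let ?l = "LEAST n. snd (loop e (den c) n x) \<noteq> None"
  have "snd (loop e (den c) ?l x) \<noteq> None"
    by (rule LeastI[of _ n]) (simp add: n)
  then obtain L' r' where "loop e (den c) ?l x = (L', Some r')"
    by (metis not_None_eq prod.collapse)
  moreover from this have "?l \<le> n"
    by (intro Least_le) (simp add: n)
  ultimately show "den (While e c) x = (L, Some r)"
    using loop_stable[of e "den c" ?l x L' r' n] n by simp
qed auto

lemma exec_imp_den: "exec c \<omega> \<sigma> L k s p \<Longrightarrow> den c (\<omega>, \<sigma>) = (L, Some (k, s, p))"
proof (induction rule: exec.induct)
  case (WhileFalse e \<sigma> c \<omega>)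
  then have "loop e (den c) 1 (\<omega>, \<sigma>) = (Map.empty, Some (1 + cost e, 1 + cost e, 1))"
    by simp
  then show ?case unfolding den_While_eq by blast
next
  case (WhileTrue e \<sigma> c \<omega> L1 k1 s1 p1 L2 k2 s2 p2)
  obtain n where n: "loop e (den c) n (sub 1 \<omega>, upd \<sigma> L1) = (L2, Some (k2, s2, p2))"
    using WhileTrue.IH(2) unfolding den_While_eq by blast
  have "loop e (den c) (Suc n) (\<omega>, \<sigma>) =
      (L1 ++ L2, Some (1 + cost e + k1 + k2, 1 + cost e + s1 + s2, max p1 p2))"
    using WhileTrue.hyps(1) WhileTrue.IH(1) n[unfolded One_nat_def] by (simp add: seqr_def)
  then show ?case unfolding den_While_eq by blast
next
  case (Par m e \<sigma> c \<omega> x Ls ks ss ps)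
  let ?f = "\<lambda>i. den c (sub i \<omega>, \<sigma>((x, 0) := real i))"
  have 1: "?f i = (Ls i, Some (ks i, ss i, ps i))" if "i < m" for i
    using Par.IH[OF that] .
  have 2: "merge m (\<lambda>i. fst (?f i)) = merge m Ls"
    unfolding merge_def by (intro arg_cong[where f = "foldl (++) Map.empty"] map_cong) (auto simp: 1)
  have 3: "map (\<lambda>i. snd (?f i)) [0..<m] = map (\<lambda>i. Some (ks i, ss i, ps i)) [0..<m]"
    by (intro map_cong) (auto simp: 1)
  have 4: "den (Par x e c) (\<omega>, \<sigma>) =
    (merge m (\<lambda>i. fst (?f i)), comb_list (1 + cost e) (map (\<lambda>i. snd (?f i)) [0..<m]))"
    by (simp add: Par.hyps(1))
  show ?case
    unfolding 4 unfolding 2 3 comb_list_def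
    by (simp add: image_image o_def interv_sum_list_conv_sum_set_nat atLeast0LessThan) auto
qed (auto simp: seqr_def)

text \<open>The assumption is the induction hypothesis for the body; it is split off because the
  loop needs an induction of its own, on the fuel.\<close>

lemma loop_imp_exec:
  assumes "\<And>\<omega> \<sigma> L k s p. den c (\<omega>, \<sigma>) = (L, Some (k, s, p)) \<Longrightarrow> exec c \<omega> \<sigma> L k s p"
  shows "loop e (den c) n (\<omega>, \<sigma>) = (L, Some (k, s, p)) \<Longrightarrow> exec (While e c) \<omega> \<sigma> L k s p"
proof (induction n arbitrary: \<omega> \<sigma> L k s p)
  case (Suc n)
  show ?case
  proof (cases "val e \<sigma> = 0")
    case True
    then show ?thesis using Suc.prems exec.WhileFalse[OF True] by auto
  next
    case False
    let ?r1 = "den c (sub 0 \<omega>, \<sigma>)"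
    let ?r2 = "loop e (den c) n (sub 1 \<omega>, upd \<sigma> (fst ?r1))"
    have *: "seqr (1 + cost e) ?r1 ?r2 = (L, Some (k, s, p))"
      using False Suc.prems by simp
    then obtain k1 s1 p1 k2 s2 p2 where r: "snd ?r1 = Some (k1, s1, p1)" "snd ?r2 = Some (k2, s2, p2)"
      "k = 1 + cost e + k1 + k2" "s = 1 + cost e + s1 + s2" "p = max p1 p2" "L = fst ?r1 ++ fst ?r2"
      unfolding seqr_def by (auto simp: comb_eq_Some)
    have "exec c (sub 0 \<omega>) \<sigma> (fst ?r1) k1 s1 p1"
      by (rule assms) (metis r(1) prod.collapse)
    moreover have "exec (While e c) (sub 1 \<omega>) (upd \<sigma> (fst ?r1)) (fst ?r2) k2 s2 p2"
      by (rule Suc.IH) (metis r(2) prod.collapse)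
    ultimately show ?thesis
      unfolding r(3-6) by (rule exec.WhileTrue[OF False])
  qed
qed simp

lemma den_imp_exec: "den c (\<omega>, \<sigma>) = (L, Some (k, s, p)) \<Longrightarrow> exec c \<omega> \<sigma> L k s p"
proof (induction c arbitrary: \<omega> \<sigma> L k s p)
  case Skip
  then show ?case using exec.Skip by auto
next
  case (Assign x i e)
  then have "L = [(x, index (val i \<sigma>)) \<mapsto> val e \<sigma>]" "k = 1 + cost i + cost e" "s = 1 + cost i + cost e" "p = 1"
    by (simp_all del: fun_upd_apply)
  then show ?case by (simp only: exec.Assign)
next
  case (Rand x i)
  then have "L = [(x, index (val i \<sigma>)) \<mapsto> \<omega> []]" "k = 1 + cost i" "s = 1 + cost i" "p = 1"
    by (simp_all del: fun_upd_apply)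
  then show ?case by (simp only: exec.Rand)
next
  case (Seq c1 c2)
  let ?r1 = "den c1 (sub 0 \<omega>, \<sigma>)"
  let ?r2 = "den c2 (sub 1 \<omega>, upd \<sigma> (fst ?r1))"
  have "seqr 0 ?r1 ?r2 = (L, Some (k, s, p))"
    using Seq.prems by simp
  then obtain k1 s1 p1 k2 s2 p2 where r: "snd ?r1 = Some (k1, s1, p1)" "snd ?r2 = Some (k2, s2, p2)"
    "k = k1 + k2" "s = s1 + s2" "p = max p1 p2" "L = fst ?r1 ++ fst ?r2"
    unfolding seqr_def by (auto simp: comb_eq_Some)
  have "exec c1 (sub 0 \<omega>) \<sigma> (fst ?r1) k1 s1 p1"
    by (rule Seq.IH) (metis r(1) prod.collapse)
  moreover have "exec c2 (sub 1 \<omega>) (upd \<sigma> (fst ?r1)) (fst ?r2) k2 s2 p2"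
    by (rule Seq.IH) (metis r(2) prod.collapse)
  ultimately show ?case
    unfolding r(3-6) by (rule exec.Seq)
next
  case (Cond e c1 c2)
  define r where "r = (if val e \<sigma> \<noteq> 0 then den c1 (\<omega>, \<sigma>) else den c2 (\<omega>, \<sigma>))"
  have "seqr (1 + cost e) (Map.empty, Some (0, 0, 0)) r = (L, Some (k, s, p))"
    using Cond.prems by (simp add: r_def)
  then obtain k2 s2 where k: "snd r = Some (k2, s2, p)" "k = 1 + cost e + k2" "s = 1 + cost e + s2"
    "L = fst r"
    unfolding seqr_def by (auto simp: comb_eq_Some)
  then have *: "r = (L, Some (k2, s2, p))"
    by (metis prod.collapse)
  show ?case
  proof (cases "val e \<sigma> = 0")
    case True
    then have "exec c2 \<omega> \<sigma> L k2 s2 p"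
      using * by (intro Cond.IH) (simp add: r_def)
    then show ?thesis unfolding k(2,3) by (rule exec.CondFalse[OF True])
  next
    case False
    then have "exec c1 \<omega> \<sigma> L k2 s2 p"
      using * by (intro Cond.IH) (simp add: r_def)
    then show ?thesis unfolding k(2,3) by (rule exec.CondTrue[OF False])
  qed
next
  case (While e c)
  then show ?case unfolding den_While_eq using loop_imp_exec[of c] by blast
next
  case (Par x e c)
  define m where "m = index (val e \<sigma>)"
  define f where "f = (\<lambda>i. den c (sub i \<omega>, \<sigma>((x, 0) := real i)))"
  have *: "merge m (\<lambda>i. fst (f i)) = L" "comb_list (1 + cost e) (map (\<lambda>i. snd (f i)) [0..<m]) = Some (k, s, p)"
    using Par.prems by (simp_all add: m_def f_def)
  have 1: "snd (f i) \<noteq> None" if "i < m" for i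
  proof
    assume "snd (f i) = None"
    then have "None \<in> set (map (\<lambda>i. snd (f i)) [0..<m])"
      using that by (auto intro!: image_eqI[of _ _ i])
    then show False using *(2) unfolding comb_list_def by simp
  qed
  have 2: "exec c (sub i \<omega>) (\<sigma>((x, 0) := real i)) (fst (f i)) (fst (the (snd (f i))))
      (fst (snd (the (snd (f i))))) (snd (snd (the (snd (f i)))))" if "i < m" for i
  proof (rule Par.IH)
    have "snd (f i) \<noteq> None" by (rule 1[OF that])
    then show "den c (sub i \<omega>, \<sigma>((x, 0) := real i)) =
      (fst (f i), Some (fst (the (snd (f i))), fst (snd (the (snd (f i)))), snd (snd (the (snd (f i))))))"
      by (auto simp: prod_eq_iff f_def)
  qed
  from *(2) have "k = 1 + cost e + m + (\<Sum>i<m. fst (the (snd (f i))))"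
    "s = 1 + cost e + Max (insert 0 ((\<lambda>i. fst (snd (the (snd (f i))))) ` {..<m}))"
    "p = max 1 (\<Sum>i<m. snd (snd (the (snd (f i)))))"
    unfolding comb_list_def
    by (auto simp: image_image o_def interv_sum_list_conv_sum_set_nat atLeast0LessThan
      split: if_splits)
  with exec.Par[OF m_def 2] *(1) show ?case by simp
qed

lemma exec_iff_den: "exec c \<omega> \<sigma> L k s p \<longleftrightarrow> den c (\<omega>, \<sigma>) = (L, Some (k, s, p))"
  using exec_imp_den den_imp_exec by blast

text \<open>Pulls the sigma-algebra back along the injection of a value into its tag and its
  content, with content 0 for \<open>None\<close>. A map into it is measurable iff its tag and its
  content are.\<close>

definition opt_space :: "real option measure" where
  "opt_space = vimage_algebra UNIV (\<lambda>v. (v = None, case_option 0 id v)) (count_space UNIV \<Otimes>\<^sub>M borel)"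

definition log_space :: "log measure" where
  "log_space = (\<Pi>\<^sub>M a\<in>UNIV. opt_space)"

definition store_space :: "store measure" where
  "store_space = (\<Pi>\<^sub>M a\<in>UNIV. borel)"

definition result_space :: "result measure" where
  "result_space = log_space \<Otimes>\<^sub>M count_space UNIV"

lemma space_simps [simp]:
  "space opt_space = UNIV" "space log_space = UNIV" "space store_space = UNIV"
  "space result_space = UNIV" "space rand = UNIV"
  by (auto simp: opt_space_def log_space_def store_space_def result_space_def rand_def
    space_PiM space_pair_measure PiE_UNIV_domain)

lemma measurable_to_opt_space:
  "f \<in> measurable M opt_space \<longleftrightarrow>
    (\<lambda>x. f x = None) \<in> measurable M (count_space UNIV) \<and>
    (\<lambda>x. case_option 0 id (f x)) \<in> borel_measurable M" (is "_ \<longleftrightarrow> ?A \<and> ?B")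
proof
  assume f: "f \<in> measurable M opt_space"
  have "(\<lambda>v. (v = None, case_option 0 id v)) \<in> measurable opt_space (count_space UNIV \<Otimes>\<^sub>M borel)"
    unfolding opt_space_def by (rule measurable_vimage_algebra1) (auto simp: space_pair_measure)
  from measurable_compose[OF measurable_compose[OF f this] measurable_fst]
    measurable_compose[OF measurable_compose[OF f this] measurable_snd]
  show "?A \<and> ?B" by simp
next
  assume "?A \<and> ?B"
  then have [measurable]: ?A ?B by auto
  show "f \<in> measurable M opt_space"
    unfolding opt_space_def by (rule measurable_vimage_algebra2) auto
qed

lemma measurable_is_None [measurable]:
  "(\<lambda>v. v = None) \<in> measurable opt_space (count_space UNIV)"
  using measurable_to_opt_space[of "\<lambda>v. v" opt_space] by simp

lemma measurable_value [measurable]: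
  "(\<lambda>v. case_option 0 id v) \<in> borel_measurable opt_space"
  using measurable_to_opt_space[of "\<lambda>v. v" opt_space] by simp

lemma measurable_log_component [measurable]: "(\<lambda>L. L a) \<in> measurable log_space opt_space"
  unfolding log_space_def by simp

lemma measurable_store_component [measurable]: "(\<lambda>\<sigma>. \<sigma> a) \<in> borel_measurable store_space"
  unfolding store_space_def by simp

lemma sets_rand: "sets rand = sets (\<Pi>\<^sub>M p\<in>UNIV. borel)"
  unfolding rand_def by (rule sets_PiM_cong) auto

lemma measurable_rand_component [measurable]: "(\<lambda>\<omega>. \<omega> p) \<in> borel_measurable rand"
  unfolding measurable_cong_sets[OF sets_rand refl] by simp

lemma measurable_to_log_space:
  "(\<And>a. (\<lambda>x. f x a) \<in> measurable M opt_space) \<Longrightarrow> f \<in> measurable M log_space"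
  unfolding log_space_def by (rule measurable_PiM_single') auto

lemma measurable_to_store_space:
  "(\<And>a. (\<lambda>x. f x a) \<in> borel_measurable M) \<Longrightarrow> f \<in> measurable M store_space"
  unfolding store_space_def by (rule measurable_PiM_single') auto

lemma measurable_to_rand:
  "(\<And>p. (\<lambda>x. f x p) \<in> borel_measurable M) \<Longrightarrow> f \<in> measurable M rand"
  unfolding measurable_cong_sets[OF refl sets_rand] by (rule measurable_PiM_single') auto

lemma measurable_sub [measurable]: "sub k \<in> measurable rand rand"
  unfolding sub_def by (rule measurable_to_rand) measurable

lemma measurable_upd [measurable (raw)]:
  assumes [measurable]: "f \<in> measurable M store_space" "g \<in> measurable M log_space"
  shows "(\<lambda>x. upd (f x) (g x)) \<in> measurable M store_space"
proof (rule measurable_to_store_space)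
  fix a
  have "(\<lambda>x. upd (f x) (g x) a) = (\<lambda>x. if g x a = None then f x a else case_option 0 id (g x a))"
    by (auto simp: upd_def split: option.splits)
  also have "\<dots> \<in> borel_measurable M"
    by measurable
  finally show "(\<lambda>x. upd (f x) (g x) a) \<in> borel_measurable M" .
qed

lemma measurable_map_add [measurable (raw)]:
  assumes [measurable]: "f \<in> measurable M log_space" "g \<in> measurable M log_space"
  shows "(\<lambda>x. f x ++ g x) \<in> measurable M log_space"
proof (rule measurable_to_log_space)
  fix a
  have "(\<lambda>x. (f x ++ g x) a) = (\<lambda>x. if g x a = None then f x a else g x a)"
    by (auto simp: map_add_def split: option.splits)
  also have "\<dots> \<in> measurable M opt_space"
    by measurable
  finally show "(\<lambda>x. (f x ++ g x) a) \<in> measurable M opt_space" .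
qed

lemma merge_Suc: "merge (Suc m) Ls = merge m Ls ++ Ls m"
  by (simp add: merge_def)

lemma merge_0: "merge 0 Ls = Map.empty"
  by (simp add: merge_def)

lemma measurable_empty_log [measurable]: "(\<lambda>x. Map.empty) \<in> measurable M log_space"
  by (rule measurable_to_log_space) (simp add: measurable_to_opt_space)

lemma measurable_merge_logs:
  "(\<And>i. Ls i \<in> measurable M log_space) \<Longrightarrow> (\<lambda>x. merge m (\<lambda>i. Ls i x)) \<in> measurable M log_space"
proof (induction m)
  case (Suc m)
  have [measurable]: "(\<lambda>x. merge m (\<lambda>i. Ls i x)) \<in> measurable M log_space" "Ls m \<in> measurable M log_space"
    using Suc by auto
  show ?case unfolding merge_Suc by measurable
qed (simp add: merge_0)

lemma measurable_val [measurable]: "val e \<in> borel_measurable store_space"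
proof (induction e)
  case (Read x e)
  have "(\<lambda>\<sigma>. \<sigma> (x, i)) \<in> borel_measurable store_space" for i
    by measurable
  \<comment> \<open>The address read depends on the store, but it takes only countably many values,
    and for each fixed address the read is a coordinate projection.\<close>
  then have "(\<lambda>\<sigma>. (\<lambda>i \<sigma>. \<sigma> (x, i)) (index (val e \<sigma>)) \<sigma>) \<in> borel_measurable store_space"
    by (rule measurable_compose_countable) (use Read in measurable)
  moreover have "val (Read x e) = (\<lambda>\<sigma>. (\<lambda>i \<sigma>. \<sigma> (x, i)) (index (val e \<sigma>)) \<sigma>)"
    by auto
  ultimately show ?case by simp
next
  case (Less a b)
  note [measurable] = Less
  have "val (Less a b) = (\<lambda>\<sigma>. if val a \<sigma> < val b \<sigma> then 1 else 0)"
    by auto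
  then show ?case by simp
next
  case (Floor a)
  note [measurable] = Floor
  have "val (Floor a) = (\<lambda>\<sigma>. of_int \<lfloor>val a \<sigma>\<rfloor>)"
    by auto
  then show ?case by simp
qed (auto simp: val.simps[abs_def])

lemma measurable_single_log:
  assumes [measurable]: "f \<in> borel_measurable M" "g \<in> borel_measurable M"
  shows "(\<lambda>x. [(y, index (f x)) \<mapsto> g x]) \<in> measurable M log_space"
proof (rule measurable_to_log_space)
  fix a :: addr
  have "(\<lambda>x. [(y, index (f x)) \<mapsto> g x] a) = (\<lambda>x. if a = (y, index (f x)) then Some (g x) else None)"
    by auto
  also have "\<dots> \<in> measurable M opt_space"
    by (intro measurable_If) (auto simp: measurable_to_opt_space)
  finally show "(\<lambda>x. [(y, index (f x)) \<mapsto> g x] a) \<in> measurable M opt_space" .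
qed

lemma measurable_seqr [measurable (raw)]:
  assumes [measurable]: "f \<in> measurable M result_space" "g \<in> measurable M result_space"
  shows "(\<lambda>x. seqr b (f x) (g x)) \<in> measurable M result_space"
proof -
  have [measurable]: "f \<in> measurable M (log_space \<Otimes>\<^sub>M count_space UNIV)"
    "g \<in> measurable M (log_space \<Otimes>\<^sub>M count_space UNIV)"
    using assms by (simp_all add: result_space_def)
  have "(\<lambda>x. comb b (snd (f x)) (snd (g x))) \<in> measurable M (count_space UNIV)"
    by measurable
  then show ?thesis
    unfolding seqr_def result_space_def by measurable
qed

lemma measurable_map_list:
  assumes "\<And>i. f i \<in> measurable M (count_space (UNIV :: 'b :: countable set))"
  shows "(\<lambda>x. map (\<lambda>i. f i x) xs) \<in> measurable M (count_space UNIV)"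
proof (induction xs)
  case (Cons i xs)
  note [measurable] = Cons assms
  have "(\<lambda>x. f i x # map (\<lambda>i. f i x) xs) \<in> measurable M (count_space UNIV)"
    by measurable
  then show ?case by simp
qed simp

lemma measurable_loop [measurable]:
  assumes [measurable]: "f \<in> measurable (rand \<Otimes>\<^sub>M store_space) result_space"
  shows "loop e f n \<in> measurable (rand \<Otimes>\<^sub>M store_space) result_space"
proof (induction n)
  case 0
  show ?case by (simp add: result_space_def)
next
  case (Suc n)
  note [measurable] = Suc
  have [measurable]: "fst \<in> measurable result_space log_space"
    by (simp add: result_space_def)
  have [measurable]: "(\<lambda>x. (Map.empty, Some (1 + cost e, 1 + cost e, 1)))
      \<in> measurable (rand \<Otimes>\<^sub>M store_space) result_space"
    by (simp add: result_space_def)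
  show ?case
    unfolding loop.simps[abs_def] by measurable
qed

lemma measurable_den [measurable]: "den c \<in> measurable (rand \<Otimes>\<^sub>M store_space) result_space"
proof (induction c)
  case Skip
  show ?case by (simp add: result_space_def den.simps[abs_def])
next
  case (Assign y i e)
  have "(\<lambda>x. [(y, index (val i (snd x))) \<mapsto> val e (snd x)]) \<in> measurable (rand \<Otimes>\<^sub>M store_space) log_space"
    by (rule measurable_single_log) measurable
  then show ?case unfolding den.simps[abs_def] result_space_def by measurable
next
  case (Rand y i)
  have "(\<lambda>x. [(y, index (val i (snd x))) \<mapsto> fst x []]) \<in> measurable (rand \<Otimes>\<^sub>M store_space) log_space"
    by (rule measurable_single_log) measurable
  then show ?case unfolding den.simps[abs_def] result_space_def by measurable
next
  case (Seq c1 c2)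
  note [measurable] = Seq
  have [measurable]: "fst \<in> measurable result_space log_space"
    by (simp add: result_space_def)
  show ?case unfolding den.simps[abs_def] by measurable
next
  case (Cond e c1 c2)
  note [measurable] = Cond
  have [measurable]: "(\<lambda>x. (Map.empty, Some (0, 0, 0))) \<in> measurable (rand \<Otimes>\<^sub>M store_space) result_space"
    by (simp add: result_space_def)
  show ?case unfolding den.simps[abs_def] by measurable
next
  case (While e c)
  note [measurable] = While
  have [measurable]: "snd \<in> measurable result_space (count_space UNIV)"
    by (simp add: result_space_def)
  \<comment> \<open>The least sufficient fuel is itself a measurable natural number, so the loop is
    glued together from countably many bounded unrollings.\<close>
  show ?case unfolding den.simps[abs_def]
    by (rule measurable_compose_countable[where f = "\<lambda>n x. loop e (den c) n x"]) measurable
next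
  case (Par y e c)
  note [measurable] = Par
  let ?f = "\<lambda>i x. den c (sub i (fst x), (snd x)((y, 0) := real i))"
  have u: "(\<lambda>x. (snd x)((y, 0) := real i)) \<in> measurable (rand \<Otimes>\<^sub>M store_space) store_space" for i
  proof (rule measurable_to_store_space)
    fix a
    show "(\<lambda>x. ((snd x)((y, 0) := real i)) a) \<in> borel_measurable (rand \<Otimes>\<^sub>M store_space)"
      by (cases "a = (y, 0)") auto
  qed
  have f: "?f i \<in> measurable (rand \<Otimes>\<^sub>M store_space) result_space" for i
    using u by measurable
  have 1: "(\<lambda>x. fst (?f i x)) \<in> measurable (rand \<Otimes>\<^sub>M store_space) log_space"
    "(\<lambda>x. snd (?f i x)) \<in> measurable (rand \<Otimes>\<^sub>M store_space) (count_space UNIV)" for i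
    using f[of i] unfolding result_space_def by (auto intro: measurable_compose[OF _ measurable_fst] measurable_compose[OF _ measurable_snd])
  have "(\<lambda>x. (merge m (\<lambda>i. fst (?f i x)), comb_list (1 + cost e) (map (\<lambda>i. snd (?f i x)) [0..<m])))
    \<in> measurable (rand \<Otimes>\<^sub>M store_space) result_space" for m
  proof -
    note [measurable] = measurable_merge_logs[OF 1(1), of m]
      measurable_map_list[OF 1(2), where xs = "[0..<m]"]
    show ?thesis unfolding result_space_def by measurable
  qed
  then show ?case unfolding den.simps[abs_def]
    by (rule measurable_compose_countable[where g = "\<lambda>x. index (val e (snd x))"]) measurable
qed

lemma measurable_den_source: "(\<lambda>\<omega>. den c (\<omega>, \<sigma>)) \<in> measurable rand result_space"
  by (rule measurable_compose[OF _ measurable_den]) simp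

lemma run_work_den: "run_work c \<sigma> \<omega> = (case snd (den c (\<omega>, \<sigma>)) of None \<Rightarrow> \<top> | Some (k, s, p) \<Rightarrow> of_nat k)"
proof (cases "snd (den c (\<omega>, \<sigma>))")
  case None
  then have "\<not> exec c \<omega> \<sigma> L k s p" for L k s p
    using exec_iff_den by auto
  then show ?thesis using None by (simp add: run_work_def)
next
  case (Some r)
  obtain k s p where r: "r = (k, s, p)" by (cases r)
  have "exec c \<omega> \<sigma> (fst (den c (\<omega>, \<sigma>))) k s p"
    unfolding exec_iff_den using Some r by (simp add: prod_eq_iff)
  from run_work_eq[OF this] Some r show ?thesis by simp
qed

lemma run_span_den: "run_span c \<sigma> \<omega> = (case snd (den c (\<omega>, \<sigma>)) of None \<Rightarrow> \<top>
    | Some (k, s, p) \<Rightarrow> of_nat (s + nat \<lceil>log 2 (real p)\<rceil>))"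
proof (cases "snd (den c (\<omega>, \<sigma>))")
  case None
  then have "\<not> exec c \<omega> \<sigma> L k s p" for L k s p
    using exec_iff_den by auto
  then show ?thesis using None by (simp add: run_span_def)
next
  case (Some r)
  obtain k s p where r: "r = (k, s, p)" by (cases r)
  have "exec c \<omega> \<sigma> (fst (den c (\<omega>, \<sigma>))) k s p"
    unfolding exec_iff_den using Some r by (simp add: prod_eq_iff)
  from run_span_eq[OF this] Some r show ?thesis by simp
qed

lemma measurable_resources: "(\<lambda>\<omega>. snd (den c (\<omega>, \<sigma>))) \<in> measurable rand (count_space UNIV)"
  using measurable_den_source[of c \<sigma>] unfolding result_space_def by (rule measurable_compose[OF _ measurable_snd])

lemma measurable_run_work: "run_work c \<sigma> \<in> borel_measurable rand"
  unfolding run_work_den[abs_def] by (rule measurable_compose[OF measurable_resources]) simp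

lemma measurable_run_span: "run_span c \<sigma> \<in> borel_measurable rand"
  unfolding run_span_den[abs_def] by (rule measurable_compose[OF measurable_resources]) simp

text \<open>Termination is read off the countable resource component, and the output condition
  concerns finitely many cells. Without this the probabilities in
  \<open>solves_weighted_random_permutation\<close> could not be computed.\<close>

lemma produces_permutation_measurable:
  "{\<omega>. produces c \<sigma> \<omega> (permutation_output t)} \<in> sets rand"
proof -
  note [measurable] = measurable_resources[of c \<sigma>]
  have [measurable]: "(\<lambda>\<omega>. fst (den c (\<omega>, \<sigma>))) \<in> measurable rand log_space"
    using measurable_den_source[of c \<sigma>] unfolding result_space_def by (rule measurable_compose[OF _ measurable_fst])
  have "produces c \<sigma> \<omega> (permutation_output t) \<longleftrightarrow> snd (den c (\<omega>, \<sigma>)) \<noteq> None \<and>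
      (\<forall>l\<in>{..<length t}. upd \<sigma> (fst (den c (\<omega>, \<sigma>))) (2, l) = real (t ! l))" for \<omega>
    unfolding produces_def exec_iff_den permutation_output_def
    by (cases "den c (\<omega>, \<sigma>)") auto
  then have "{\<omega>. produces c \<sigma> \<omega> (permutation_output t)} = {\<omega> \<in> space rand. snd (den c (\<omega>, \<sigma>)) \<noteq> None \<and>
      (\<forall>l\<in>{..<length t}. upd \<sigma> (fst (den c (\<omega>, \<sigma>))) (2, l) = real (t ! l))}"
    by simp
  also have "\<dots> \<in> sets rand"
    by (intro sets.sets_Collect_conj sets.sets_Collect_finite_All) measurable
  finally show ?thesis .
qed

section \<open>Framing and lower bounds\<close>

primrec exp_uses :: "nat set \<Rightarrow> exp \<Rightarrow> bool" where
  "exp_uses A (Const z) \<longleftrightarrow> True"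
| "exp_uses A (Read x e) \<longleftrightarrow> x \<in> A \<and> exp_uses A e"
| "exp_uses A (Add a b) \<longleftrightarrow> exp_uses A a \<and> exp_uses A b"
| "exp_uses A (Sub a b) \<longleftrightarrow> exp_uses A a \<and> exp_uses A b"
| "exp_uses A (Mul a b) \<longleftrightarrow> exp_uses A a \<and> exp_uses A b"
| "exp_uses A (Div a b) \<longleftrightarrow> exp_uses A a \<and> exp_uses A b"
| "exp_uses A (Floor a) \<longleftrightarrow> exp_uses A a"
| "exp_uses A (Ln a) \<longleftrightarrow> exp_uses A a"
| "exp_uses A (Exp a) \<longleftrightarrow> exp_uses A a"
| "exp_uses A (Less a b) \<longleftrightarrow> exp_uses A a \<and> exp_uses A b"

text \<open>A static bound on the arrays touched, for reading, writing and loop counters alike. A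
  sorter confined to \<open>{..<b}\<close> neither notices nor disturbs data stored from
  \<open>b\<close> on.\<close>

primrec uses :: "nat set \<Rightarrow> com \<Rightarrow> bool" where
  "uses A Skip \<longleftrightarrow> True"
| "uses A (Assign x i e) \<longleftrightarrow> x \<in> A \<and> exp_uses A i \<and> exp_uses A e"
| "uses A (Rand x i) \<longleftrightarrow> x \<in> A \<and> exp_uses A i"
| "uses A (Seq c1 c2) \<longleftrightarrow> uses A c1 \<and> uses A c2"
| "uses A (Cond e c1 c2) \<longleftrightarrow> exp_uses A e \<and> uses A c1 \<and> uses A c2"
| "uses A (While e c) \<longleftrightarrow> exp_uses A e \<and> uses A c"
| "uses A (Par x e c) \<longleftrightarrow> x \<in> A \<and> exp_uses A e \<and> uses A c"

definition agree :: "nat set \<Rightarrow> store \<Rightarrow> store \<Rightarrow> bool" where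
  "agree A \<sigma> \<tau> \<longleftrightarrow> (\<forall>x\<in>A. \<forall>i. \<sigma> (x, i) = \<tau> (x, i))"

lemma exp_uses_mono: "exp_uses A e \<Longrightarrow> A \<subseteq> B \<Longrightarrow> exp_uses B e"
  by (induction e) auto

lemma uses_mono: "uses A c \<Longrightarrow> A \<subseteq> B \<Longrightarrow> uses B c"
  by (induction c) (auto intro: exp_uses_mono)

lemma ex_exp_uses: "\<exists>N. exp_uses {..<N} e"
proof (induction e)
  case (Read x e)
  then obtain N where "exp_uses {..<N} e" by blast
  then have "exp_uses {..<Suc (max x N)} (Read x e)"
    by (auto intro: exp_uses_mono)
  then show ?case by blast
qed (auto, (metis exp_uses_mono max.cobounded1 max.cobounded2 lessThan_subset_iff)+)

lemma ex_uses: "\<exists>N. uses {..<N} c"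
proof (induction c)
  case (Assign x i e)
  obtain N M where "exp_uses {..<N} i" "exp_uses {..<M} e"
    using ex_exp_uses by metis
  then have "uses {..<Suc (max x (max N M))} (Assign x i e)"
    by (auto intro: exp_uses_mono)
  then show ?case by blast
next
  case (Rand x i)
  obtain N where "exp_uses {..<N} i"
    using ex_exp_uses by metis
  then have "uses {..<Suc (max x N)} (Rand x i)"
    by (auto intro: exp_uses_mono)
  then show ?case by blast
next
  case (Seq c1 c2)
  then obtain N M where "uses {..<N} c1" "uses {..<M} c2" by blast
  then have "uses {..<max N M} (Seq c1 c2)"
    by (auto intro: uses_mono)
  then show ?case by blast
next
  case (Cond e c1 c2)
  then obtain N M where "uses {..<N} c1" "uses {..<M} c2" by blast
  moreover obtain J where "exp_uses {..<J} e"
    using ex_exp_uses by metis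
  ultimately have "uses {..<max J (max N M)} (Cond e c1 c2)"
    by (auto intro: uses_mono exp_uses_mono)
  then show ?case by blast
next
  case (While e c)
  then obtain N where "uses {..<N} c" by blast
  moreover obtain J where "exp_uses {..<J} e"
    using ex_exp_uses by metis
  ultimately have "uses {..<max J N} (While e c)"
    by (auto intro: uses_mono exp_uses_mono)
  then show ?case by blast
next
  case (Par x e c)
  then obtain N where "uses {..<N} c" by blast
  moreover obtain J where "exp_uses {..<J} e"
    using ex_exp_uses by metis
  ultimately have "uses {..<Suc (max x (max J N))} (Par x e c)"
    by (auto intro: uses_mono exp_uses_mono)
  then show ?case by blast
qed simp

lemma val_agree: "exp_uses A e \<Longrightarrow> agree A \<sigma> \<tau> \<Longrightarrow> val e \<sigma> = val e \<tau>"
  by (induction e) (auto simp: agree_def)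

lemma agree_upd: "agree A \<sigma> \<tau> \<Longrightarrow> agree A (upd \<sigma> L) (upd \<tau> L)"
  by (auto simp: agree_def upd_def split: option.splits)

lemma merge_eq_None: "merge m Ls a = None \<longleftrightarrow> (\<forall>i<m. Ls i a = None)"
  by (induction m) (auto simp: merge_0 merge_Suc less_Suc_eq)

lemma dom_merge: "dom (merge m Ls) = (\<Union>i<m. dom (Ls i))"
  by (rule set_eqI) (auto simp: domIff merge_eq_None simp del: not_None_eq)

text \<open>Every test, address and value depends on arrays in \<open>A\<close> only, so the two
  runs proceed in lockstep. This transfers a sorter's run from its standard input to the store in
  which it is called.\<close>

lemma exec_agree:
  "exec c \<omega> \<sigma> L k s p \<Longrightarrow> uses A c \<Longrightarrow> agree A \<sigma> \<tau> \<Longrightarrow> exec c \<omega> \<tau> L k s p"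
proof (induction arbitrary: \<tau> rule: exec.induct)
  case (Skip \<omega> \<sigma>)
  show ?case by (rule exec.Skip)
next
  case (Assign x i e \<omega> \<sigma>)
  then have "val i \<sigma> = val i \<tau>" "val e \<sigma> = val e \<tau>"
    using val_agree by auto
  then show ?case using exec.Assign by metis
next
  case (Rand x i \<omega> \<sigma>)
  then have "val i \<sigma> = val i \<tau>"
    using val_agree by auto
  then show ?case using exec.Rand by metis
next
  case (Seq c1 \<omega> \<sigma> L1 k1 s1 p1 c2 L2 k2 s2 p2)
  then show ?case by (intro exec.Seq Seq.IH agree_upd) auto
next
  case (CondTrue e \<sigma> c1 \<omega> L k s p c2)
  then have "val e \<tau> \<noteq> 0"
    using val_agree[of A e \<sigma> \<tau>] by simp
  then show ?case
    using CondTrue by (intro exec.CondTrue CondTrue.IH) auto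
next
  case (CondFalse e \<sigma> c2 \<omega> L k s p c1)
  then have "val e \<tau> = 0"
    using val_agree[of A e \<sigma> \<tau>] by simp
  then show ?case
    using CondFalse by (intro exec.CondFalse CondFalse.IH) auto
next
  case (WhileFalse e \<sigma> c \<omega>)
  then have "val e \<tau> = 0"
    using val_agree[of A e \<sigma> \<tau>] by simp
  then show ?case by (rule exec.WhileFalse)
next
  case (WhileTrue e \<sigma> c \<omega> L1 k1 s1 p1 L2 k2 s2 p2)
  then have "val e \<tau> \<noteq> 0"
    using val_agree[of A e \<sigma> \<tau>] by simp
  then show ?case
    using WhileTrue by (intro exec.WhileTrue WhileTrue.IH agree_upd) auto
next
  case (Par m e \<sigma> c \<omega> x Ls ks ss ps)
  have m: "m = index (val e \<tau>)"
    using Par.hyps(1) Par.prems val_agree[of A e \<sigma> \<tau>] by simp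
  have "agree A (\<sigma>((x, 0) := real i)) (\<tau>((x, 0) := real i))" for i
    using Par.prems by (simp add: agree_def)
  then show ?case
    using Par.prems(1) by (intro exec.Par m Par.IH) (simp_all del: fun_upd_apply)
qed

lemma exec_writes:
  "exec c \<omega> \<sigma> L k s p \<Longrightarrow> uses A c \<Longrightarrow> dom L \<subseteq> A \<times> UNIV"
proof (induction rule: exec.induct)
  case (Par m e \<sigma> c \<omega> x Ls ks ss ps)
  then show ?case unfolding dom_merge by auto
qed auto

section \<open>Resource inequalities behind the lower bounds\<close>

lemma le_double_mult: "1 \<le> p \<Longrightarrow> a \<le> 2 * a * (p :: nat)"
  using mult_le_mono2[of 1 "2 * p" a] by simp

text \<open>Every written cell costs an operation, and \<open>p\<close> processors do at most
  \<open>p\<close> operations per time step. The factor 2 pays for the \<open>m\<close> activations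
  of a parallel loop, which count as work but not as span.\<close>

lemma exec_resources:
  "exec c \<omega> \<sigma> L k s p \<Longrightarrow>
    finite (dom L) \<and> card (dom L) \<le> k \<and> 1 \<le> s \<and> 1 \<le> p \<and> k \<le> 2 * s * p"
proof (induction rule: exec.induct)
  case (Seq c1 \<omega> \<sigma> L1 k1 s1 p1 c2 L2 k2 s2 p2)
  have "k1 \<le> 2 * s1 * max p1 p2" "k2 \<le> 2 * s2 * max p1 p2"
    using Seq.IH by (auto intro: order_trans)
  then have "k1 + k2 \<le> 2 * (s1 + s2) * max p1 p2"
    by (simp add: algebra_simps)
  moreover have "card (dom L2 \<union> dom L1) \<le> k1 + k2"
    using card_Un_le[of "dom L2" "dom L1"] Seq.IH by linarith
  ultimately show ?case using Seq.IH by auto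
next
  case (CondTrue e \<sigma> c1 \<omega> L k s p c2)
  have "1 + cost e \<le> 2 * (1 + cost e) * p"
    using CondTrue.IH by (intro le_double_mult) simp
  then have "1 + cost e + k \<le> 2 * (1 + cost e + s) * p"
    using CondTrue.IH by (simp add: algebra_simps)
  then show ?case using CondTrue.IH by auto
next
  case (CondFalse e \<sigma> c2 \<omega> L k s p c1)
  have "1 + cost e \<le> 2 * (1 + cost e) * p"
    using CondFalse.IH by (intro le_double_mult) simp
  then have "1 + cost e + k \<le> 2 * (1 + cost e + s) * p"
    using CondFalse.IH by (simp add: algebra_simps)
  then show ?case using CondFalse.IH by auto
next
  case (WhileTrue e \<sigma> c \<omega> L1 k1 s1 p1 L2 k2 s2 p2)
  have "1 + cost e \<le> 2 * (1 + cost e) * max p1 p2"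
    using WhileTrue.IH by (intro le_double_mult) (simp add: le_max_iff_disj)
  moreover have "k1 \<le> 2 * s1 * max p1 p2" "k2 \<le> 2 * s2 * max p1 p2"
    using WhileTrue.IH by (auto intro: order_trans)
  ultimately have "1 + cost e + k1 + k2 \<le> 2 * (1 + cost e + s1 + s2) * max p1 p2"
    by (simp add: algebra_simps)
  moreover have "card (dom L2 \<union> dom L1) \<le> k1 + k2"
    using card_Un_le[of "dom L2" "dom L1"] WhileTrue.IH by linarith
  ultimately show ?case using WhileTrue.IH by auto
next
  case (Par m e \<sigma> c \<omega> x Ls ks ss ps)
  define S where "S = Max (insert 0 (ss ` {..<m}))"
  define P where "P = max 1 (\<Sum>i<m. ps i)"
  have "card (\<Union>i<m. dom (Ls i)) \<le> (\<Sum>i<m. card (dom (Ls i)))"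
    by (rule card_UN_le) simp
  also have "\<dots> \<le> (\<Sum>i<m. ks i)"
    using Par.IH by (intro sum_mono) auto
  finally have w: "card (dom (merge m Ls)) \<le> (\<Sum>i<m. ks i)"
    unfolding dom_merge .
  have "(\<Sum>i<m. ks i) \<le> (\<Sum>i<m. 2 * S * ps i)"
  proof (rule sum_mono)
    fix i assume i: "i \<in> {..<m}"
    then have "ss i \<le> S"
      unfolding S_def by (intro Max_ge) auto
    then have "2 * ss i * ps i \<le> 2 * S * ps i" by simp
    moreover have "ks i \<le> 2 * ss i * ps i" using Par.IH i by simp
    ultimately show "ks i \<le> 2 * S * ps i" by (rule order_trans[rotated])
  qed
  also have "\<dots> \<le> 2 * S * P"
    unfolding sum_distrib_left[symmetric] P_def by simp
  finally have k: "(\<Sum>i<m. ks i) \<le> 2 * S * P" .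
  have "m \<le> (\<Sum>i<m. ps i)"
    using sum_mono[of "{..<m}" "\<lambda>_. 1" ps] Par.IH by auto
  then have "m \<le> P" "1 \<le> P"
    unfolding P_def by auto
  moreover have "1 + cost e \<le> (1 + cost e) * P" "P \<le> (1 + cost e) * P"
    using mult_le_mono2[OF \<open>1 \<le> P\<close>, of "1 + cost e"] by auto
  ultimately have "1 + cost e + m + (\<Sum>i<m. ks i) \<le> 2 * (1 + cost e + S) * P"
    using k by (simp add: algebra_simps)
  moreover have "finite (dom (merge m Ls))"
    unfolding dom_merge using Par.IH by auto
  ultimately show ?case
    using w \<open>1 \<le> P\<close> unfolding S_def[symmetric] P_def[symmetric] by auto
qed (auto simp del: fun_upd_apply)

text \<open>Array 2 is initially zero, so all output cells but one have to be written.\<close>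

lemma sorter_writes:
  assumes "exec S \<omega> (sort_input n K key) L k s p" "sorted_output n key (upd (sort_input n K key) L)"
  shows "n - 1 \<le> k"
proof -
  obtain \<pi> where \<pi>: "bij_betw \<pi> {..<n} {..<n}" "\<And>j. j < n \<Longrightarrow> upd (sort_input n K key) L (2, j) = real (\<pi> j)"
    using assms(2) unfolding sorted_output_def by blast
  let ?J = "{j. j < n \<and> \<pi> j \<noteq> 0}"
  have "{..<n} - {0} \<subseteq> \<pi> ` ?J"
  proof
    fix y assume y: "y \<in> {..<n} - {0}"
    then have "y \<in> \<pi> ` {..<n}"
      using \<pi>(1) by (simp add: bij_betw_def)
    with y show "y \<in> \<pi> ` ?J" by auto
  qed
  then have "card ({..<n} - {0}) \<le> card ?J"
    by (rule surj_card_le[rotated]) simp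
  moreover have "n - 1 \<le> card ({..<n} - {0})"
    by (cases "n = 0") (auto simp: card_Diff_singleton_if)
  moreover have "Pair (2 :: nat) ` ?J \<subseteq> dom L"
  proof
    fix a assume "a \<in> Pair (2 :: nat) ` ?J"
    then obtain j where "a = (2, j)" "j < n" "\<pi> j \<noteq> 0" by blast
    then have "upd (sort_input n K key) L (2, j) \<noteq> sort_input n K key (2, j)"
      using \<pi>(2)[of j] by (simp add: sort_input_def)
    then show "a \<in> dom L"
      using \<open>a = (2, j)\<close> by (auto simp: upd_def split: option.splits)
  qed
  then have "card (Pair (2::nat) ` ?J) \<le> card (dom L)"
    using exec_resources[OF assms(1)] by (intro card_mono) auto
  then have "card ?J \<le> k"
    using exec_resources[OF assms(1)] by (subst (asm) card_image) (auto simp: inj_on_def)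
  ultimately show ?thesis by linarith
qed

text \<open>From \<open>n - 1 \<le> 2 * s * p\<close> and \<open>s \<le> 2 powr (s - 1)\<close> the
  logarithm of \<open>n\<close> is at most 1 plus the span with start-up time. As that span is at
  least 1, the factor 3 absorbs the constants. The case \<open>n = 1\<close> is separate because the
  logarithm of \<open>n - 1\<close> is used.\<close>

lemma log_le_span:
  assumes "1 \<le> n" "n - 1 \<le> k" "k \<le> 2 * s * p" "1 \<le> s" "1 \<le> p"
  shows "1 + log 2 (real n) \<le> 3 * real (s + nat \<lceil>log 2 (real p)\<rceil>)"
proof (cases "n = 1")
  case True
  have "real s \<le> real (s + nat \<lceil>log 2 (real p)\<rceil>)"
    by (simp only: of_nat_le_iff le_add1)
  moreover have "1 \<le> real s" "log 2 (real n) = 0"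
    using assms(4) True by simp_all
  ultimately show ?thesis by (smt (verit))
next
  case False
  then have n: "2 \<le> n" using assms by simp
  have "real s \<le> 2 powr (real s - 1)"
    using assms(4)
  proof (induction s rule: dec_induct)
    case (step s)
    have "real (Suc s) \<le> 2 * real s" using step by simp
    also have "\<dots> \<le> 2 * 2 powr (real s - 1)" using step by simp
    also have "\<dots> = 2 powr (real (Suc s) - 1)" by (simp add: powr_diff)
    finally show ?case .
  qed simp
  then have "log 2 (real s) \<le> real s - 1"
    using assms(4) by (subst log_le_iff) auto
  moreover have "log 2 (real p) \<le> real (nat \<lceil>log 2 (real p)\<rceil>)"
    by linarith
  moreover have "log 2 (real (2 * s * p)) = 1 + log 2 (real s) + log 2 (real p)"
    using assms by (simp add: log_mult)
  moreover have "log 2 (real (n - 1)) \<le> log 2 (real (2 * s * p))"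
    using n assms by (intro log_mono) linarith+
  moreover have "log 2 (real n) \<le> log 2 (real (2 * (n - 1)))"
    using n by (intro log_mono) linarith+
  moreover have "log 2 (real (2 * (n - 1))) = 1 + log 2 (real (n - 1))"
    using n log_mult[of 2 "real (n - 1)" 2] by (simp add: mult.commute add.commute)
  ultimately have "log 2 (real n) \<le> 1 + real (s + nat \<lceil>log 2 (real p)\<rceil>)"
    by simp
  then show ?thesis using assms(4) by simp
qed

section \<open>Independence of the deviates of different subprograms\<close>

interpretation rand: prob_space rand
  unfolding rand_def by (intro prob_space_PiM prob_space_uniform_measure) auto

text \<open>Reindexing independent identically distributed coordinates injectively does not change
  their joint law. For prefixing by \<open>k\<close> this says that \<open>sub k\<close> preserves
  the measure.\<close>

lemma distr_rand_shift:
  assumes "inj f"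
  shows "distr rand rand (\<lambda>\<omega> p. \<omega> (f p)) = rand"
proof -
  have "distr (\<Pi>\<^sub>M p\<in>UNIV. uniform_measure lborel {0..1 :: real}) (\<Pi>\<^sub>M p\<in>UNIV. uniform_measure lborel {0..1})
      (\<lambda>\<omega>. \<lambda>n\<in>UNIV. \<omega> (f n)) = (\<Pi>\<^sub>M p\<in>UNIV. uniform_measure lborel {0..1})"
    using assms by (intro distr_PiM_reindex prob_space_uniform_measure) (auto simp: inj_on_def)
  then show ?thesis by (simp add: rand_def restrict_UNIV)
qed

lemma distr_sub: "distr rand rand (sub k) = rand"
  using distr_rand_shift[of "Cons k"] by (simp add: sub_def[abs_def])

lemma AE_sub: "AE \<omega> in rand. P \<omega> \<Longrightarrow> AE \<omega> in rand. P (sub k \<omega>)"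
  using AE_distrD[OF measurable_sub[of k], of P] by (simp only: distr_sub)

lemma nn_integral_sub:
  "f \<in> borel_measurable rand \<Longrightarrow> (\<integral>\<^sup>+\<omega>. f (sub k \<omega>) \<partial>rand) = (\<integral>\<^sup>+\<omega>. f \<omega> \<partial>rand)"
  using nn_integral_distr[OF measurable_sub, of f k] by (simp add: distr_sub)

lemma indep_coordinates: "rand.indep_vars (\<lambda>_. borel) (\<lambda>p \<omega>. \<omega> p) UNIV"
proof (subst rand.indep_vars_iff_distr_eq_PiM)
  have "distr rand borel (\<lambda>\<omega>. \<omega> p) = uniform_measure lborel {0..1}" for p
  proof -
    have "distr rand borel (\<lambda>\<omega>. \<omega> p) = distr rand (uniform_measure lborel {0..1}) (\<lambda>\<omega>. \<omega> p)"
      by (rule distr_cong) auto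
    also have "\<dots> = uniform_measure lborel {0..1}"
      unfolding rand_def by (rule distr_PiM_component) (auto intro: prob_space_uniform_measure)
    finally show ?thesis .
  qed
  then show "distr rand (Pi\<^sub>M UNIV (\<lambda>_. borel)) (\<lambda>x. \<lambda>i\<in>UNIV. x i) =
      Pi\<^sub>M UNIV (\<lambda>i. distr rand borel (\<lambda>\<omega>. \<omega> i))"
    using distr_id[of rand] distr_cong[OF refl sets_rand[symmetric], of rand "\<lambda>x. x" "\<lambda>x. x"]
    by (simp add: rand_def restrict_UNIV)
qed auto

text \<open>Nodes starting with 0 and nodes starting with 1 are disjoint families of independent
  coordinates.\<close>

lemma indep_sub: "rand.indep_var rand (sub 0) rand (sub 1)"
proof -
  let ?A = "range (Cons (0 :: nat))" and ?B = "range (Cons (1 :: nat))"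
  let ?f = "\<lambda>k x p. x (k # p) :: real"
  have m: "?f k \<in> measurable (Pi\<^sub>M (range (Cons k)) (\<lambda>_. borel)) rand" for k :: nat
    by (rule measurable_to_rand) auto
  have "rand.indep_var (Pi\<^sub>M ?A (\<lambda>_. borel)) (\<lambda>\<omega>. restrict (\<lambda>p. \<omega> p) ?A)
      (Pi\<^sub>M ?B (\<lambda>_. borel)) (\<lambda>\<omega>. restrict (\<lambda>p. \<omega> p) ?B)"
    by (rule rand.indep_var_restrict[OF indep_coordinates]) auto
  from rand.indep_var_compose[OF this m m]
  have "rand.indep_var rand (?f 0 \<circ> (\<lambda>\<omega>. restrict (\<lambda>p. \<omega> p) ?A))
      rand (?f 1 \<circ> (\<lambda>\<omega>. restrict (\<lambda>p. \<omega> p) ?B))" .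
  then show ?thesis
    by (simp add: sub_def[abs_def] o_def)
qed

lemma nn_integral_sub_mult:
  assumes [measurable]: "f \<in> borel_measurable rand" "g \<in> borel_measurable rand"
  shows "(\<integral>\<^sup>+\<omega>. f (sub 0 \<omega>) * g (sub 1 \<omega>) \<partial>rand) = (\<integral>\<^sup>+\<omega>. f \<omega> \<partial>rand) * (\<integral>\<^sup>+\<omega>. g \<omega> \<partial>rand)"
proof -
  interpret pair_sigma_finite rand rand ..
  have eq: "rand \<Otimes>\<^sub>M rand = distr rand (rand \<Otimes>\<^sub>M rand) (\<lambda>\<omega>. (sub 0 \<omega>, sub 1 \<omega>))"
    using indep_sub rand.indep_var_distribution_eq[of rand "sub 0" rand "sub 1"] by (simp add: distr_sub)
  have "(\<integral>\<^sup>+\<omega>. f (sub 0 \<omega>) * g (sub 1 \<omega>) \<partial>rand) =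
      (\<integral>\<^sup>+x. f (fst x) * g (snd x) \<partial>distr rand (rand \<Otimes>\<^sub>M rand) (\<lambda>\<omega>. (sub 0 \<omega>, sub 1 \<omega>)))"
    by (subst nn_integral_distr) auto
  also have "\<dots> = (\<integral>\<^sup>+x. f (fst x) * g (snd x) \<partial>(rand \<Otimes>\<^sub>M rand))"
    unfolding eq[symmetric] ..
  also have "\<dots> = (\<integral>\<^sup>+x. \<integral>\<^sup>+y. f x * g y \<partial>rand \<partial>rand)"
    by (subst rand.nn_integral_fst[symmetric]) auto
  also have "\<dots> = (\<integral>\<^sup>+\<omega>. f \<omega> \<partial>rand) * (\<integral>\<^sup>+\<omega>. g \<omega> \<partial>rand)"
    by (simp add: nn_integral_cmult nn_integral_multc)
  finally show ?thesis .
qed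

section \<open>The order of exponential arrival times\<close>

abbreviation unif :: "real measure" where
  "unif \<equiv> uniform_measure lborel {0..1}"

text \<open>An exponentially distributed time of rate \<open>l\<close>, for \<open>u\<close> uniformly distributed.\<close>

definition arrival :: "real \<Rightarrow> real \<Rightarrow> real" where
  "arrival l u = (0 - ln u) / l"

lemma measurable_arrival [measurable]: "arrival l \<in> borel_measurable borel"
  unfolding arrival_def by measurable

text \<open>The threshold \<open>x\<close> allows the event to be peeled from the front: the first
  time becomes the threshold of the remaining items.\<close>

primrec ascending :: "(nat \<Rightarrow> real) \<Rightarrow> real \<Rightarrow> nat list \<Rightarrow> (nat \<Rightarrow> real) \<Rightarrow> bool" where
  "ascending l x [] u \<longleftrightarrow> True"
| "ascending l x (a # s) u \<longleftrightarrow> x < arrival (l a) (u a) \<and> ascending l (arrival (l a) (u a)) s u"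

text \<open>The probability of the order \<open>s\<close> under successive weighted sampling
  (Plackett-Luce): each denominator is the weight of the items not drawn before.\<close>

primrec order_prob :: "(nat \<Rightarrow> real) \<Rightarrow> nat list \<Rightarrow> real" where
  "order_prob l [] = 1"
| "order_prob l (a # s) = l a / (\<Sum>i\<leftarrow>a # s. l i) * order_prob l s"

lemma ascending_cong: "(\<And>i. i \<in> set s \<Longrightarrow> u i = v i) \<Longrightarrow> ascending l x s u \<longleftrightarrow> ascending l x s v"
  by (induction s arbitrary: x) auto

lemma ascending_measurable:
  "f \<in> borel_measurable M \<Longrightarrow> (\<And>i. i \<in> set s \<Longrightarrow> (\<lambda>\<omega>. u \<omega> i) \<in> borel_measurable M) \<Longrightarrow>
    Measurable.pred M (\<lambda>\<omega>. ascending l (f \<omega>) s (u \<omega>))"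
proof (induction s arbitrary: f)
  case (Cons a s)
  have [measurable]: "f \<in> borel_measurable M" "(\<lambda>\<omega>. u \<omega> a) \<in> borel_measurable M"
    using Cons.prems by auto
  have [measurable]: "Measurable.pred M (\<lambda>\<omega>. ascending l (arrival (l a) (u \<omega> a)) s (u \<omega>))"
    using Cons.prems by (intro Cons.IH) auto
  show ?case by simp
qed simp

interpretation unif: prob_space unif
  by (rule prob_space_uniform_measure) auto

lemma measurable_unif_component [measurable (raw)]:
  "i \<in> I \<Longrightarrow> (\<lambda>u. u i) \<in> borel_measurable (\<Pi>\<^sub>M i\<in>I. unif)"
  using measurable_component_singleton[of i I "\<lambda>_. unif"]
  by (simp add: measurable_cong_sets[OF refl, of unif borel])

lemma nn_integral_unif:
  "f \<in> borel_measurable borel \<Longrightarrow> (\<integral>\<^sup>+u. f u \<partial>unif) = (\<integral>\<^sup>+u. f u * indicator {0..1} u \<partial>lborel)"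
  using mult_divide_eq_ennreal[of 1] by (subst nn_integral_uniform_measure) auto

text \<open>One step of the iterated integral. With \<open>u = exp (- l * t)\<close> the factor
  \<open>exp (- t * L)\<close> becomes \<open>u powr (L / l)\<close> and \<open>x < t\<close>
  becomes \<open>u < exp (- x * l)\<close>, so a power is integrated from 0 to
  \<open>c\<close>.\<close>

lemma nn_integral_arrival_tail:
  assumes "0 < l" "0 \<le> L" "0 \<le> x" "0 \<le> q"
  shows "(\<integral>\<^sup>+u. indicator {u. x < arrival l u} u * ennreal (exp (- arrival l u * L) * q) \<partial>unif) =
    ennreal (exp (- x * (l + L)) * (l / (l + L) * q))"
proof -
  define c where "c = exp (- x * l)"
  have c: "0 < c" "c \<le> 1" using assms by (auto simp: c_def)
  have "(\<integral>\<^sup>+u. indicator {u. x < arrival l u} u * ennreal (exp (- arrival l u * L) * q) \<partial>unif) =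
    (\<integral>\<^sup>+u. indicator {u. x < arrival l u} u * ennreal (exp (- arrival l u * L) * q) * indicator {0..1} u \<partial>lborel)"
    by (rule nn_integral_unif) measurable
  also have "\<dots> = (\<integral>\<^sup>+u. ennreal (u powr (L / l) * q) * indicator {0..c} u \<partial>lborel)"
  proof (rule nn_integral_cong_AE)
    \<comment> \<open>At 0 the logarithm has a default value, and at \<open>c\<close> the strict
      comparison differs from the closed interval; both points are null.\<close>
    have "AE u in lborel. u \<noteq> 0 \<and> u \<noteq> c"
      by (simp add: AE_conj_iff AE_lborel_singleton)
    then show "AE u in lborel. indicator {u. x < arrival l u} u * ennreal (exp (- arrival l u * L) * q) * indicator {0..1} u =
      ennreal (u powr (L / l) * q) * indicator {0..c} u"
    proof eventually_elim
      case (elim u)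
      show ?case
      proof (cases "0 < u")
        case True
        have "x < arrival l u \<longleftrightarrow> ln u < - x * l"
          using assms(1) by (simp add: arrival_def field_simps) linarith
        also have "\<dots> \<longleftrightarrow> u < c"
          unfolding c_def using True by (metis exp_less_cancel_iff exp_ln)
        finally have 1: "x < arrival l u \<longleftrightarrow> u < c" .
        have 2: "exp (- arrival l u * L) = u powr (L / l)"
          using True by (simp add: arrival_def powr_def mult.commute)
        show ?thesis
          using True c elim unfolding 2 by (auto simp: indicator_def 1)
      next
        case False
        then have "\<not> (0 \<le> u)" using elim by simp
        then show ?thesis by simp
      qed
    qed
  qed
  also have "\<dots> = ennreal (c powr (L / l + 1) / (L / l + 1) * q)"
  proof (rule nn_integral_has_integral_lebesgue')
    show "((\<lambda>u. u powr (L / l) * q) has_integral c powr (L / l + 1) / (L / l + 1) * q) {0..c}"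
    proof (intro has_integral_mult_left has_integral_powr_from_0)
      have "0 \<le> L / l" using assms by simp
      then show "- 1 < L / l" by linarith
    qed (use c in auto)
  qed (use assms in auto)
  also have "c powr (L / l + 1) / (L / l + 1) * q = exp (- x * (l + L)) * (l / (l + L) * q)"
  proof -
    have "c powr (L / l + 1) = exp (- x * (l + L))"
      unfolding c_def using assms(1) by (simp add: powr_def field_simps)
    moreover have "1 / (L / l + 1) = l / (l + L)"
      using assms(1) by (simp add: field_simps)
    ultimately show ?thesis by (metis mult.assoc times_divide_eq_right mult.right_neutral)
  qed
  finally show ?thesis .
qed

lemma order_prob_nonneg: "(\<And>i. i \<in> set s \<Longrightarrow> 0 \<le> l i) \<Longrightarrow> 0 \<le> order_prob l s"
  by (induction s) (auto intro!: mult_nonneg_nonneg divide_nonneg_nonneg add_nonneg_nonneg sum_list_nonneg)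

text \<open>Given the time \<open>y\<close> of the first item, the rest has to ascend beyond
  \<open>y\<close>, which is the same event with a new threshold. The factor with \<open>x\<close>,
  the probability that all times exceed the threshold, is needed for the induction; the claim of
  interest is \<open>x = 0\<close>.\<close>

lemma emeasure_ascending:
  assumes "distinct s" "\<And>i. i \<in> set s \<Longrightarrow> 0 < l i" "0 \<le> x"
  shows "emeasure (\<Pi>\<^sub>M i\<in>set s. unif) {u \<in> space (\<Pi>\<^sub>M i\<in>set s. unif). ascending l x s u} =
    ennreal (exp (- x * (\<Sum>i\<leftarrow>s. l i)) * order_prob l s)"
  using assms
proof (induction s arbitrary: x)
  case Nil
  then show ?case by (simp add: PiM_empty space_PiM)
next
  case (Cons a s)
  interpret product_sigma_finite "\<lambda>_. unif"
    by standard
  let ?P = "\<Pi>\<^sub>M i\<in>set s. unif" and ?P' = "\<Pi>\<^sub>M i\<in>insert a (set s). unif"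
  let ?L = "\<Sum>i\<leftarrow>s. l i" and ?q = "order_prob l s"
  have a: "a \<notin> set s" "0 < l a" using Cons.prems by auto
  have m: "{u \<in> space (\<Pi>\<^sub>M i\<in>I. unif). ascending l y t u} \<in> sets (\<Pi>\<^sub>M i\<in>I. unif)" if "set t \<subseteq> I" for I y t
    using that by (intro predE ascending_measurable) (auto intro: measurable_unif_component)
  have "emeasure ?P' {u \<in> space ?P'. ascending l x (a # s) u} =
    (\<integral>\<^sup>+u. indicator {u \<in> space ?P'. ascending l x (a # s) u} u \<partial>?P')"
    using m[of "a # s" "insert a (set s)" x] by simp
  \<comment> \<open>Tonelli: the coordinate of the first item is integrated last.\<close>
  also have "\<dots> = (\<integral>\<^sup>+y. \<integral>\<^sup>+u. indicator {u \<in> space ?P'. ascending l x (a # s) u} (u(a := y)) \<partial>?P \<partial>unif)"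
    using m[of "a # s" "insert a (set s)" x] a by (intro product_nn_integral_insert_rev) auto
  also have "\<dots> = (\<integral>\<^sup>+y. \<integral>\<^sup>+u. indicator {u. x < arrival (l a) u} y *
      indicator {u \<in> space ?P. ascending l (arrival (l a) y) s u} u \<partial>?P \<partial>unif)"
  proof (intro nn_integral_cong)
    fix y u assume u: "u \<in> space ?P"
    have "ascending l z s (u(a := y)) \<longleftrightarrow> ascending l z s u" for z
      using a by (intro ascending_cong) auto
    moreover have "u(a := y) \<in> space ?P'"
      using u by (simp add: space_PiM PiE_fun_upd)
    ultimately show "indicator {u \<in> space ?P'. ascending l x (a # s) u} (u(a := y)) =
      (indicator {u. x < arrival (l a) u} y * indicator {u \<in> space ?P. ascending l (arrival (l a) y) s u} u :: ennreal)"
      using u by (auto simp: indicator_def)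
  qed
  also have "\<dots> = (\<integral>\<^sup>+y. indicator {u. x < arrival (l a) u} y *
      emeasure ?P {u \<in> space ?P. ascending l (arrival (l a) y) s u} \<partial>unif)"
    using m[of s "set s"] by (subst nn_integral_cmult) auto
  also have "\<dots> = (\<integral>\<^sup>+y. indicator {u. x < arrival (l a) u} y * ennreal (exp (- arrival (l a) y * ?L) * ?q) \<partial>unif)"
    using Cons by (intro nn_integral_cong) (auto simp: indicator_def)
  also have "\<dots> = ennreal (exp (- x * (l a + ?L)) * (l a / (l a + ?L) * ?q))"
  proof (rule nn_integral_arrival_tail)
    show "0 \<le> ?L" using Cons.prems(2) by (intro sum_list_nonneg) (auto intro: less_imp_le)
    show "0 \<le> ?q" using Cons.prems(2) by (intro order_prob_nonneg) (auto intro: less_imp_le)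
  qed (use Cons.prems a in auto)
  finally show ?case by simp
qed

section \<open>The density of the weighted random permutation\<close>

text \<open>A list determines its prefix, so only the summand for \<open>t\<close> survives in the
  bind.\<close>

lemma pmf_draws_snoc:
  "pmf (draws w n (Suc l)) (t @ [i]) = pmf (draws w n l) t * pmf (next_item w n t) i"
proof -
  have "pmf (map_pmf (\<lambda>i. t' @ [i]) (next_item w n t')) (t @ [i]) =
      indicator {t} t' * pmf (next_item w n t) i" for t'
  proof (cases "t' = t")
    case True
    then show ?thesis
      using pmf_map_inj'[of "\<lambda>i. t @ [i]" "next_item w n t" i] by (simp add: inj_on_def)
  next
    case False
    then have "t @ [i] \<notin> set_pmf (map_pmf (\<lambda>i. t' @ [i]) (next_item w n t'))"
      by auto
    then have "pmf (map_pmf (\<lambda>i. t' @ [i]) (next_item w n t')) (t @ [i]) = 0"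
      by (simp only: set_pmf_iff not_not)
    then show ?thesis using False by simp
  qed
  then have "pmf (draws w n (Suc l)) (t @ [i]) =
      measure_pmf.expectation (draws w n l) (\<lambda>t'. indicator {t} t' * pmf (next_item w n t) i)"
    by (simp add: pmf_bind)
  then show ?thesis by (simp add: pmf.rep_eq)
qed

text \<open>\<open>draws\<close> grows at the end whereas \<open>order_prob\<close> recurses at the
  front. Moving items one by one from the suffix \<open>s\<close> to the drawn prefix
  \<open>r\<close> reconciles the two.\<close>

lemma pmf_draws_append:
  assumes "\<forall>i\<in>{1..n}. 0 < w i" "distinct (r @ s)" "set (r @ s) = {1..n}"
  shows "pmf (draws w n (length (r @ s))) (r @ s) = pmf (draws w n (length r)) r * order_prob w s"
  using assms(2,3)
proof (induction s arbitrary: r)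
  case (Cons a s)
  have "(\<Sum>j = 1..n. w j) = sum w (set (r @ a # s))"
    using Cons.prems by simp
  also have "\<dots> = (\<Sum>j\<leftarrow>r @ a # s. w j)"
    using Cons.prems by (intro sum_list_distinct_conv_sum_set[symmetric]) auto
  finally have W: "(\<Sum>j = 1..n. w j) - (\<Sum>j\<leftarrow>r. w j) = (\<Sum>j\<leftarrow>a # s. w j)"
    by simp
  have "pmf (draws w n (length (r @ a # s))) (r @ a # s) =
      pmf (draws w n (length (r @ [a]))) (r @ [a]) * order_prob w s"
    using Cons.IH[of "r @ [a]"] Cons.prems by simp
  also have "pmf (draws w n (length (r @ [a]))) (r @ [a]) =
      pmf (draws w n (length r)) r * pmf (next_item w n r) a"
    by (simp del: draws.simps add: pmf_draws_snoc)
  also have "pmf (next_item w n r) a = w a / (\<Sum>j\<leftarrow>a # s. w j)"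
  proof -
    have "a \<in> {1..n} - set r" "distinct r" "set r \<subset> {1..n}"
      using Cons.prems by auto
    then show ?thesis
      using pmf_next_item[OF assms(1), of r a] W by simp
  qed
  finally show ?case by simp
qed simp

lemma pmf_weighted_random_permutation:
  assumes "\<forall>i\<in>{1..n}. 0 < w i" "distinct t" "set t = {1..n}"
  shows "pmf (weighted_random_permutation w n) t = order_prob w t"
proof -
  have "length t = n"
    using assms by (metis card_atLeastAtMost diff_Suc_1 distinct_card)
  then show ?thesis
    using pmf_draws_append[of n w "[]" t] assms by (simp add: weighted_random_permutation_def)
qed

lemma set_pmf_draws:
  assumes "\<forall>i\<in>{1..n}. 0 < w i" "l \<le> n" "t \<in> set_pmf (draws w n l)"
  shows "length t = l \<and> distinct t \<and> set t \<subseteq> {1..n}"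
  using assms(2,3)
proof (induction l arbitrary: t)
  case (Suc l)
  then obtain r i where t: "t = r @ [i]" "r \<in> set_pmf (draws w n l)" "i \<in> set_pmf (next_item w n r)"
    by auto
  have r: "length r = l" "distinct r" "set r \<subseteq> {1..n}"
    using Suc.IH[OF _ t(2)] Suc.prems by auto
  \<comment> \<open>Some item must be left over: only then are the weights in
    \<open>next_item\<close> normalised and \<open>pmf_next_item\<close> applicable.\<close>
  have "card (set r) < card {1..n}"
    using r Suc.prems distinct_card[of r] by simp
  then have "set r \<subset> {1..n}"
    using r(3) by auto
  with t(3) have "i \<in> {1..n} - set r"
    using pmf_next_item[OF assms(1) r(2), of i] by (auto simp: set_pmf_iff split: if_splits)
  then show ?case using r t(1) by auto
qed simp

lemma set_pmf_weighted_random_permutation: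
  assumes "\<forall>i\<in>{1..n}. 0 < w i"
  shows "set_pmf (weighted_random_permutation w n) \<subseteq> {t. distinct t \<and> set t = {1..n}}"
proof
  fix t assume "t \<in> set_pmf (weighted_random_permutation w n)"
  then have t: "length t = n" "distinct t" "set t \<subseteq> {1..n}"
    using set_pmf_draws[OF assms, of n t] by (auto simp: weighted_random_permutation_def)
  then have "set t = {1..n}"
    by (intro card_subset_eq) (auto simp: distinct_card)
  with t show "t \<in> {t. distinct t \<and> set t = {1..n}}" by simp
qed

lemma order_prob_map_Suc: "order_prob w (map Suc s) = order_prob (\<lambda>i. w (Suc i)) s"
  by (induction s) (simp_all add: o_def)

section \<open>Bucket sizes\<close>

text \<open>Arrival times are bucketed on a logarithmic scale, with \<open>n\<close> buckets per factor \<open>e\<close>.\<close>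

definition bucket :: "nat \<Rightarrow> nat \<Rightarrow> real \<Rightarrow> real \<Rightarrow> nat" where
  "bucket n K m v = min K (nat \<lfloor>real n * ln (v * m * real n)\<rfloor>)"

lemma measurable_bucket [measurable]: "bucket n K m \<in> measurable borel (count_space UNIV)"
  unfolding bucket_def by measurable

lemma bucket_mono:
  assumes "0 < m" "0 < n" "0 < v" "v \<le> v'"
  shows "bucket n K m v \<le> bucket n K m v'"
proof -
  have "real n * ln (v * m * real n) \<le> real n * ln (v' * m * real n)"
    using assms by (intro mult_left_mono ln_mono) auto
  then show ?thesis
    unfolding bucket_def by (intro min.mono nat_mono floor_mono) auto
qed

text \<open>The end points of the unit interval, where \<open>arrival\<close> or its logarithm is
  degenerate, form a null set and can be ignored.\<close>

lemma emeasure_unif_le: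
  assumes "A \<in> sets borel" "A \<inter> {0<..<1} \<subseteq> {a..b}" "a \<le> b"
  shows "emeasure unif A \<le> ennreal (b - a)"
proof -
  have "emeasure unif A = emeasure lborel ({0..1} \<inter> A)"
    using assms(1) mult_divide_eq_ennreal[of 1] by (subst emeasure_uniform_measure) auto
  also have "\<dots> \<le> emeasure lborel ({a..b} \<union> {0, 1})"
    using assms by (intro emeasure_mono) (auto simp: subset_eq)
  also have "\<dots> \<le> emeasure lborel {a..b} + emeasure lborel {0, 1 :: real}"
    by (rule emeasure_subadditive) auto
  also have "emeasure lborel {0, 1 :: real} = 0"
    by (intro emeasure_lborel_countable) auto
  finally show ?thesis using assms(3) by simp
qed

text \<open>Here \<open>- ln u\<close> is a standard exponential variable, scaled by \<rho> = m / l,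
  which lies between 1 and U. The lowest bucket forces it below 3 / n since \<rho> is at least 1,
  the highest forces it above n / 3 since \<rho> is at most U, and an inner bucket is an interval of
  length 1 / n on the logarithmic scale, where the density is bounded.\<close>

lemma emeasure_bucket:
  assumes n: "1 \<le> n" and l: "0 < l" "l \<le> m" "m / l \<le> U"
    and K: "K = nat \<lfloor>2 * real n * ln (real n * U)\<rfloor>"
  shows "emeasure unif {u. bucket n K m (arrival l u) = \<kappa>} \<le> ennreal (3 / real n)"
\<comment> \<open>For \<open>n = 1\<close> the bound exceeds 1. From \<open>n \<ge> 2\<close>
  follows \<open>K \<ge> 1\<close>, so that the lowest and the highest bucket are different.\<close>
proof (cases "n = 1")
  case True
  have "emeasure unif {u. bucket n K m (arrival l u) = \<kappa>} \<le> 1"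
    by (rule unif.emeasure_le_1)
  also have "\<dots> \<le> ennreal (3 / real n)" using True by simp
  finally show ?thesis .
next
  case False
  then have n2: "2 \<le> n" using n by simp
  define \<rho> where "\<rho> = m / l"
  have \<rho>: "1 \<le> \<rho>" "\<rho> \<le> U" using l by (auto simp: \<rho>_def)
  have nU: "real n \<le> real n * U" using \<rho> n by simp
  have x: "arrival l u * m * real n = - ln u * \<rho> * real n" for u
    by (simp add: arrival_def \<rho>_def)
  have K_ge: "2 * real n * ln (real n * U) - 1 < real K"
    unfolding K by linarith
  have "2 / 3 \<le> ln (real n * U)"
  proof -
    have "2 \<le> real n * U" using nU n2 by linarith
    then have "ln 2 \<le> ln (real n * U)" by (intro ln_mono) auto
    then show ?thesis using ln2_ge_two_thirds by linarith
  qed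
  then have "2 * 2 * (2 / 3) \<le> 2 * real n * ln (real n * U)"
    using n2 by (intro mult_mono) auto
  then have "1 \<le> K" using K_ge by linarith
  have A: "{u. bucket n K m (arrival l u) = \<kappa>} \<in> sets borel"
    by measurable
  consider "\<kappa> = 0" | "\<kappa> = K" "0 < \<kappa>" | "0 < \<kappa>" "\<kappa> < K" | "K < \<kappa>"
    by linarith
  then show ?thesis
  proof cases
    case 1
    have "{u. bucket n K m (arrival l u) = \<kappa>} \<inter> {0<..<1} \<subseteq> {1 - 3 / real n..1}"
    proof
      fix u assume u: "u \<in> {u. bucket n K m (arrival l u) = \<kappa>} \<inter> {0<..<1}"
      let ?y = "- ln u * \<rho> * real n"
      have E: "0 < - ln u" using u by simp
      have y: "0 < ?y" using E \<rho> n by (intro mult_pos_pos) auto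
      \<comment> \<open>\<open>nat\<close> sends all negative values to bucket 0, which therefore
        gives an upper bound on the time only.\<close>
      have "nat \<lfloor>real n * ln ?y\<rfloor> = 0"
        using u 1 \<open>1 \<le> K\<close> unfolding bucket_def x by (auto simp: min_def split: if_splits)
      then have "real n * ln ?y < 1"
        by linarith
      moreover have "ln ?y \<le> real n * ln ?y" if "0 < ln ?y"
        using that n by simp
      ultimately have "ln ?y \<le> 1"
        by linarith
      then have "?y \<le> exp 1"
        using y by (metis exp_le_cancel_iff exp_ln)
      also have "\<dots> \<le> 3" by (rule exp_le)
      finally have "- ln u * \<rho> * real n \<le> 3" .
      moreover have "- ln u * 1 * real n \<le> - ln u * \<rho> * real n"
        using E \<rho> by (intro mult_right_mono mult_left_mono) auto
      ultimately have "- ln u * real n \<le> 3"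
        by linarith
      then have "- ln u \<le> 3 / real n"
        using n by (subst pos_le_divide_eq) auto
      moreover have "ln u \<le> u - 1"
        using u by (intro ln_le_minus_one) auto
      ultimately show "u \<in> {1 - 3 / real n..1}"
        using u by auto
    qed
    then show ?thesis using emeasure_unif_le[OF A] by fastforce
  next
    case 2
    have "{u. bucket n K m (arrival l u) = \<kappa>} \<inter> {0<..<1} \<subseteq> {0..3 / real n}"
    proof
      fix u assume u: "u \<in> {u. bucket n K m (arrival l u) = \<kappa>} \<inter> {0<..<1}"
      let ?y = "- ln u * \<rho> * real n"
      have E: "0 < - ln u" using u by simp
      have y: "0 < ?y" using E \<rho> n by (intro mult_pos_pos) auto
      have "K \<le> nat \<lfloor>real n * ln ?y\<rfloor>"
        using u 2 unfolding bucket_def x by auto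
      then have "real K \<le> real n * ln ?y"
        using \<open>1 \<le> K\<close> by linarith
      \<comment> \<open>The rounding error 1 in \<open>K\<close> is weakened to \<open>n\<close>, so
        that after division by \<open>n\<close> it costs a factor \<open>exp 1\<close> only.\<close>
      then have "real n * (2 * ln (real n * U)) - real n * 1 < real n * ln ?y"
        using K_ge n by simp
      then have "2 * ln (real n * U) - 1 < ln ?y"
        using n by (simp only: right_diff_distrib[symmetric] mult_less_cancel_left_pos of_nat_0_less_iff)
      then have "exp (2 * ln (real n * U) - 1) \<le> ?y"
        using y by (metis exp_le_cancel_iff exp_ln less_imp_le)
      moreover have "exp (2 * ln (real n * U) - 1) = (real n * U)\<^sup>2 / exp 1"
        using nU n2 by (simp add: exp_diff exp_double)
      ultimately have "(real n * U)\<^sup>2 \<le> ?y * exp 1"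
        by (simp add: divide_le_eq)
      also have "\<dots> \<le> ?y * 3"
        using y exp_le by (intro mult_left_mono) auto
      also have "\<dots> \<le> - ln u * U * real n * 3"
        using E \<rho> by (intro mult_right_mono mult_left_mono) auto
      finally have "(real n * U) * (real n * U) \<le> (real n * U) * (3 * - ln u)"
        by (simp add: power2_eq_square algebra_simps)
      then have "real n * U \<le> 3 * - ln u"
        using nU n2 by (subst (asm) mult_le_cancel_left_pos) auto
      then have "real n / 3 \<le> - ln u" using nU by linarith
      then have "u \<le> exp (- (real n / 3))"
        using u by (metis Int_iff exp_le_cancel_iff exp_ln greaterThanLessThan_iff le_minus_iff)
      also have "\<dots> = 1 / exp (real n / 3)"
        by (simp add: exp_minus field_simps)
      also have "\<dots> \<le> 1 / (real n / 3)"
        using exp_ge_add_one_self[of "real n / 3"] n by (intro divide_left_mono mult_pos_pos) linarith+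
      finally show "u \<in> {0..3 / real n}"
        using u by auto
    qed
    then show ?thesis using emeasure_unif_le[OF A] by fastforce
  next
    case 3
    define \<alpha> where "\<alpha> = exp (real \<kappa> / real n) / (\<rho> * real n)"
    define \<beta> where "\<beta> = \<alpha> * exp (1 / real n)"
    have pos: "0 < \<rho> * real n" using \<rho> n by (intro mult_pos_pos) auto
    have \<alpha>: "0 < \<alpha>" unfolding \<alpha>_def using pos by simp
    have \<alpha>\<beta>: "\<alpha> \<le> \<beta>" unfolding \<beta>_def using \<alpha> by simp
    have sub: "{u. bucket n K m (arrival l u) = \<kappa>} \<inter> {0<..<1} \<subseteq> {exp (- \<beta>)..exp (- \<alpha>)}"
    proof
      fix u assume u: "u \<in> {u. bucket n K m (arrival l u) = \<kappa>} \<inter> {0<..<1}"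
      let ?y = "- ln u * \<rho> * real n"
      have E: "0 < - ln u" using u by simp
      have y: "0 < ?y" using E \<rho> n by (intro mult_pos_pos) auto
      have "nat \<lfloor>real n * ln ?y\<rfloor> = \<kappa>"
        using u 3 unfolding bucket_def x by auto
      then have "real \<kappa> \<le> real n * ln ?y" "real n * ln ?y \<le> real \<kappa> + 1"
        using 3 by linarith+
      then have "real \<kappa> / real n \<le> ln ?y" "ln ?y \<le> real \<kappa> / real n + 1 / real n"
        using n by (auto simp: field_simps)
      then have "exp (real \<kappa> / real n) \<le> ?y" "?y \<le> exp (real \<kappa> / real n + 1 / real n)"
        using y by (metis exp_le_cancel_iff exp_ln)+
      then have "\<alpha> \<le> - ln u" "- ln u \<le> \<beta>"
        using pos unfolding \<alpha>_def \<beta>_def exp_add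
        by (simp_all add: pos_divide_le_eq pos_le_divide_eq mult.assoc)
      then have "exp (- \<beta>) \<le> exp (ln u)" "exp (ln u) \<le> exp (- \<alpha>)"
        unfolding exp_le_cancel_iff by linarith+
      moreover have "exp (ln u) = u" using u by simp
      ultimately show "u \<in> {exp (- \<beta>)..exp (- \<alpha>)}"
        unfolding atLeastAtMost_iff by metis
    qed
    \<comment> \<open>Factoring out \<open>exp (- \<alpha>)\<close> leaves a term of the form
      \<open>1 - exp (- x)\<close>, which is at most x. What results is \<alpha> exp(-\<alpha>), at
      most 1, times the relative width exp(1/n) - 1 of the bucket, at most 2/n.\<close>
    have "exp (- \<alpha>) - exp (- \<beta>) = exp (- \<alpha>) * (1 - exp (- (\<beta> - \<alpha>)))"
      by (simp add: algebra_simps flip: exp_add)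
    also have "\<dots> \<le> exp (- \<alpha>) * (\<beta> - \<alpha>)"
      by (intro mult_left_mono) (use exp_ge_add_one_self[of "- (\<beta> - \<alpha>)"] in linarith, simp)
    also have "\<dots> = (exp (- \<alpha>) * \<alpha>) * (exp (1 / real n) - 1)"
      unfolding \<beta>_def by (simp add: algebra_simps)
    also have "\<dots> \<le> 1 * (2 / real n)"
    proof (rule mult_mono)
      have "\<alpha> \<le> exp \<alpha>" using exp_ge_add_one_self[of \<alpha>] by linarith
      then show "exp (- \<alpha>) * \<alpha> \<le> 1" by (simp add: exp_minus field_simps)
      have "exp (1 / real n) \<le> 1 + 1 / real n + (1 / real n)\<^sup>2"
        using n by (intro exp_bound) auto
      moreover have "(1 / real n)\<^sup>2 \<le> 1 / real n"
        using n by (simp add: power2_eq_square field_simps)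
      ultimately show "exp (1 / real n) - 1 \<le> 2 / real n" by simp
    qed (use \<alpha> in auto)
    also have "\<dots> \<le> 3 / real n" using n by (simp add: field_simps)
    finally have "ennreal (exp (- \<alpha>) - exp (- \<beta>)) \<le> ennreal (3 / real n)"
      by (rule ennreal_leI)
    then show ?thesis using emeasure_unif_le[OF A sub] \<alpha>\<beta> by (auto intro: order_trans)
  next
    case 4
    then have "{u. bucket n K m (arrival l u) = \<kappa>} = {}"
      by (auto simp: bucket_def)
    then show ?thesis by simp
  qed
qed

text \<open>The exponential moment bounds both the total and the maximal bucket size.\<close>

lemma nn_integral_collisions:
  fixes h :: "nat \<Rightarrow> real \<Rightarrow> nat"
  assumes n: "1 \<le> n" and h[measurable]: "\<And>i. h i \<in> measurable borel (count_space UNIV)"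
    and K: "\<And>i u. h i u \<le> K"
    and q: "\<And>i \<kappa>. i < n \<Longrightarrow> emeasure unif {u. h i u = \<kappa>} \<le> ennreal (3 / real n)"
  shows "(\<integral>\<^sup>+u. ennreal (\<Sum>j<n. 2 ^ card {i. i < n \<and> i \<noteq> j \<and> h i (u i) = h j (u j)})
    \<partial>(\<Pi>\<^sub>M i\<in>{..<n}. unif)) \<le> ennreal (27 * real n)"
proof -
  interpret product_sigma_finite "\<lambda>_ :: nat. unif"
    by standard
  define A where "A = (\<lambda>i \<kappa>. {u. h i u = \<kappa>})"
  have A [measurable]: "A i \<kappa> \<in> sets borel" for i \<kappa>
    unfolding A_def by measurable
  \<comment> \<open>The factor of item \<open>j\<close> tests whether its key is \<kappa>; that of
    any other item doubles if its key is \<kappa>. The product over all items is thus the power of 2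
    in question if \<open>j\<close> has key \<kappa>, and 0 otherwise; summing over \<kappa> makes
    the integrand a sum of products over independent coordinates.\<close>
  define g where "g = (\<lambda>j \<kappa> i u. if i = j then indicator (A i \<kappa>) u else 1 + indicator (A i \<kappa>) u :: ennreal)"
  have g [measurable]: "g j \<kappa> i \<in> borel_measurable borel" for j \<kappa> i
    unfolding g_def by measurable
  have g': "g j \<kappa> i \<in> borel_measurable unif" for j \<kappa> i
    using g by (simp cong: measurable_cong_sets)
  have expand: "ennreal (2 ^ card {i. i < n \<and> i \<noteq> j \<and> h i (u i) = h j (u j)}) =
      (\<Sum>\<kappa>\<le>K. \<Prod>i<n. g j \<kappa> i (u i))" if j: "j < n" for j u
  proof -
    have "(\<Prod>i<n. g j \<kappa> i (u i)) = (if \<kappa> = h j (u j)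
        then ennreal (2 ^ card {i. i < n \<and> i \<noteq> j \<and> h i (u i) = h j (u j)}) else 0)" for \<kappa>
    proof (cases "\<kappa> = h j (u j)")
      case True
      have "(\<Prod>i<n. g j \<kappa> i (u i)) = (\<Prod>i<n. if i \<noteq> j \<and> h i (u i) = h j (u j) then 2 else 1)"
        by (intro prod.cong) (auto simp: g_def A_def True one_add_one)
      also have "\<dots> = (\<Prod>i\<in>{i. i < n \<and> i \<noteq> j \<and> h i (u i) = h j (u j)}. 2)"
        by (subst prod.If_cases) (auto intro!: prod.cong arg_cong[where f = "\<lambda>A. 2 ^ card A"])
      finally show ?thesis using True by (simp add: ennreal_power flip: ennreal_numeral)
    next
      case False
      then have "g j \<kappa> j (u j) = 0" by (simp add: g_def A_def)
      then show ?thesis using False j by (auto intro: prod_zero)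
    qed
    then show ?thesis using K by simp
  qed
  have int: "(\<integral>\<^sup>+u. ennreal (2 ^ card {i. i < n \<and> i \<noteq> j \<and> h i (u i) = h j (u j)})
      \<partial>(\<Pi>\<^sub>M i\<in>{..<n}. unif)) \<le> ennreal 27" if j: "j < n" for j
  proof -
    have "(\<integral>\<^sup>+u. ennreal (2 ^ card {i. i < n \<and> i \<noteq> j \<and> h i (u i) = h j (u j)}) \<partial>(\<Pi>\<^sub>M i\<in>{..<n}. unif)) =
      (\<Sum>\<kappa>\<le>K. \<integral>\<^sup>+u. (\<Prod>i<n. g j \<kappa> i (u i)) \<partial>(\<Pi>\<^sub>M i\<in>{..<n}. unif))"
      unfolding expand[OF j] by (intro nn_integral_sum) measurable
    also have "\<dots> = (\<Sum>\<kappa>\<le>K. \<Prod>i<n. \<integral>\<^sup>+u. g j \<kappa> i u \<partial>unif)"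
      by (intro sum.cong refl product_nn_integral_prod g') auto
    \<comment> \<open>Each of the \<open>n - 1\<close> other factors has mean at most
      \<open>1 + 3 / n \<le> exp (3 / n)\<close>. The events for the key of \<open>j\<close> are
      disjoint, so \<open>exp 3 \<le> 27\<close> remains.\<close>
    also have "\<dots> \<le> (\<Sum>\<kappa>\<le>K. emeasure unif (A j \<kappa>) * ennreal (exp 3))"
    proof (rule sum_mono)
      fix \<kappa>
      have "(\<Prod>i<n. \<integral>\<^sup>+u. g j \<kappa> i u \<partial>unif) =
          (\<integral>\<^sup>+u. g j \<kappa> j u \<partial>unif) * (\<Prod>i\<in>{..<n} - {j}. \<integral>\<^sup>+u. g j \<kappa> i u \<partial>unif)"
        using j by (intro prod.remove) auto
      also have "(\<integral>\<^sup>+u. g j \<kappa> j u \<partial>unif) = emeasure unif (A j \<kappa>)"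
        by (simp add: g_def)
      also have "(\<Prod>i\<in>{..<n} - {j}. \<integral>\<^sup>+u. g j \<kappa> i u \<partial>unif) \<le> (\<Prod>i\<in>{..<n} - {j}. ennreal (exp (3 / real n)))"
      proof (rule prod_mono_ennreal)
        fix i assume "i \<in> {..<n} - {j}"
        then have i: "i < n" "i \<noteq> j" by auto
        have "(\<integral>\<^sup>+u. g j \<kappa> i u \<partial>unif) = 1 + emeasure unif (A i \<kappa>)"
        proof -
          have "A i \<kappa> \<in> sets unif" by simp
          moreover have "(\<integral>\<^sup>+u. g j \<kappa> i u \<partial>unif) = (\<integral>\<^sup>+u. 1 + indicator (A i \<kappa>) u \<partial>unif)"
            using i by (simp add: g_def)
          ultimately show ?thesis
            by (simp only: nn_integral_add[OF borel_measurable_const borel_measurable_indicator]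
              nn_integral_const nn_integral_indicator unif.emeasure_space_1 mult_1)
        qed
        also have "\<dots> \<le> 1 + ennreal (3 / real n)"
          unfolding A_def by (intro add_left_mono q i)
        also have "\<dots> = ennreal (1 + 3 / real n)"
          by simp
        also have "\<dots> \<le> ennreal (exp (3 / real n))"
          by (intro ennreal_leI exp_ge_add_one_self)
        finally show "(\<integral>\<^sup>+u. g j \<kappa> i u \<partial>unif) \<le> ennreal (exp (3 / real n))" .
      qed
      also have "\<dots> = ennreal (exp (3 / real n) ^ (n - 1))"
        using j by (simp add: ennreal_power)
      also have "\<dots> \<le> ennreal (exp 3)"
      proof (rule ennreal_leI)
        have "exp (3 / real n) ^ (n - 1) \<le> exp (3 / real n) ^ n"
          by (intro power_increasing) auto
        also have "\<dots> = exp 3"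
          using n by (simp flip: exp_of_nat_mult)
        finally show "exp (3 / real n) ^ (n - 1) \<le> exp (3 :: real)" .
      qed
      finally show "(\<Prod>i<n. \<integral>\<^sup>+u. g j \<kappa> i u \<partial>unif) \<le> emeasure unif (A j \<kappa>) * ennreal (exp 3)"
        by (simp add: mult_left_mono)
    qed
    also have "\<dots> = (\<Sum>\<kappa>\<le>K. emeasure unif (A j \<kappa>)) * ennreal (exp 3)"
      by (simp add: sum_distrib_right)
    also have "(\<Sum>\<kappa>\<le>K. emeasure unif (A j \<kappa>)) = emeasure unif (\<Union>\<kappa>\<le>K. A j \<kappa>)"
      by (intro sum_emeasure) (auto simp: A_def disjoint_family_on_def)
    also have "\<dots> \<le> 1" by (rule unif.emeasure_le_1)
    also have "exp 3 = (exp 1 :: real) ^ 3"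
      by (simp flip: exp_of_nat_mult)
    also have "ennreal \<dots> \<le> ennreal 27"
      using power_mono[OF exp_le, of 3] by (intro ennreal_leI) auto
    finally show ?thesis by (simp add: mult_right_mono)
  qed
  have "(\<integral>\<^sup>+u. ennreal (\<Sum>j<n. 2 ^ card {i. i < n \<and> i \<noteq> j \<and> h i (u i) = h j (u j)})
      \<partial>(\<Pi>\<^sub>M i\<in>{..<n}. unif)) =
    (\<integral>\<^sup>+u. (\<Sum>j<n. \<Sum>\<kappa>\<le>K. \<Prod>i<n. g j \<kappa> i (u i)) \<partial>(\<Pi>\<^sub>M i\<in>{..<n}. unif))"
    by (intro nn_integral_cong) (simp add: expand flip: sum_ennreal)
  also have "\<dots> = (\<Sum>j<n. \<integral>\<^sup>+u. (\<Sum>\<kappa>\<le>K. \<Prod>i<n. g j \<kappa> i (u i)) \<partial>(\<Pi>\<^sub>M i\<in>{..<n}. unif))"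
    by (intro nn_integral_sum) measurable
  also have "\<dots> \<le> (\<Sum>j<n. ennreal 27)"
    using int by (intro sum_mono) (simp add: expand)
  also have "\<dots> = ennreal (27 * real n)"
    by (simp add: ennreal_mult ennreal_of_nat_eq_real_of_nat mult.commute)
  finally show ?thesis .
qed

section \<open>Running programs\<close>

text \<open>A total-correctness triple with budgets for work, span and processors. Upper bounds
  instead of exact values let the budgets be rounded up generously at each composition.\<close>

definition runs :: "com \<Rightarrow> source \<Rightarrow> store \<Rightarrow> nat \<Rightarrow> nat \<Rightarrow> nat \<Rightarrow> (store \<Rightarrow> bool) \<Rightarrow> bool" where
  "runs c \<omega> \<sigma> k s p Q \<longleftrightarrow>
    (\<exists>L k' s' p'. exec c \<omega> \<sigma> L k' s' p' \<and> k' \<le> k \<and> s' \<le> s \<and> p' \<le> p \<and> Q (upd \<sigma> L))"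

lemma upd_empty [simp]: "upd \<sigma> Map.empty = \<sigma>"
  by (simp add: upd_def)

lemma upd_single [simp]: "upd \<sigma> [a \<mapsto> v] = \<sigma>(a := v)"
  by (auto simp: upd_def)

lemma upd_map_add: "upd \<sigma> (L1 ++ L2) = upd (upd \<sigma> L1) L2"
  by (auto simp: upd_def map_add_def split: option.splits)

lemma runs_Assign:
  assumes "Q (\<sigma>((x, index (val i \<sigma>)) := val e \<sigma>))" "1 + cost i + cost e \<le> k"
    "1 + cost i + cost e \<le> s" "1 \<le> p"
  shows "runs (Assign x i e) \<omega> \<sigma> k s p Q"
  unfolding runs_def using exec.Assign[of x i e \<omega> \<sigma>] assms by (metis upd_single)

lemma runs_Seq:
  assumes "runs c1 (sub 0 \<omega>) \<sigma> k1 s1 p1 R" "\<And>\<tau>. R \<tau> \<Longrightarrow> runs c2 (sub 1 \<omega>) \<tau> k2 s2 p2 Q"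
    "k1 + k2 \<le> k" "s1 + s2 \<le> s" "p1 \<le> p" "p2 \<le> p"
  shows "runs (Seq c1 c2) \<omega> \<sigma> k s p Q"
proof -
  obtain L1 k1' s1' p1' where 1: "exec c1 (sub 0 \<omega>) \<sigma> L1 k1' s1' p1'" "k1' \<le> k1" "s1' \<le> s1"
    "p1' \<le> p1" "R (upd \<sigma> L1)"
    using assms(1) unfolding runs_def by blast
  obtain L2 k2' s2' p2' where 2: "exec c2 (sub 1 \<omega>) (upd \<sigma> L1) L2 k2' s2' p2'" "k2' \<le> k2"
    "s2' \<le> s2" "p2' \<le> p2" "Q (upd (upd \<sigma> L1) L2)"
    using assms(2)[OF 1(5)] unfolding runs_def by blast
  show ?thesis
    unfolding runs_def upd_map_add
    using exec.Seq[OF 1(1) 2(1)] 1(2-4) 2(2-5) assms(3-6)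
    by (intro exI[of _ "L1 ++ L2"] exI[of _ "k1' + k2'"] exI[of _ "s1' + s2'"] exI[of _ "max p1' p2'"])
      (simp add: upd_map_add)
qed

lemma runs_weaken:
  "runs c \<omega> \<sigma> k s p R \<Longrightarrow> (\<And>\<tau>. R \<tau> \<Longrightarrow> Q \<tau>) \<Longrightarrow> k \<le> k' \<Longrightarrow> s \<le> s' \<Longrightarrow> p \<le> p' \<Longrightarrow> runs c \<omega> \<sigma> k' s' p' Q"
  unfolding runs_def by (meson order_trans)

lemma runs_WhileFalse:
  assumes "val e \<sigma> = 0" "Q \<sigma>" "1 + cost e \<le> k" "1 + cost e \<le> s" "1 \<le> p"
  shows "runs (While e c) \<omega> \<sigma> k s p Q"
  unfolding runs_def using exec.WhileFalse[OF assms(1), of c \<omega>] assms by (metis upd_empty)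

lemma runs_WhileTrue:
  assumes "val e \<sigma> \<noteq> 0" "runs (Seq c (While e c)) \<omega> \<sigma> k1 s1 p Q"
    "1 + cost e + k1 \<le> k" "1 + cost e + s1 \<le> s"
  shows "runs (While e c) \<omega> \<sigma> k s p Q"
proof -
  obtain L k' s' p' where 1: "exec (Seq c (While e c)) \<omega> \<sigma> L k' s' p'" "k' \<le> k1" "s' \<le> s1"
    "p' \<le> p" "Q (upd \<sigma> L)"
    using assms(2) unfolding runs_def by blast
  from 1(1) have "exec (While e c) \<omega> \<sigma> L (1 + cost e + k') (1 + cost e + s') p'"
  proof cases
    case (Seq L1 k1 s1 p1 L2 k2 s2 p2)
    then show ?thesis
      using exec.WhileTrue[OF assms(1), of c \<omega> L1 k1 s1 p1 L2 k2 s2 p2] by (simp add: add.assoc)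
  qed
  then show ?thesis
    unfolding runs_def using 1(2-5) assms(3,4)
    by (intro exI[of _ L] exI[of _ "1 + cost e + k'"] exI[of _ "1 + cost e + s'"] exI[of _ p']) simp
qed

text \<open>Tailored to sequential bodies (\<open>p' \<le> 1\<close>), for which \<open>m\<close>
  iterations need at most \<open>m\<close> processors. Work is bounded per iteration because bucket
  scans differ in length; the span bound is uniform.\<close>

lemma runs_Par:
  assumes m: "m = index (val e \<sigma>)"
    and body: "\<And>i. i < m \<Longrightarrow> \<exists>L k' s' p'. exec c (sub i \<omega>) (\<sigma>((x, 0) := real i)) L k' s' p' \<and>
      k' \<le> kb i \<and> s' \<le> sb \<and> p' \<le> 1 \<and> R i L"
    and post: "\<And>Ls. (\<And>i. i < m \<Longrightarrow> R i (Ls i)) \<Longrightarrow> Q (upd \<sigma> (merge m Ls))"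
    and bounds: "1 + cost e + m + (\<Sum>i<m. kb i) \<le> k" "1 + cost e + sb \<le> s" "1 \<le> p" "m \<le> p"
  shows "runs (Par x e c) \<omega> \<sigma> k s p Q"
proof -
  obtain Ls ks ss ps where b: "\<And>i. i < m \<Longrightarrow>
      exec c (sub i \<omega>) (\<sigma>((x, 0) := real i)) (Ls i) (ks i) (ss i) (ps i) \<and>
      ks i \<le> kb i \<and> ss i \<le> sb \<and> ps i \<le> 1 \<and> R i (Ls i)"
    using body by metis
  have "(\<Sum>i<m. ks i) \<le> (\<Sum>i<m. kb i)"
    using b by (intro sum_mono) auto
  then have 1: "1 + cost e + m + (\<Sum>i<m. ks i) \<le> k"
    using bounds(1) by linarith
  have "Max (insert 0 (ss ` {..<m})) \<le> sb"
    using b by (subst Max_le_iff) auto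
  then have 2: "1 + cost e + Max (insert 0 (ss ` {..<m})) \<le> s"
    using bounds(2) by linarith
  have "(\<Sum>i<m. ps i) \<le> (\<Sum>i<m. 1)"
    using b by (intro sum_mono) auto
  then have 3: "max 1 (\<Sum>i<m. ps i) \<le> p"
    using bounds(3,4) by simp
  have 4: "exec (Par x e c) \<omega> \<sigma> (merge m Ls) (1 + cost e + m + (\<Sum>i<m. ks i))
      (1 + cost e + Max (insert 0 (ss ` {..<m}))) (max 1 (\<Sum>i<m. ps i))"
    using b by (intro exec.Par m) blast
  have 5: "Q (upd \<sigma> (merge m Ls))"
    using b by (intro post) blast
  show ?thesis
    unfolding runs_def using 1 2 3 4 5 by blast
qed

lemma merge_unique:
  "i < m \<Longrightarrow> (\<And>j. j < m \<Longrightarrow> j \<noteq> i \<Longrightarrow> Ls j a = None) \<Longrightarrow> merge m Ls a = Ls i a"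
proof (induction m)
  case (Suc m)
  show ?case
  proof (cases "i = m")
    case True
    then have "merge m Ls a = None"
      using Suc.prems by (simp add: merge_eq_None)
    then show ?thesis
      using True by (cases "Ls m a") (auto simp: merge_Suc map_add_def)
  next
    case False
    then show ?thesis
      using Suc by (auto simp: merge_Suc map_add_def)
  qed
qed simp

lemma merge_diagonal:
  assumes "\<And>i x j. i < m \<Longrightarrow> j \<noteq> i \<Longrightarrow> Ls i (x, j) = None"
  shows "merge m Ls (x, j) = (if j < m then Ls j (x, j) else None)"
  using merge_unique[of j m Ls "(x, j)"] assms merge_eq_None[of m Ls "(x, j)"] by auto

section \<open>The program\<close>

text \<open>The arrays of the program are numbered from \<open>b\<close> on, beyond those of the integer sorter.\<close>

abbreviation (input) scalar :: "nat \<Rightarrow> exp" where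
  "scalar x \<equiv> Read x (Const 0)"

abbreviation (input) a_size :: "nat \<Rightarrow> nat" where "a_size b \<equiv> b"
abbreviation (input) a_ctr :: "nat \<Rightarrow> nat" where "a_ctr b \<equiv> b + 1"
abbreviation (input) a_time :: "nat \<Rightarrow> nat" where "a_time b \<equiv> b + 2"
abbreviation (input) a_max :: "nat \<Rightarrow> nat" where "a_max b \<equiv> b + 3"
abbreviation (input) a_min :: "nat \<Rightarrow> nat" where "a_min b \<equiv> b + 4"
abbreviation (input) a_len :: "nat \<Rightarrow> nat" where "a_len b \<equiv> b + 5"
abbreviation (input) a_key :: "nat \<Rightarrow> nat" where "a_key b \<equiv> b + 6"
abbreviation (input) a_dist :: "nat \<Rightarrow> nat" where "a_dist b \<equiv> b + 7"
abbreviation (input) a_pos :: "nat \<Rightarrow> nat" where "a_pos b \<equiv> b + 8"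

abbreviation (input) ctr :: "nat \<Rightarrow> exp" where
  "ctr b \<equiv> scalar (a_ctr b)"

text \<open>A maximum without conditional expression: the truth value 0 or 1 switches the correction
  off or on.\<close>

definition emax :: "exp \<Rightarrow> exp \<Rightarrow> exp" where
  "emax e f = Add e (Mul (Less e f) (Sub f e))"

definition emin :: "exp \<Rightarrow> exp \<Rightarrow> exp" where
  "emin e f = Add f (Mul (Less e f) (Sub e f))"

lemma val_emax [simp]: "val (emax e f) \<sigma> = max (val e \<sigma>) (val f \<sigma>)"
  by (simp add: emax_def)

lemma val_emin [simp]: "val (emin e f) \<sigma> = min (val e \<sigma>) (val f \<sigma>)"
  by (simp add: emin_def)

text \<open>\<open>a_max\<close> and \<open>a_min\<close> start as copies of the weights, to be
  overwritten by the tournament in \<open>reduce\<close>.\<close>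

definition draw_item :: "nat \<Rightarrow> com" where
  "draw_item b = Seq (Rand (a_time b) (ctr b))
    (Seq (Assign (a_time b) (ctr b) (Div (Sub (Const 0) (Ln (Read (a_time b) (ctr b)))) (Read 1 (ctr b))))
    (Seq (Assign (a_max b) (ctr b) (Read 1 (ctr b)))
      (Assign (a_min b) (ctr b) (Read 1 (ctr b)))))"

definition draw :: "nat \<Rightarrow> com" where
  "draw b = Par (a_ctr b) (scalar 0)
    (draw_item b)"

definition half :: "nat \<Rightarrow> exp" where
  "half b = Floor (Div (scalar (a_len b)) (Const 2))"

text \<open>Pairing \<open>i\<close> with \<open>i + (len - half)\<close> leaves the middle item of
  an odd range in place, and the surviving range is again a prefix.\<close>

definition partner :: "nat \<Rightarrow> exp" where
  "partner b = Add (ctr b) (Sub (scalar (a_len b)) (half b))"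

definition fold_item :: "nat \<Rightarrow> com" where
  "fold_item b = Seq (Assign (a_max b) (ctr b) (emax (Read (a_max b) (ctr b)) (Read (a_max b) (partner b))))
    (Assign (a_min b) (ctr b) (emin (Read (a_min b) (ctr b)) (Read (a_min b) (partner b))))"

definition reduce_step :: "nat \<Rightarrow> com" where
  "reduce_step b = Seq
    (Par (a_ctr b) (half b)
      (fold_item b))
    (Assign (a_len b) (Const 0) (Sub (scalar (a_len b)) (half b)))"

definition reduce_loop :: "nat \<Rightarrow> com" where
  "reduce_loop b = While (Less (Const 1) (scalar (a_len b))) (reduce_step b)"

definition reduce :: "nat \<Rightarrow> com" where
  "reduce b = Seq (Assign (a_len b) (Const 0) (scalar 0))
    (reduce_loop b)"

definition key_bound_exp :: "nat \<Rightarrow> exp" where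
  "key_bound_exp b = Floor (Mul (Mul (Const 2) (scalar (a_size b)))
    (Ln (Mul (scalar (a_size b)) (Div (scalar (a_max b)) (scalar (a_min b))))))"

text \<open>The key is stored twice: array 1 is the sorter's input, which the sorter may overwrite,
  while the copy in \<open>a_key\<close> is out of its reach.\<close>

definition key_item :: "nat \<Rightarrow> com" where
  "key_item b = Seq (Assign (a_key b) (ctr b) (emin (Read 0 (Const 1)) (emax (Const 0) (Floor (Mul (scalar (a_size b))
      (Ln (Mul (Mul (Read (a_time b) (ctr b)) (scalar (a_max b))) (scalar (a_size b)))))))))
    (Assign 1 (ctr b) (Read (a_key b) (ctr b)))"

text \<open>The size is saved first, since the sorter may overwrite array 0 as well.\<close>

definition keys :: "nat \<Rightarrow> com" where
  "keys b = Seq (Assign (a_size b) (Const 0) (scalar 0))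
    (Seq (Assign 0 (Const 1) (key_bound_exp b))
    (Par (a_ctr b) (scalar (a_size b))
      (key_item b)))"

definition key_at :: "nat \<Rightarrow> exp \<Rightarrow> exp" where
  "key_at b e = Read (a_key b) (Read 2 e)"

definition time_at :: "nat \<Rightarrow> exp \<Rightarrow> exp" where
  "time_at b e = Read (a_time b) (Read 2 e)"

definition left_ok :: "nat \<Rightarrow> exp" where
  "left_ok b = Less (scalar (a_dist b)) (Add (ctr b) (Const 1))"

definition right_ok :: "nat \<Rightarrow> exp" where
  "right_ok b = Less (Add (ctr b) (scalar (a_dist b))) (scalar (a_size b))"

definition left_pos :: "nat \<Rightarrow> exp" where
  "left_pos b = Sub (ctr b) (scalar (a_dist b))"

definition right_pos :: "nat \<Rightarrow> exp" where
  "right_pos b = Add (ctr b) (scalar (a_dist b))"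

text \<open>Sums act as disjunctions, products as conjunctions, and \<open>1 - Less\<close> as a
  negated comparison. A read outside the range is harmless because it is multiplied by 0. The scan
  goes on while either neighbour at the current distance shares the bucket.\<close>

definition guard :: "nat \<Rightarrow> exp" where
  "guard b = Add
    (Mul (left_ok b) (Sub (Const 1) (Less (key_at b (left_pos b)) (key_at b (ctr b)))))
    (Mul (right_ok b) (Sub (Const 1) (Less (key_at b (ctr b)) (key_at b (right_pos b)))))"

definition displacement_exp :: "nat \<Rightarrow> exp" where
  "displacement_exp b = Sub
    (Mul (right_ok b) (Less (time_at b (right_pos b)) (time_at b (ctr b))))
    (Mul (left_ok b) (Less (time_at b (ctr b)) (time_at b (left_pos b))))"

definition scan_step :: "nat \<Rightarrow> com" where
  "scan_step b = Seq (Assign (a_pos b) (Const 0) (Add (scalar (a_pos b)) (displacement_exp b)))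
    (Assign (a_dist b) (Const 0) (Add (scalar (a_dist b)) (Const 1)))"

text \<open>
  The item at position \<open>j\<close> of the output of the sorter moves right by the number of later items in
  its bucket with smaller times, minus the number of earlier ones with larger times.
\<close>

definition place_item :: "nat \<Rightarrow> com" where
  "place_item b = Seq (Assign (a_dist b) (Const 0) (Const 1))
    (Seq (Assign (a_pos b) (Const 0) (ctr b))
    (Seq (While (guard b) (scan_step b))
      (Assign 2 (scalar (a_pos b)) (Add (Read 2 (ctr b)) (Const 1)))))"

definition place :: "nat \<Rightarrow> com" where
  "place b = Par (a_ctr b) (scalar (a_size b))
    (place_item b)"

text \<open>The nesting of \<open>Seq\<close> fixes the branches of the source: the times come from
  \<open>sub 0 \<omega>\<close> and the sorter runs within \<open>sub 1 \<omega>\<close>. This is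
  what makes the keys independent of the sorter.\<close>

definition permute :: "com \<Rightarrow> nat \<Rightarrow> com" where
  "permute S b = Seq (draw b) (Seq (reduce b) (Seq (keys b) (Seq S (place b))))"

section \<open>The phases of a run\<close>

definition drawn :: "nat \<Rightarrow> nat \<Rightarrow> (nat \<Rightarrow> real) \<Rightarrow> (nat \<Rightarrow> real) \<Rightarrow> store" where
  "drawn b n w v = (\<lambda>(x, i). if i < n \<and> x = a_time b then v i
     else if i < n \<and> (x = a_max b \<or> x = a_min b) then w (i + 1) else permutation_input n w (x, i))"

lemma runs_draw:
  assumes "3 \<le> b" "1 \<le> n"
  shows "runs (draw b) \<omega> (permutation_input n w) (100 * n) 100 n
    (\<lambda>\<tau>. \<tau> = drawn b n w (\<lambda>i. arrival (w (i + 1)) (\<omega> [i, 0])))"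
  unfolding draw_def
proof (rule runs_Par)
  \<comment> \<open>\<open>[i, 0]\<close> is the node of the draw: iteration \<open>i\<close> of the
    loop, first component of the sequence.\<close>
  let ?v = "\<lambda>i. arrival (w (i + 1)) (\<omega> [i, 0])"
  let ?R = "\<lambda>i L. L = [(a_time b, i) \<mapsto> ?v i, (a_max b, i) \<mapsto> w (i + 1), (a_min b, i) \<mapsto> w (i + 1)]"
  show "n = index (val (scalar 0) (permutation_input n w))"
    by (simp add: permutation_input_def)
  show "\<exists>L k' s' p'. exec
      (draw_item b)
      (sub i \<omega>) ((permutation_input n w)((a_ctr b, 0) := real i)) L k' s' p' \<and>
      k' \<le> 50 \<and> s' \<le> 50 \<and> p' \<le> 1 \<and> ?R i L" if "i < n" for i
    using that assms
    by (simp add: draw_item_def exec_iff_den seqr_def upd_map_add sub_def permutation_input_def arrival_def)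
  show "upd (permutation_input n w) (merge n Ls) = drawn b n w ?v"
    if R: "\<And>i. i < n \<Longrightarrow> ?R i (Ls i)" for Ls
  proof
    fix a :: addr
    obtain x j where a: "a = (x, j)" by (cases a)
    have "merge n Ls (x, j) = (if j < n then Ls j (x, j) else None)"
      using R by (intro merge_diagonal) auto
    then show "upd (permutation_input n w) (merge n Ls) a = drawn b n w ?v a"
      using R unfolding a by (auto simp: upd_def drawn_def)
  qed
qed (use assms in auto)

lemma val_half:
  "\<sigma> (a_len b, 0) = real m \<Longrightarrow> val (half b) \<sigma> = real (m div 2)"
  using floor_divide_of_nat_eq[of m 2, where 'a = real] by (simp add: half_def)

lemma runs_reduce_step:
  fixes \<sigma> :: store
  assumes "\<sigma> (a_len b, 0) = real m" "2 \<le> m"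
  defines "h \<equiv> m div 2"
  shows "runs (reduce_step b) \<omega> \<sigma> (130 * h) 130 m
    (\<lambda>\<tau>. \<tau> (a_len b, 0) = real (m - h) \<and>
      (\<forall>i. \<tau> (a_max b, i) = (if i < h then max (\<sigma> (a_max b, i)) (\<sigma> (a_max b, i + (m - h))) else \<sigma> (a_max b, i))) \<and>
      (\<forall>i. \<tau> (a_min b, i) = (if i < h then min (\<sigma> (a_min b, i)) (\<sigma> (a_min b, i + (m - h))) else \<sigma> (a_min b, i))) \<and>
      (\<forall>x i. x \<notin> {a_max b, a_min b, a_len b} \<longrightarrow> \<tau> (x, i) = \<sigma> (x, i)))"
proof -
  have h: "1 \<le> h" "h \<le> m" using assms by auto
  have sub: "real m - real h = real (m - h)" using h by simp
  let ?M = "\<lambda>i. max (\<sigma> (a_max b, i)) (\<sigma> (a_max b, i + (m - h)))"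
  let ?N = "\<lambda>i. min (\<sigma> (a_min b, i)) (\<sigma> (a_min b, i + (m - h)))"
  let ?R = "\<lambda>i L. L = [(a_max b, i) \<mapsto> ?M i, (a_min b, i) \<mapsto> ?N i]"
  have idx: "nat (int i + int (m - h)) = i + m - h" for i
    using h by linarith
  show ?thesis
    unfolding reduce_step_def
  proof (rule runs_Seq)
    show "runs (Par (a_ctr b) (half b)
      (fold_item b))
      (sub 0 \<omega>) \<sigma> (110 * h) 110 m
      (\<lambda>\<tau>. \<forall>x i. \<tau> (x, i) = (if i < h \<and> x = a_max b then ?M i else if i < h \<and> x = a_min b then ?N i else \<sigma> (x, i)))"
    proof (rule runs_Par)
      show "h = index (val (half b) \<sigma>)"
        using val_half[of \<sigma> b m, OF assms(1)] by (simp add: h_def)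
      show "\<exists>L k' s' p'. exec
        (fold_item b)
        (sub i (sub 0 \<omega>)) (\<sigma>((a_ctr b, 0) := real i)) L k' s' p' \<and>
        k' \<le> 100 \<and> s' \<le> 100 \<and> p' \<le> 1 \<and> ?R i L" if "i < h" for i
      proof -
        have vh: "val (half b) \<tau> = real h" if "\<tau> (a_len b, 0) = real m" for \<tau>
          using val_half[of \<tau> b m, OF that] by (simp add: h_def)
        have c: "cost (half b) = 5" by (simp add: half_def)
        show ?thesis
          using that assms(1) h
          by (simp add: fold_item_def exec_iff_den seqr_def partner_def vh sub idx c emax_def[THEN arg_cong[where f = cost]] emin_def[THEN arg_cong[where f = cost]] del: of_nat_diff)
      qed
      show "\<forall>x i. upd \<sigma> (merge h Ls) (x, i) =
        (if i < h \<and> x = a_max b then ?M i else if i < h \<and> x = a_min b then ?N i else \<sigma> (x, i))"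
        if R: "\<And>i. i < h \<Longrightarrow> ?R i (Ls i)" for Ls
      proof (intro allI)
        fix x j :: nat
        have "merge h Ls (x, j) = (if j < h then Ls j (x, j) else None)"
          using R by (intro merge_diagonal) auto
        then show "upd \<sigma> (merge h Ls) (x, j) =
          (if j < h \<and> x = a_max b then ?M j else if j < h \<and> x = a_min b then ?N j else \<sigma> (x, j))"
          using R by (auto simp: upd_def)
      qed
    qed (use h in \<open>auto simp: half_def\<close>)
    fix \<tau> :: store
    assume \<tau>: "\<forall>x i. \<tau> (x, i) = (if i < h \<and> x = a_max b then ?M i else if i < h \<and> x = a_min b then ?N i else \<sigma> (x, i))"
    have "val (half b) \<tau> = real h"
      using val_half[of \<tau> b m] \<tau> assms by (simp add: h_def)
    then show "runs (Assign (a_len b) (Const 0) (Sub (scalar (a_len b)) (half b))) (sub 1 \<omega>) \<tau> 20 20 m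
      (\<lambda>\<tau>. \<tau> (a_len b, 0) = real (m - h) \<and>
      (\<forall>i. \<tau> (a_max b, i) = (if i < h then max (\<sigma> (a_max b, i)) (\<sigma> (a_max b, i + (m - h))) else \<sigma> (a_max b, i))) \<and>
      (\<forall>i. \<tau> (a_min b, i) = (if i < h then min (\<sigma> (a_min b, i)) (\<sigma> (a_min b, i + (m - h))) else \<sigma> (a_min b, i))) \<and>
      (\<forall>x i. x \<notin> {a_max b, a_min b, a_len b} \<longrightarrow> \<tau> (x, i) = \<sigma> (x, i)))"
      using \<tau> assms h by (intro runs_Assign) (auto simp: half_def)
  qed (use h in auto)
qed

definition greatest_least :: "(nat \<Rightarrow> real) \<Rightarrow> (nat \<Rightarrow> real) \<Rightarrow> nat \<Rightarrow> real \<Rightarrow> real \<Rightarrow> bool" where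
  "greatest_least f g m x y \<longleftrightarrow> x \<in> f ` {..<m} \<and> y \<in> g ` {..<m} \<and> (\<forall>i<m. f i \<le> x \<and> y \<le> g i)"

text \<open>The items dropped are those at positions from \<open>m - h\<close> on, and each has been
  folded into a surviving position below \<open>h\<close>, because
  \<open>h \<le> m - h\<close>.\<close>

lemma greatest_least_fold:
  assumes "greatest_least f' g' (m - h) x y" "h \<le> m - h" "h < m"
    "\<And>i. f' i = (if i < h then max (f i) (f (i + (m - h))) else f i)"
    "\<And>i. g' i = (if i < h then min (g i) (g (i + (m - h))) else g i)"
  shows "greatest_least f g m x y"
proof -
  obtain i j where i: "i < m - h" "x = f' i" and j: "j < m - h" "y = g' j"
    using assms(1) unfolding greatest_least_def by auto
  have "x \<in> f ` {..<m}"
    unfolding i(2) assms(4) using i(1) assms(2,3) by (auto simp: max_def)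
  moreover have "y \<in> g ` {..<m}"
    unfolding j(2) assms(5) using j(1) assms(2,3) by (auto simp: min_def)
  moreover have "f e \<le> x \<and> y \<le> g e" if "e < m" for e
  proof (cases "e < m - h")
    case True
    then have "f' e \<le> x" "y \<le> g' e" using assms(1) unfolding greatest_least_def by auto
    then show ?thesis unfolding assms(4,5) by (auto split: if_splits)
  next
    case False
    define d where "d = e - (m - h)"
    have d: "d < h" "e = d + (m - h)" using False that by (auto simp: d_def)
    then have "f' d \<le> x" "y \<le> g' d" using assms(1,2) unfolding greatest_least_def by auto
    then show ?thesis unfolding assms(4,5) d(2) using d(1) by auto
  qed
  ultimately show ?thesis unfolding greatest_least_def by blast
qed

text \<open>The work is geometric: a round costs 130 per item removed, and the budget of 150 per
  item leaves enough for the loop test. The range shrinks to its half, rounded up, so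
  \<open>r\<close> rounds suffice.\<close>

lemma runs_reduce_loop:
  fixes \<sigma> :: store
  assumes "\<sigma> (a_len b, 0) = real m" "1 \<le> m" "m \<le> 2 ^ r"
  shows "runs (reduce_loop b) \<omega> \<sigma> (150 * m) (150 * (r + 1)) m
    (\<lambda>\<tau>. greatest_least (\<lambda>i. \<sigma> (a_max b, i)) (\<lambda>i. \<sigma> (a_min b, i)) m (\<tau> (a_max b, 0)) (\<tau> (a_min b, 0)) \<and>
      (\<forall>x i. x \<notin> {a_max b, a_min b, a_len b} \<longrightarrow> \<tau> (x, i) = \<sigma> (x, i)))"
  using assms
proof (induction m arbitrary: r \<sigma> \<omega> rule: less_induct)
  case (less m)
  show ?case
  proof (cases "m = 1")
    case True
    then show ?thesis
      unfolding reduce_loop_def using less.prems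
      by (intro runs_WhileFalse) (auto simp: greatest_least_def)
  next
    case False
    define h where "h = m div 2"
    have h: "1 \<le> h" "h \<le> m - h" "h < m" "m - h < m" "1 \<le> m - h"
      using False less.prems by (auto simp: h_def)
    obtain r' where r: "r = Suc r'"
      using False less.prems by (cases r) auto
    then have r': "m - h \<le> 2 ^ r'"
      using less.prems by (auto simp: h_def)
    show ?thesis
    proof (rule runs_WhileTrue[where c = "reduce_step b" and e = "Less (Const 1) (scalar (a_len b))", folded reduce_loop_def])
      show "val (Less (Const 1) (scalar (a_len b))) \<sigma> \<noteq> 0"
        using less.prems False by simp
      show "runs (Seq (reduce_step b) (reduce_loop b)) \<omega> \<sigma>
        (130 * h + 150 * (m - h)) (130 + 150 * r) m
        (\<lambda>\<tau>. greatest_least (\<lambda>i. \<sigma> (a_max b, i)) (\<lambda>i. \<sigma> (a_min b, i)) m (\<tau> (a_max b, 0)) (\<tau> (a_min b, 0)) \<and>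
        (\<forall>x i. x \<notin> {a_max b, a_min b, a_len b} \<longrightarrow> \<tau> (x, i) = \<sigma> (x, i)))"
      proof (rule runs_Seq[OF runs_reduce_step[where m = m, folded h_def]])
        fix \<tau> :: store
        assume \<tau>: "\<tau> (a_len b, 0) = real (m - h) \<and>
          (\<forall>i. \<tau> (a_max b, i) = (if i < h then max (\<sigma> (a_max b, i)) (\<sigma> (a_max b, i + (m - h))) else \<sigma> (a_max b, i))) \<and>
          (\<forall>i. \<tau> (a_min b, i) = (if i < h then min (\<sigma> (a_min b, i)) (\<sigma> (a_min b, i + (m - h))) else \<sigma> (a_min b, i))) \<and>
          (\<forall>x i. x \<notin> {a_max b, a_min b, a_len b} \<longrightarrow> \<tau> (x, i) = \<sigma> (x, i))"
        have "runs (reduce_loop b) (sub 1 \<omega>) \<tau>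
          (150 * (m - h)) (150 * (r' + 1)) (m - h)
          (\<lambda>\<rho>. greatest_least (\<lambda>i. \<tau> (a_max b, i)) (\<lambda>i. \<tau> (a_min b, i)) (m - h) (\<rho> (a_max b, 0)) (\<rho> (a_min b, 0)) \<and>
          (\<forall>x i. x \<notin> {a_max b, a_min b, a_len b} \<longrightarrow> \<rho> (x, i) = \<tau> (x, i)))"
          using h r' \<tau> by (intro less.IH) auto
        then show "runs (reduce_loop b) (sub 1 \<omega>) \<tau>
          (150 * (m - h)) (150 * r) m
          (\<lambda>\<tau>. greatest_least (\<lambda>i. \<sigma> (a_max b, i)) (\<lambda>i. \<sigma> (a_min b, i)) m (\<tau> (a_max b, 0)) (\<tau> (a_min b, 0)) \<and>
          (\<forall>x i. x \<notin> {a_max b, a_min b, a_len b} \<longrightarrow> \<tau> (x, i) = \<sigma> (x, i)))"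
        proof (rule runs_weaken)
          fix \<rho> :: store
          assume "greatest_least (\<lambda>i. \<tau> (a_max b, i)) (\<lambda>i. \<tau> (a_min b, i)) (m - h) (\<rho> (a_max b, 0)) (\<rho> (a_min b, 0)) \<and>
            (\<forall>x i. x \<notin> {a_max b, a_min b, a_len b} \<longrightarrow> \<rho> (x, i) = \<tau> (x, i))"
          with \<tau> h(2,3) show "greatest_least (\<lambda>i. \<sigma> (a_max b, i)) (\<lambda>i. \<sigma> (a_min b, i)) m (\<rho> (a_max b, 0)) (\<rho> (a_min b, 0)) \<and>
            (\<forall>x i. x \<notin> {a_max b, a_min b, a_len b} \<longrightarrow> \<rho> (x, i) = \<sigma> (x, i))"
            using greatest_least_fold[of "\<lambda>i. \<tau> (a_max b, i)" "\<lambda>i. \<tau> (a_min b, i)" m h "\<rho> (a_max b, 0)" "\<rho> (a_min b, 0)"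
              "\<lambda>i. \<sigma> (a_max b, i)" "\<lambda>i. \<sigma> (a_min b, i)"] by simp
        qed (use h r in auto)
      qed (use less.prems False h in auto)
    qed (use h r in auto)
  qed
qed

lemma runs_reduce:
  assumes "3 \<le> b" "1 \<le> n" "n \<le> 2 ^ r"
  shows "runs (reduce b) \<omega> (drawn b n w v) (160 * n) (160 * (r + 1)) n
    (\<lambda>\<tau>. \<tau> (a_max b, 0) = Max (w ` {1..n}) \<and> \<tau> (a_min b, 0) = Min (w ` {1..n}) \<and>
      (\<forall>x i. x \<notin> {a_max b, a_min b, a_len b} \<longrightarrow> \<tau> (x, i) = drawn b n w v (x, i)))"
  unfolding reduce_def
proof (rule runs_Seq)
  let ?\<sigma> = "(drawn b n w v)((a_len b, 0) := real n)"
  show "runs (Assign (a_len b) (Const 0) (scalar 0)) (sub 0 \<omega>) (drawn b n w v) 10 10 1 (\<lambda>\<tau>. \<tau> = ?\<sigma>)"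
    using assms by (intro runs_Assign) (auto simp: drawn_def permutation_input_def)
  fix \<tau> :: store
  assume \<tau>: "\<tau> = ?\<sigma>"
  show "runs (reduce_loop b) (sub 1 \<omega>) \<tau> (150 * n) (150 * (r + 1)) n
    (\<lambda>\<tau>. \<tau> (a_max b, 0) = Max (w ` {1..n}) \<and> \<tau> (a_min b, 0) = Min (w ` {1..n}) \<and>
      (\<forall>x i. x \<notin> {a_max b, a_min b, a_len b} \<longrightarrow> \<tau> (x, i) = drawn b n w v (x, i)))"
  proof (rule runs_weaken[OF runs_reduce_loop])
    fix \<rho> :: store
    assume \<rho>: "greatest_least (\<lambda>i. \<tau> (a_max b, i)) (\<lambda>i. \<tau> (a_min b, i)) n (\<rho> (a_max b, 0)) (\<rho> (a_min b, 0)) \<and>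
      (\<forall>x i. x \<notin> {a_max b, a_min b, a_len b} \<longrightarrow> \<rho> (x, i) = \<tau> (x, i))"
    have im: "(\<lambda>i. \<tau> (a_max b, i)) ` {..<n} = w ` {1..n}" "(\<lambda>i. \<tau> (a_min b, i)) ` {..<n} = w ` {1..n}"
    proof -
      have "Suc ` {..<n} = {1..n}"
        by (simp add: image_Suc_lessThan)
      then have "w ` {1..n} = (\<lambda>i. w (Suc i)) ` {..<n}"
        by (metis image_image)
      then show "(\<lambda>i. \<tau> (a_max b, i)) ` {..<n} = w ` {1..n}" "(\<lambda>i. \<tau> (a_min b, i)) ` {..<n} = w ` {1..n}"
        by (simp_all add: \<tau> drawn_def)
    qed
    have "Max (w ` {1..n}) = \<rho> (a_max b, 0)"
      using \<rho> unfolding im(1)[symmetric] greatest_least_def by (intro Max_eqI) auto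
    moreover have "Min (w ` {1..n}) = \<rho> (a_min b, 0)"
      using \<rho> unfolding im(2)[symmetric] greatest_least_def by (intro Min_eqI) auto
    moreover note \<rho> \<tau>
    ultimately show "\<rho> (a_max b, 0) = Max (w ` {1..n}) \<and> \<rho> (a_min b, 0) = Min (w ` {1..n}) \<and>
      (\<forall>x i. x \<notin> {a_max b, a_min b, a_len b} \<longrightarrow> \<rho> (x, i) = drawn b n w v (x, i))"
      by simp
  qed (use assms \<tau> in auto)
qed (use assms in auto)

text \<open>Afterwards the arrays below \<open>b\<close> look exactly like a sorter's input: the
  earlier phases wrote from \<open>b\<close> on only, and all \<open>n\<close> weights in array 1
  are replaced by keys.\<close>

lemma runs_keys:
  fixes \<sigma> :: store
  assumes b: "3 \<le> b" and n: "1 \<le> n" and \<sigma>: "\<sigma> (a_max b, 0) = mx" "\<sigma> (a_min b, 0) = mn"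
      "\<forall>x i. x \<notin> {a_max b, a_min b, a_len b} \<longrightarrow> \<sigma> (x, i) = drawn b n w v (x, i)"
    and ratio: "1 \<le> mx / mn" and K: "K = nat \<lfloor>2 * real n * ln (real n * (mx / mn))\<rfloor>"
    and key: "key = (\<lambda>i. if i < n then bucket n K mx (v i) else 0)"
  shows "runs (keys b) \<omega> \<sigma> (200 * n) 200 n
    (\<lambda>\<tau>. agree {..<b} (sort_input n K key) \<tau> \<and> \<tau> (a_size b, 0) = real n \<and>
      (\<forall>i<n. \<tau> (a_time b, i) = v i \<and> \<tau> (a_key b, i) = real (key i)))"
proof -
  let ?\<sigma>1 = "\<sigma>((a_size b, 0) := real n)"
  let ?\<sigma>2 = "?\<sigma>1((0, 1) := real K)"
  \<comment> \<open>The logarithm is nonnegative, so the floor computed by the program agrees with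
    the \<open>nat\<close> in \<open>K\<close>.\<close>
  have "1 * 1 \<le> real n * (mx / mn)"
    using n ratio by (intro mult_mono) auto
  then have "0 \<le> 2 * real n * ln (real n * (mx / mn))"
    by simp
  then have K': "of_int \<lfloor>2 * real n * ln (real n * mx / mn)\<rfloor> = real K"
    unfolding K by simp
  have B: "min (real K) (max 0 (of_int \<lfloor>x\<rfloor>)) = real (min K (nat \<lfloor>x\<rfloor>))" for x
  proof -
    have "max 0 (real_of_int \<lfloor>x\<rfloor>) = real (nat \<lfloor>x\<rfloor>)" by linarith
    then show ?thesis by simp
  qed
  show ?thesis
    unfolding keys_def
  proof (rule runs_Seq)
    show "runs (Assign (a_size b) (Const 0) (scalar 0)) (sub 0 \<omega>) \<sigma> 10 10 1 (\<lambda>\<tau>. \<tau> = ?\<sigma>1)"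
      using b \<sigma> by (intro runs_Assign) (auto simp: drawn_def permutation_input_def)
    fix \<tau> :: store
    assume \<tau>: "\<tau> = ?\<sigma>1"
    show "runs (Seq (Assign 0 (Const 1) (key_bound_exp b))
      (Par (a_ctr b) (scalar (a_size b))
      (key_item b))) (sub 1 \<omega>) \<tau> (190 * n) 190 n
    (\<lambda>\<tau>. agree {..<b} (sort_input n K key) \<tau> \<and> \<tau> (a_size b, 0) = real n \<and>
      (\<forall>i<n. \<tau> (a_time b, i) = v i \<and> \<tau> (a_key b, i) = real (key i)))"
      unfolding \<tau>
    proof (rule runs_Seq)
      show "runs (Assign 0 (Const 1) (key_bound_exp b)) (sub 0 (sub 1 \<omega>)) ?\<sigma>1 30 30 1
        (\<lambda>\<tau>. \<tau> = ?\<sigma>2)"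
        using b \<sigma>(1,2) K' by (intro runs_Assign) (auto simp: key_bound_exp_def)
      fix \<tau> :: store
      assume \<tau>: "\<tau> = ?\<sigma>2"
      let ?R = "\<lambda>i L. L = [(a_key b, i) \<mapsto> real (key i), (1, i) \<mapsto> real (key i)]"
      show "runs (Par (a_ctr b) (scalar (a_size b))
        (key_item b)) (sub 1 (sub 1 \<omega>)) \<tau> (160 * n) 160 n
        (\<lambda>\<tau>. agree {..<b} (sort_input n K key) \<tau> \<and> \<tau> (a_size b, 0) = real n \<and>
        (\<forall>i<n. \<tau> (a_time b, i) = v i \<and> \<tau> (a_key b, i) = real (key i)))"
        unfolding \<tau>
      proof (rule runs_Par)
        show "n = index (val (scalar (a_size b)) ?\<sigma>2)"
          using b by simp
        show "\<exists>L k' s' p'. exec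
          (key_item b)
          (sub i (sub 1 (sub 1 \<omega>))) (?\<sigma>2((a_ctr b, 0) := real i)) L k' s' p' \<and>
          k' \<le> 150 \<and> s' \<le> 150 \<and> p' \<le> 1 \<and> ?R i L" if i: "i < n" for i
        proof -
          have t: "\<sigma> (a_time b, i) = v i"
            using \<sigma>(3) i by (simp add: drawn_def)
          show ?thesis
            using i b \<sigma>(1) t
            by (simp add: key_item_def exec_iff_den seqr_def B key bucket_def emax_def[THEN arg_cong[where f = cost]] emin_def[THEN arg_cong[where f = cost]] del: of_nat_min)
        qed
        show "agree {..<b} (sort_input n K key) (upd ?\<sigma>2 (merge n Ls)) \<and>
          upd ?\<sigma>2 (merge n Ls) (a_size b, 0) = real n \<and>
          (\<forall>i<n. upd ?\<sigma>2 (merge n Ls) (a_time b, i) = v i \<and> upd ?\<sigma>2 (merge n Ls) (a_key b, i) = real (key i))"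
          if R: "\<And>i. i < n \<Longrightarrow> ?R i (Ls i)" for Ls
        proof -
          have "merge n Ls (x, j) = (if j < n then Ls j (x, j) else None)" for x j
            using R by (intro merge_diagonal) auto
          then have M: "upd ?\<sigma>2 (merge n Ls) (x, j) =
            (if j < n \<and> (x = a_key b \<or> x = 1) then real (key j) else ?\<sigma>2 (x, j))" for x j
            using R by (auto simp: upd_def)
          show ?thesis
            unfolding agree_def M using b \<sigma>(3) n
            by (auto simp: sort_input_def drawn_def permutation_input_def)
        qed
      qed (use n in auto)
    qed (use n in auto)
  qed (use n in auto)
qed

subsection \<open>Sorting within the buckets\<close>

text \<open>With keys in sorted order either inequality amounts to equality; the one-sided form is
  what the program tests.\<close>

definition in_bucket :: "nat \<Rightarrow> (nat \<Rightarrow> nat) \<Rightarrow> (nat \<Rightarrow> nat) \<Rightarrow> nat \<Rightarrow> nat \<Rightarrow> bool" where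
  "in_bucket n \<pi> key j d \<longleftrightarrow> d \<le> j \<and> key (\<pi> j) \<le> key (\<pi> (j - d)) \<or> j + d < n \<and> key (\<pi> (j + d)) \<le> key (\<pi> j)"

definition displacement :: "nat \<Rightarrow> (nat \<Rightarrow> nat) \<Rightarrow> (nat \<Rightarrow> real) \<Rightarrow> nat \<Rightarrow> nat \<Rightarrow> real" where
  "displacement n \<pi> v j d = of_bool (j + d < n \<and> v (\<pi> (j + d)) < v (\<pi> j)) - of_bool (d \<le> j \<and> v (\<pi> j) < v (\<pi> (j - d)))"

definition scan_store :: "nat \<Rightarrow> nat \<Rightarrow> (nat \<Rightarrow> nat) \<Rightarrow> (nat \<Rightarrow> nat) \<Rightarrow> (nat \<Rightarrow> real) \<Rightarrow> nat \<Rightarrow> store \<Rightarrow> bool" where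
  "scan_store b n \<pi> key v j \<sigma> \<longleftrightarrow> \<sigma> (a_size b, 0) = real n \<and> \<sigma> (a_ctr b, 0) = real j \<and>
    (\<forall>q<n. \<sigma> (2, q) = real (\<pi> q)) \<and> (\<forall>i<n. \<sigma> (a_key b, i) = real (key i) \<and> \<sigma> (a_time b, i) = v i)"

lemma val_scan:
  fixes \<sigma> :: store
  assumes "scan_store b n \<pi> key v j \<sigma>" "\<sigma> (a_dist b, 0) = real d" "j < n" "\<And>q. q < n \<Longrightarrow> \<pi> q < n"
  shows "val (guard b) \<sigma> \<noteq> 0 \<longleftrightarrow> in_bucket n \<pi> key j d"
    "val (displacement_exp b) \<sigma> = displacement n \<pi> v j d"
proof -
  have st: "\<sigma> (a_size b, 0) = real n" "\<sigma> (a_ctr b, 0) = real j" "\<And>q. q < n \<Longrightarrow> \<sigma> (2, q) = real (\<pi> q)"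
    "\<And>i. i < n \<Longrightarrow> \<sigma> (a_key b, i) = real (key i)" "\<And>i. i < n \<Longrightarrow> \<sigma> (a_time b, i) = v i"
    using assms(1) unfolding scan_store_def by auto
  \<comment> \<open>A negative position is rounded to index 0, in agreement with truncated
    subtraction.\<close>
  have lp: "index (val (left_pos b) \<sigma>) = j - d"
    using st assms(2) by (simp add: left_pos_def) linarith
  have rp: "index (val (right_pos b) \<sigma>) = j + d"
    using st assms(2) by (simp add: right_pos_def nat_add_distrib)
  have cp: "index (val (ctr b) \<sigma>) = j"
    using st by simp
  have lo: "val (left_ok b) \<sigma> = of_bool (d \<le> j)"
    using st assms(2) by (simp add: left_ok_def)
  have ro: "val (right_ok b) \<sigma> = of_bool (j + d < n)"
    using st assms(2) by (simp add: right_ok_def)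
  have at: "val (key_at b e) \<sigma> = real (key (\<pi> q))" "val (time_at b e) \<sigma> = v (\<pi> q)"
    if "index (val e \<sigma>) = q" "q < n" for e q
    using that st assms(4) by (simp_all add: key_at_def time_at_def)
  note c = at[OF cp assms(3)]
  have l: "val (key_at b (left_pos b)) \<sigma> = real (key (\<pi> (j - d)))"
    "val (time_at b (left_pos b)) \<sigma> = v (\<pi> (j - d))"
    using at[OF lp] assms(3) by auto
  have r: "val (key_at b (right_pos b)) \<sigma> = real (key (\<pi> (j + d)))"
    "val (time_at b (right_pos b)) \<sigma> = v (\<pi> (j + d))" if "j + d < n"
    using at[OF rp that] by auto
  show "val (guard b) \<sigma> \<noteq> 0 \<longleftrightarrow> in_bucket n \<pi> key j d"
    unfolding guard_def in_bucket_def
    using lo ro l r c by (cases "j + d < n") (simp_all del: val.simps(2))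
  show "val (displacement_exp b) \<sigma> = displacement n \<pi> v j d"
    unfolding displacement_def displacement_exp_def
    using lo ro l r c by (cases "j + d < n") (simp_all del: val.simps(2))
qed

lemma cost_guard: "cost (guard b) = 46"
  by (simp add: guard_def left_ok_def right_ok_def key_at_def left_pos_def right_pos_def)

text \<open>An arbitrary starting distance \<open>d\<close> makes induction on \<open>d' - d\<close>
  possible. A round costs 47 operations for the guard and 53 for the step.\<close>

lemma exec_scan:
  fixes \<sigma> :: store
  assumes "scan_store b n \<pi> key v j \<sigma>" "\<sigma> (a_dist b, 0) = real d" "j < n" "\<And>q. q < n \<Longrightarrow> \<pi> q < n" "3 \<le> b"
    "d \<le> d'" "\<And>e. d \<le> e \<Longrightarrow> e < d' \<Longrightarrow> in_bucket n \<pi> key j e" "\<not> in_bucket n \<pi> key j d'"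
  shows "\<exists>L s. exec (While (guard b) (scan_step b)) \<omega> \<sigma> L s s 1 \<and> s \<le> 200 * (d' - d + 1) \<and>
    dom L \<subseteq> {(a_dist b, 0), (a_pos b, 0)} \<and>
    upd \<sigma> L (a_pos b, 0) = \<sigma> (a_pos b, 0) + (\<Sum>e=d..<d'. displacement n \<pi> v j e)"
  using assms(1,2,6-8)
proof (induction "d' - d" arbitrary: d \<sigma> \<omega>)
  case 0
  then have "val (guard b) \<sigma> = 0"
    using val_scan(1)[OF 0(2,3) assms(3,4)] by auto
  from exec.WhileFalse[OF this] 0 show ?case
    by (intro exI[of _ Map.empty] exI[of _ "1 + cost (guard b)"]) (auto simp: cost_guard)
next
  case (Suc x)
  note vs = val_scan[OF Suc.prems(1,2) assms(3,4)]
  let ?L = "[(a_pos b, 0) \<mapsto> \<sigma> (a_pos b, 0) + displacement n \<pi> v j d, (a_dist b, 0) \<mapsto> real (Suc d)]"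
  define E where "E = Add (scalar (a_pos b)) (displacement_exp b)"
  have E: "val E \<sigma> = \<sigma> (a_pos b, 0) + displacement n \<pi> v j d" "cost E = 45"
    unfolding E_def using vs(2)
    by simp (simp add: displacement_exp_def left_ok_def right_ok_def time_at_def left_pos_def right_pos_def)
  let ?\<tau>1 = "upd \<sigma> [(a_pos b, 0) \<mapsto> \<sigma> (a_pos b, 0) + displacement n \<pi> v j d]"
  have "exec (Assign (a_pos b) (Const 0) E) \<omega>' \<sigma> [(a_pos b, 0) \<mapsto> \<sigma> (a_pos b, 0) + displacement n \<pi> v j d] 47 47 1" for \<omega>'
    using E by (simp add: exec_iff_den)
  moreover have "exec (Assign (a_dist b) (Const 0) (Add (scalar (a_dist b)) (Const 1))) \<omega>' ?\<tau>1
      [(a_dist b, 0) \<mapsto> real (Suc d)] 6 6 1" for \<omega>'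
    using Suc.prems(2) by (simp add: exec_iff_den add.commute)
  ultimately have "exec (scan_step b) (sub 0 \<omega>) \<sigma> ([(a_pos b, 0) \<mapsto> \<sigma> (a_pos b, 0) + displacement n \<pi> v j d] ++
      [(a_dist b, 0) \<mapsto> real (Suc d)]) (47 + 6) (47 + 6) (max 1 1)"
    unfolding scan_step_def E_def by (rule exec.Seq)
  then have step: "exec (scan_step b) (sub 0 \<omega>) \<sigma> ?L 53 53 1"
    by (simp del: fun_upd_apply)
  have d: "x = d' - Suc d" "Suc d \<le> d'" "in_bucket n \<pi> key j d"
    using Suc.hyps(2) Suc.prems by auto
  let ?\<tau> = "upd \<sigma> ?L"
  have \<tau>: "?\<tau> = \<sigma>((a_pos b, 0) := \<sigma> (a_pos b, 0) + displacement n \<pi> v j d, (a_dist b, 0) := real (Suc d))"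
    by (auto simp: upd_def)
  have "scan_store b n \<pi> key v j ?\<tau>" "?\<tau> (a_dist b, 0) = real (Suc d)"
    using Suc.prems(1) assms(5) unfolding \<tau> by (auto simp: scan_store_def)
  note IH = Suc.hyps(1)[OF d(1) this d(2) _ Suc.prems(5), of "sub 1 \<omega>"]
  have "\<exists>L s. exec (While (guard b) (scan_step b)) (sub 1 \<omega>) ?\<tau> L s s 1 \<and>
    s \<le> 200 * (d' - Suc d + 1) \<and> dom L \<subseteq> {(a_dist b, 0), (a_pos b, 0)} \<and>
    upd ?\<tau> L (a_pos b, 0) = ?\<tau> (a_pos b, 0) + (\<Sum>e=Suc d..<d'. displacement n \<pi> v j e)"
    by (rule IH) (simp add: Suc.prems(4))
  then obtain L s where L: "exec (While (guard b) (scan_step b)) (sub 1 \<omega>) ?\<tau> L s s 1"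
    "s \<le> 200 * (d' - Suc d + 1)" "dom L \<subseteq> {(a_dist b, 0), (a_pos b, 0)}"
    "upd ?\<tau> L (a_pos b, 0) = ?\<tau> (a_pos b, 0) + (\<Sum>e=Suc d..<d'. displacement n \<pi> v j e)"
    by (elim exE conjE) (rule that)
  have "exec (While (guard b) (scan_step b)) \<omega> \<sigma> (?L ++ L) (1 + cost (guard b) + 53 + s)
      (1 + cost (guard b) + 53 + s) (max 1 1)"
    using vs(1) d(3) by (intro exec.WhileTrue step L(1)) auto
  moreover have "1 + cost (guard b) + 53 + s \<le> 200 * (d' - d + 1)"
    using L(2) d(2) by (simp add: cost_guard)
  moreover have "dom (?L ++ L) \<subseteq> {(a_dist b, 0), (a_pos b, 0)}"
    using L(3) by auto
  moreover have "upd \<sigma> (?L ++ L) (a_pos b, 0) = \<sigma> (a_pos b, 0) + (\<Sum>e=d..<d'. displacement n \<pi> v j e)"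
    using L(4) d(2) unfolding upd_map_add \<tau> by (simp add: sum.atLeast_Suc_lessThan)
  ultimately show ?case
    by (intro exI[of _ "?L ++ L"] exI[of _ "1 + cost (guard b) + 53 + s"]) auto
qed

text \<open>Distance 0 is excluded, being the item itself.\<close>

definition scan_end :: "nat \<Rightarrow> (nat \<Rightarrow> nat) \<Rightarrow> (nat \<Rightarrow> nat) \<Rightarrow> nat \<Rightarrow> nat" where
  "scan_end n \<pi> key j = (LEAST d. 1 \<le> d \<and> \<not> in_bucket n \<pi> key j d)"

definition target :: "nat \<Rightarrow> (nat \<Rightarrow> nat) \<Rightarrow> (nat \<Rightarrow> nat) \<Rightarrow> (nat \<Rightarrow> real) \<Rightarrow> nat \<Rightarrow> real" where
  "target n \<pi> key v j = real j + (\<Sum>d=1..<scan_end n \<pi> key j. displacement n \<pi> v j d)"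

definition collisions :: "nat \<Rightarrow> (nat \<Rightarrow> nat) \<Rightarrow> nat \<Rightarrow> nat" where
  "collisions n key i = card {i'. i' < n \<and> i' \<noteq> i \<and> key i' = key i}"

definition time_rank :: "nat \<Rightarrow> (nat \<Rightarrow> real) \<Rightarrow> nat \<Rightarrow> nat" where
  "time_rank n v i = card {i'. i' < n \<and> v i' < v i}"

lemma scan_end:
  assumes "j < n"
  shows "1 \<le> scan_end n \<pi> key j" "scan_end n \<pi> key j \<le> n" "\<not> in_bucket n \<pi> key j (scan_end n \<pi> key j)"
    "1 \<le> d \<Longrightarrow> d < scan_end n \<pi> key j \<Longrightarrow> in_bucket n \<pi> key j d"
proof -
  \<comment> \<open>Distance \<open>n\<close> is out of range on both sides, so the least element
    exists.\<close>
  have n: "1 \<le> n \<and> \<not> in_bucket n \<pi> key j n"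
    using assms by (auto simp: in_bucket_def)
  show "1 \<le> scan_end n \<pi> key j" "\<not> in_bucket n \<pi> key j (scan_end n \<pi> key j)"
    using LeastI[of "\<lambda>d. 1 \<le> d \<and> \<not> in_bucket n \<pi> key j d", OF n] by (auto simp: scan_end_def)
  show "scan_end n \<pi> key j \<le> n"
    using Least_le[of "\<lambda>d. 1 \<le> d \<and> \<not> in_bucket n \<pi> key j d", OF n] by (simp add: scan_end_def)
  show "1 \<le> d \<Longrightarrow> d < scan_end n \<pi> key j \<Longrightarrow> in_bucket n \<pi> key j d"
    using not_less_Least[of d "\<lambda>d. 1 \<le> d \<and> \<not> in_bucket n \<pi> key j d"] by (auto simp: scan_end_def)
qed

text \<open>Every distance passed by the scan exhibits another item of the bucket, to the left or to
  the right, and different distances exhibit different items.\<close>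

lemma scan_end_le_collisions:
  assumes \<pi>: "bij_betw \<pi> {..<n} {..<n}" and sorted: "\<And>i j. i < j \<Longrightarrow> j < n \<Longrightarrow> key (\<pi> i) \<le> key (\<pi> j)"
    and j: "j < n"
  shows "scan_end n \<pi> key j \<le> collisions n key (\<pi> j) + 1"
proof -
  let ?D = "{1..<scan_end n \<pi> key j}"
  let ?f = "\<lambda>d. if d \<le> j \<and> key (\<pi> j) \<le> key (\<pi> (j - d)) then j - d else j + d"
  have f: "?f d < n \<and> ?f d \<noteq> j \<and> key (\<pi> (?f d)) = key (\<pi> j)" if "d \<in> ?D" for d
  proof -
    have d: "1 \<le> d" "in_bucket n \<pi> key j d"
      using that scan_end(4)[OF j] by auto
    show ?thesis
    proof (cases "d \<le> j \<and> key (\<pi> j) \<le> key (\<pi> (j - d))")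
      case True
      then show ?thesis using sorted[of "j - d" j] d j by auto
    next
      case False
      then have "j + d < n" "key (\<pi> (j + d)) \<le> key (\<pi> j)"
        using d(2) by (auto simp: in_bucket_def)
      then show ?thesis using False sorted[of j "j + d"] d by auto
    qed
  qed
  have "inj_on ?f ?D"
    by (auto simp: inj_on_def split: if_splits)
  moreover have "inj_on \<pi> (?f ` ?D)"
  proof (rule inj_on_subset)
    show "inj_on \<pi> {..<n}" using \<pi> by (simp add: bij_betw_def)
    show "?f ` ?D \<subseteq> {..<n}" using f by blast
  qed
  ultimately have "inj_on (\<pi> \<circ> ?f) ?D"
    by (rule comp_inj_on)
  moreover have "(\<pi> \<circ> ?f) ` ?D \<subseteq> {i'. i' < n \<and> i' \<noteq> \<pi> j \<and> key i' = key (\<pi> j)}"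
  proof
    fix i assume "i \<in> (\<pi> \<circ> ?f) ` ?D"
    then obtain d where d: "d \<in> ?D" "i = \<pi> (?f d)" by auto
    define q where "q = ?f d"
    have q: "q < n" "q \<noteq> j" "key (\<pi> q) = key (\<pi> j)" "i = \<pi> q"
      using f[OF d(1)] d(2) unfolding q_def by blast+
    moreover have "\<pi> q \<noteq> \<pi> j"
      using q j \<pi> inj_on_eq_iff[of \<pi> "{..<n}" q j] by (simp add: bij_betw_def)
    moreover have "\<pi> q < n"
      using q \<pi> by (meson bij_betwE lessThan_iff)
    ultimately show "i \<in> {i'. i' < n \<and> i' \<noteq> \<pi> j \<and> key i' = key (\<pi> j)}"
      by simp
  qed
  ultimately have "card ?D \<le> card {i'. i' < n \<and> i' \<noteq> \<pi> j \<and> key i' = key (\<pi> j)}"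
    by (rule card_inj_on_le) simp
  then show ?thesis by (simp add: collisions_def)
qed

text \<open>Items of other buckets are on their correct side already, hence the truncated scan suffices.\<close>

lemma target_eq_rank:
  assumes \<pi>: "bij_betw \<pi> {..<n} {..<n}" and sorted: "\<And>i j. i < j \<Longrightarrow> j < n \<Longrightarrow> key (\<pi> i) \<le> key (\<pi> j)"
    and j: "j < n" and inj: "inj_on v {..<n}"
    and mono: "\<And>i i'. i < n \<Longrightarrow> i' < n \<Longrightarrow> v i \<le> v i' \<Longrightarrow> key i \<le> key i'"
  shows "target n \<pi> key v j = real (time_rank n v (\<pi> j))"
proof -
  let ?e = "scan_end n \<pi> key j"
  let ?lt = "\<lambda>q. v (\<pi> q) < v (\<pi> j)" and ?gt = "\<lambda>q. v (\<pi> j) < v (\<pi> q)"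
  have \<pi>n: "\<pi> q < n" if "q < n" for q
    using \<pi> that by (meson bij_betwE lessThan_iff)
  have less: "v (\<pi> p) < v (\<pi> q)" if "p < n" "q < n" "key (\<pi> p) < key (\<pi> q)" for p q
    using mono[OF \<pi>n[OF that(2)] \<pi>n[OF that(1)]] that(3) by force
  have sorted': "key (\<pi> p) \<le> key (\<pi> q)" if "p \<le> q" "q < n" for p q
    using sorted[of p q] that by (cases "p = q") auto
  \<comment> \<open>At the end of the scan both neighbours, if present, have keys different from
    that of \<open>j\<close>, and by sortedness so have all positions farther away. Different keys
    force the times into the same order.\<close>
  have zero: "displacement n \<pi> v j d = 0" if d: "?e \<le> d" for d
  proof -
    have nb: "\<not> in_bucket n \<pi> key j ?e"
      by (rule scan_end(3)[OF j])
    have A: "\<not> ?lt (j + d)" if "j + d < n"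
    proof -
      have "key (\<pi> j) < key (\<pi> (j + ?e))"
        using nb d that by (auto simp: in_bucket_def)
      also have "\<dots> \<le> key (\<pi> (j + d))"
        using d that by (intro sorted') auto
      finally show ?thesis using less[of j "j + d"] j that by auto
    qed
    have B: "\<not> ?gt (j - d)" if "d \<le> j"
    proof -
      have "key (\<pi> (j - d)) \<le> key (\<pi> (j - ?e))"
        using d j by (intro sorted') auto
      also have "\<dots> < key (\<pi> j)"
        using nb d that by (auto simp: in_bucket_def)
      finally have "v (\<pi> (j - d)) < v (\<pi> j)"
        using j by (intro less) auto
      then show ?thesis by simp
    qed
    show ?thesis using A B by (auto simp: displacement_def)
  qed
  have "(\<Sum>d=1..<?e. displacement n \<pi> v j d) = (\<Sum>d=1..<n. displacement n \<pi> v j d)"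
    using scan_end(1,2)[OF j, of \<pi> key] zero by (intro sum.mono_neutral_left) auto
  also have "\<dots> = (\<Sum>d=1..<n. of_bool (j + d < n \<and> ?lt (j + d))) - (\<Sum>d=1..<n. of_bool (d \<le> j \<and> ?gt (j - d)))"
    unfolding displacement_def by (rule sum_subtractf)
  also have "(\<Sum>d=1..<n. of_bool (j + d < n \<and> ?lt (j + d))) = (\<Sum>q=Suc j..<n. of_bool (?lt q) :: real)"
  proof -
    have "(\<Sum>q=Suc j..<n. of_bool (?lt q) :: real) = (\<Sum>d\<in>{d. 1 \<le> d \<and> j + d < n}. of_bool (?lt (j + d)))"
      by (rule sum.reindex_bij_witness[of _ "\<lambda>d. j + d" "\<lambda>q. q - j"]) auto
    also have "\<dots> = (\<Sum>d=1..<n. of_bool (j + d < n \<and> ?lt (j + d)))"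
      by (rule sum.mono_neutral_cong_left) auto
    finally show ?thesis by simp
  qed
  also have "(\<Sum>d=1..<n. of_bool (d \<le> j \<and> ?gt (j - d))) = (\<Sum>q<j. of_bool (?gt q) :: real)"
  proof -
    have "(\<Sum>q<j. of_bool (?gt q) :: real) = (\<Sum>d\<in>{1..j}. of_bool (?gt (j - d)))"
      by (rule sum.reindex_bij_witness[of _ "\<lambda>d. j - d" "\<lambda>q. j - q"]) auto
    also have "\<dots> = (\<Sum>d=1..<n. of_bool (d \<le> j \<and> ?gt (j - d)))"
      using j by (intro sum.mono_neutral_cong_left) auto
    finally show ?thesis by simp
  qed
  finally have "target n \<pi> key v j =
      real j + (\<Sum>q=Suc j..<n. of_bool (?lt q)) - (\<Sum>q<j. of_bool (?gt q))"
    by (simp add: target_def)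
  \<comment> \<open>Times are distinct, so each of the \<open>j\<close> earlier positions holds
    either a smaller or a larger time. Subtracting the larger ones from \<open>j\<close> counts the
    smaller ones.\<close>
  also have "real j - (\<Sum>q<j. of_bool (?gt q)) = (\<Sum>q<j. of_bool (?lt q))"
  proof -
    have "of_bool (?lt q) = (1 :: real) - of_bool (?gt q)" if "q < j" for q
    proof -
      have "\<pi> q \<noteq> \<pi> j"
        using \<pi> that j unfolding bij_betw_def inj_on_def by auto
      then have "v (\<pi> q) \<noteq> v (\<pi> j)"
        using inj \<pi>n[of q] \<pi>n[of j] that j unfolding inj_on_def by auto
      then show ?thesis by auto
    qed
    then have "(\<Sum>q<j. of_bool (?lt q)) = (\<Sum>q<j. (1 :: real) - of_bool (?gt q))"
      by (intro sum.cong) auto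
    then show ?thesis by (simp add: sum_subtractf)
  qed
  then have "real j + (\<Sum>q=Suc j..<n. of_bool (?lt q)) - (\<Sum>q<j. of_bool (?gt q)) =
      (\<Sum>q<j. of_bool (?lt q)) + (\<Sum>q=Suc j..<n. of_bool (?lt q))"
    by simp
  also have "\<dots> = (\<Sum>q<n. of_bool (?lt q))"
  proof -
    have split: "sum g {..<n} = sum g {..<j} + (g j + sum g {Suc j..<n})" for g :: "nat \<Rightarrow> real"
      using sum.atLeastLessThan_concat[of 0 j n g] sum.atLeast_Suc_lessThan[of j n g] j
      by (simp add: lessThan_atLeast0)
    show ?thesis unfolding split by (simp del: sum_of_bool_eq)
  qed
  also have "\<dots> = (\<Sum>i<n. of_bool (v i < v (\<pi> j)))"
    by (rule sum.reindex_bij_betw[OF \<pi>])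
  also have "\<dots> = real (time_rank n v (\<pi> j))"
    by (simp add: time_rank_def of_bool_def sum.If_cases Int_def)
  finally show ?thesis .
qed

lemma rank_less: "i < n \<Longrightarrow> v i < v i' \<Longrightarrow> time_rank n v i < time_rank n v i'"
  unfolding time_rank_def by (intro psubset_card_mono) (auto intro: less_trans)

text \<open>The budgets rest on sorted keys only. Distinct times and keys monotone in time are
  premises inside the postcondition, because they are available only on the event
  \<open>ascending\<close>, whereas the cost is bounded outside it as well.\<close>

lemma runs_place:
  fixes \<sigma> :: store
  assumes b: "3 \<le> b" and n: "1 \<le> n" and \<pi>: "bij_betw \<pi> {..<n} {..<n}"
    and sorted: "\<And>i j. i < j \<Longrightarrow> j < n \<Longrightarrow> key (\<pi> i) \<le> key (\<pi> j)"
    and \<sigma>: "\<sigma> (a_size b, 0) = real n" "\<And>q. q < n \<Longrightarrow> \<sigma> (2, q) = real (\<pi> q)"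
      "\<And>i. i < n \<Longrightarrow> \<sigma> (a_key b, i) = real (key i) \<and> \<sigma> (a_time b, i) = v i"
    and M: "\<And>i. i < n \<Longrightarrow> collisions n key i \<le> M"
  shows "runs (place b) \<omega> \<sigma> (300 * (n + (\<Sum>i<n. collisions n key i))) (300 * (M + 1)) n
    (\<lambda>\<tau>. inj_on v {..<n} \<longrightarrow> (\<forall>i<n. \<forall>i'<n. v i \<le> v i' \<longrightarrow> key i \<le> key i') \<longrightarrow>
      (\<forall>i<n. \<tau> (2, time_rank n v i) = real i + 1))"
  unfolding place_def
proof (rule runs_Par)
  let ?T = "\<lambda>j. index (target n \<pi> key v j)"
  let ?R = "\<lambda>j L. \<forall>q. L (2, q) = (if q = ?T j then Some (real (\<pi> j) + 1) else None)"
  let ?e = "scan_end n \<pi> key"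
  have \<pi>n: "\<pi> q < n" if "q < n" for q
    using \<pi> that by (meson bij_betwE lessThan_iff)
  show "n = index (val (scalar (a_size b)) \<sigma>)"
    using \<sigma>(1) by simp
  show "\<exists>L k' s' p'. exec
    (place_item b)
    (sub j \<omega>) (\<sigma>((a_ctr b, 0) := real j)) L k' s' p' \<and>
    k' \<le> 200 * (collisions n key (\<pi> j) + 1) + 50 \<and> s' \<le> 200 * (M + 1) + 50 \<and> p' \<le> 1 \<and> ?R j L" if j: "j < n" for j
  proof -
    let ?\<sigma>0 = "\<sigma>((a_ctr b, 0) := real j)"
    let ?\<sigma>1 = "?\<sigma>0((a_dist b, 0) := 1)"
    let ?\<sigma>2 = "?\<sigma>1((a_pos b, 0) := real j)"
    have A1: "exec (Assign (a_dist b) (Const 0) (Const 1)) \<omega>' ?\<sigma>0 [(a_dist b, 0) \<mapsto> 1] 3 3 1" for \<omega>'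
      by (simp add: exec_iff_den)
    have A2: "exec (Assign (a_pos b) (Const 0) (ctr b)) \<omega>' ?\<sigma>1 [(a_pos b, 0) \<mapsto> real j] 4 4 1" for \<omega>'
      by (simp add: exec_iff_den)
    have st: "scan_store b n \<pi> key v j ?\<sigma>2" "?\<sigma>2 (a_dist b, 0) = real 1"
      using \<sigma> b by (auto simp: scan_store_def)
    have "\<exists>L s. exec (While (guard b) (scan_step b)) (sub 0 (sub 1 (sub 1 (sub j \<omega>)))) ?\<sigma>2 L s s 1 \<and>
      s \<le> 200 * (?e j - 1 + 1) \<and> dom L \<subseteq> {(a_dist b, 0), (a_pos b, 0)} \<and>
      upd ?\<sigma>2 L (a_pos b, 0) = ?\<sigma>2 (a_pos b, 0) + (\<Sum>d=1..<?e j. displacement n \<pi> v j d)"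
      by (rule exec_scan[OF st j \<pi>n b scan_end(1)[OF j] scan_end(4)[OF j] scan_end(3)[OF j]])
    then obtain L s where W: "exec (While (guard b) (scan_step b)) (sub 0 (sub 1 (sub 1 (sub j \<omega>)))) ?\<sigma>2 L s s 1"
      "s \<le> 200 * (?e j - 1 + 1)" "dom L \<subseteq> {(a_dist b, 0), (a_pos b, 0)}"
      "upd ?\<sigma>2 L (a_pos b, 0) = ?\<sigma>2 (a_pos b, 0) + (\<Sum>d=1..<?e j. displacement n \<pi> v j d)"
      by (elim exE conjE) (rule that)
    let ?\<sigma>3 = "upd ?\<sigma>2 L"
    have keep: "?\<sigma>3 a = ?\<sigma>2 a" if "a \<noteq> (a_dist b, 0)" "a \<noteq> (a_pos b, 0)" for a
    proof -
      have "a \<notin> dom L" using W(3) that by blast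
      then show ?thesis by (auto simp: upd_def domIff)
    qed
    have v3: "?\<sigma>3 (a_pos b, 0) = target n \<pi> key v j" "?\<sigma>3 (a_ctr b, 0) = real j" "?\<sigma>3 (2, j) = real (\<pi> j)"
      using W(4) \<sigma> j b keep[of "(a_ctr b, 0)"] keep[of "(2, j)"] by (simp_all add: target_def)
    have A3: "exec (Assign 2 (scalar (a_pos b)) (Add (Read 2 (ctr b)) (Const 1))) \<omega>' ?\<sigma>3
        [(2, ?T j) \<mapsto> real (\<pi> j) + 1] 8 8 1" for \<omega>'
      using v3 by (simp add: exec_iff_den)
    have E: "exec (place_item b) (sub j \<omega>) ?\<sigma>0
      ([(a_dist b, 0) \<mapsto> 1] ++ ([(a_pos b, 0) \<mapsto> real j] ++ (L ++ [(2, ?T j) \<mapsto> real (\<pi> j) + 1])))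
      (3 + (4 + (s + 8))) (3 + (4 + (s + 8))) (max 1 (max 1 (max 1 1)))"
      unfolding place_item_def
      by (intro exec.Seq A1) (simp_all only: upd_single A2 A3 W(1))
    have L2: "L (2, q) = None" for q
      using W(3) b by (auto simp: domIff)
    have b1: "s \<le> 200 * (collisions n key (\<pi> j) + 1)"
      using W(2) scan_end(1)[OF j, of \<pi> key] scan_end_le_collisions[of \<pi> n key j, OF \<pi> sorted j] by auto
    have b2: "200 * (collisions n key (\<pi> j) + 1) \<le> 200 * (M + 1)"
      using M[OF \<pi>n[OF j]] by simp
    have b3: "?R j ([(a_dist b, 0) \<mapsto> 1] ++ ([(a_pos b, 0) \<mapsto> real j] ++ (L ++ [(2, ?T j) \<mapsto> real (\<pi> j) + 1])))"
      using b by (auto simp: map_add_def L2 split: option.splits)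
    show ?thesis
      by (intro exI conjI, rule E, use b1 in linarith, use b1 b2 in linarith, simp, rule b3)
  qed
  show "inj_on v {..<n} \<longrightarrow> (\<forall>i<n. \<forall>i'<n. v i \<le> v i' \<longrightarrow> key i \<le> key i') \<longrightarrow>
      (\<forall>i<n. upd \<sigma> (merge n Ls) (2, time_rank n v i) = real i + 1)"
    if R: "\<And>j. j < n \<Longrightarrow> ?R j (Ls j)" for Ls
  proof (intro impI allI)
    assume inj: "inj_on v {..<n}" and mono: "\<forall>i<n. \<forall>i'<n. v i \<le> v i' \<longrightarrow> key i \<le> key i'"
    fix i assume i: "i < n"
    have T: "?T j = time_rank n v (\<pi> j)" if "j < n" for j
      using target_eq_rank[of \<pi> n key j v, OF \<pi> sorted that inj] mono by simp
    obtain j where j: "j < n" "\<pi> j = i"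
      using \<pi> i unfolding bij_betw_def by (metis imageE lessThan_iff)
    \<comment> \<open>Distinct times have distinct ranks, so no two iterations write the same output
      cell.\<close>
    have "merge n Ls (2, time_rank n v i) = Ls j (2, time_rank n v i)"
    proof (rule merge_unique[OF j(1)])
      fix j' assume j': "j' < n" "j' \<noteq> j"
      then have "\<pi> j' \<noteq> i"
        using \<pi> j unfolding bij_betw_def inj_on_def by auto
      then have "v (\<pi> j') \<noteq> v i"
        using inj \<pi>n[OF j'(1)] i unfolding inj_on_def by auto
      then have "time_rank n v (\<pi> j') \<noteq> time_rank n v i"
        using rank_less[of i n v "\<pi> j'"] rank_less[of "\<pi> j'" n v i] i \<pi>n[OF j'(1)] by (metis linorder_neqE_linordered_idom less_irrefl)
      then show "Ls j' (2, time_rank n v i) = None"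
        using R[OF j'(1)] T[OF j'(1)] by simp
    qed
    then show "upd \<sigma> (merge n Ls) (2, time_rank n v i) = real i + 1"
      using R[OF j(1)] T[OF j(1)] j(2) by (simp add: upd_def)
  qed
  have "(\<Sum>j<n. collisions n key (\<pi> j)) = (\<Sum>i<n. collisions n key i)"
    by (rule sum.reindex_bij_betw[OF \<pi>])
  then have "(\<Sum>j<n. 200 * (collisions n key (\<pi> j) + 1) + 50) = 250 * n + 200 * (\<Sum>i<n. collisions n key i)"
    by (simp add: sum.distrib flip: sum_distrib_left)
  then show "1 + cost (scalar (a_size b)) + n + (\<Sum>j<n. 200 * (collisions n key (\<pi> j) + 1) + 50)
      \<le> 300 * (n + (\<Sum>i<n. collisions n key i))"
    using n by simp
qed (use n in auto)

section \<open>From ascending times to the output permutation\<close>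

lemma ascending_sorted:
  "ascending l x s u \<Longrightarrow> sorted_wrt (\<lambda>i i'. arrival (l i) (u i) < arrival (l i') (u i')) s \<and>
    (\<forall>i\<in>set s. x < arrival (l i) (u i))"
  by (induction s arbitrary: x) (auto intro: less_trans)

lemma sorted_wrt_inj_on:
  fixes v :: "nat \<Rightarrow> real"
  shows "sorted_wrt (\<lambda>i i'. v i < v i') t \<Longrightarrow> inj_on v (set t)"
  by (induction t) (auto simp: image_iff)

text \<open>In a list sorted by time the items with smaller times are exactly the \<open>l\<close>
  preceding ones.\<close>

lemma time_rank_nth:
  assumes "set t = {..<n}" "sorted_wrt (\<lambda>i i'. v i < v i') t" "distinct t" "l < length t"
  shows "time_rank n v (t ! l) = l"
proof -
  have less_iff: "v (t ! l') < v (t ! l) \<longleftrightarrow> l' < l" if "l' < length t" for l'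
  proof
    show "v (t ! l') < v (t ! l)" if "l' < l"
      using sorted_wrt_nth_less[OF assms(2) that assms(4)] .
    show "l' < l" if "v (t ! l') < v (t ! l)"
    proof (rule ccontr)
      assume "\<not> l' < l"
      then consider "l = l'" | "l < l'" by linarith
      then show False
      proof cases
        case 2
        from sorted_wrt_nth_less[OF assms(2) this] that \<open>l' < length t\<close> show False by auto
      qed (use that in auto)
    qed
  qed
  have "{i'. i' < n \<and> v i' < v (t ! l)} = (!) t ` {..<l}"
  proof (intro equalityI subsetI)
    fix i assume "i \<in> {i'. i' < n \<and> v i' < v (t ! l)}"
    moreover from this obtain l' where "l' < length t" "i = t ! l'"
      using assms(1) by (metis (no_types, lifting) in_set_conv_nth lessThan_iff mem_Collect_eq)
    ultimately show "i \<in> (!) t ` {..<l}" using less_iff by auto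
  next
    fix i assume "i \<in> (!) t ` {..<l}"
    then obtain l' where l': "l' < l" "i = t ! l'" by auto
    then have "i \<in> set t" using assms(4) by auto
    then show "i \<in> {i'. i' < n \<and> v i' < v (t ! l)}"
      using less_iff[of l'] l' assms(1,4) by auto
  qed
  moreover have "inj_on ((!) t) {..<l}"
    using assms(3,4) by (auto simp: inj_on_def nth_eq_iff_index_eq)
  ultimately show ?thesis
    by (simp add: time_rank_def card_image)
qed

text \<open>The sorter enters as one given run on its standard input, so its costs appear unchanged.
  The phases cost 100, 160, 200 and 300 in their respective units, rounded up to 1000.\<close>

lemma runs_permute:
  assumes b: "3 \<le> b" "uses {..<b} S" and w: "positive_weights n w" and r: "n \<le> 2 ^ r"
    and K: "K = nat \<lfloor>2 * real n * ln (real n * weight_ratio n w)\<rfloor>"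
    and u: "u = (\<lambda>i. sub 0 \<omega> [i, 0])"
    and key: "key = (\<lambda>i. if i < n then bucket n K (Max (w ` {1..n})) (arrival (w (Suc i)) (u i)) else 0)"
    and M: "\<And>i. i < n \<Longrightarrow> collisions n key i \<le> M"
    and S: "exec S (sub 0 (sub 1 (sub 1 (sub 1 \<omega>)))) (sort_input n K key) L k s p"
      "sorted_output n key (upd (sort_input n K key) L)"
  shows "runs (permute S b) \<omega> (permutation_input n w) (k + 1000 * (n + (\<Sum>i<n. collisions n key i)))
    (s + 1000 * (r + M + 1)) (max n p)
    (\<lambda>\<tau>. \<forall>t. distinct t \<longrightarrow> set t = {..<n} \<longrightarrow> ascending (\<lambda>i. w (Suc i)) 0 t u \<longrightarrow>
      permutation_output (map Suc t) \<tau>)" (is "runs _ _ _ _ _ _ ?Q")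
proof -
  define mx where "mx = Max (w ` {1..n})"
  define mn where "mn = Min (w ` {1..n})"
  define v where "v = (\<lambda>i. arrival (w (Suc i)) (u i))"
  have n: "1 \<le> n" and pos: "\<And>i. i \<in> {1..n} \<Longrightarrow> 0 < w i"
    using w by (auto simp: positive_weights_def)
  have mn: "0 < mn" "mn \<le> mx"
  proof -
    have "mn \<in> w ` {1..n}"
      unfolding mn_def using n by (intro Min_in) auto
    then show "0 < mn" using pos by auto
    show "mn \<le> mx"
      unfolding mx_def using \<open>mn \<in> w ` {1..n}\<close> by (intro Max_ge) auto
  qed
  have ratio: "weight_ratio n w = mx / mn" "1 \<le> mx / mn"
    using mn by (simp_all add: weight_ratio_def mx_def mn_def)
  have key': "key = (\<lambda>i. if i < n then bucket n K mx (v i) else 0)"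
    unfolding key v_def mx_def ..
  obtain \<pi> where \<pi>: "bij_betw \<pi> {..<n} {..<n}" "\<And>j. j < n \<Longrightarrow> upd (sort_input n K key) L (2, j) = real (\<pi> j)"
    "\<And>i j. i < j \<Longrightarrow> j < n \<Longrightarrow> key (\<pi> i) \<le> key (\<pi> j)"
    using S(2) unfolding sorted_output_def by blast
  \<comment> \<open>\<open>ascending\<close> supplies both premises of the placement: strict order
    makes the times distinct, and the threshold 0 makes them positive, as monotonicity of
    \<open>bucket\<close> requires.\<close>
  have good: "?Q \<tau>" if \<tau>: "inj_on v {..<n} \<longrightarrow> (\<forall>i<n. \<forall>i'<n. v i \<le> v i' \<longrightarrow> key i \<le> key i') \<longrightarrow>
      (\<forall>i<n. \<tau> (2, time_rank n v i) = real i + 1)" for \<tau>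
  proof (intro allI impI)
    fix t assume t: "distinct t" "set t = {..<n}" "ascending (\<lambda>i. w (Suc i)) 0 t u"
    have sorted: "sorted_wrt (\<lambda>i i'. v i < v i') t" and v0: "\<And>i. i < n \<Longrightarrow> 0 < v i"
      using ascending_sorted[OF t(3)] t(2) by (auto simp: v_def)
    have "inj_on v {..<n}"
      using sorted_wrt_inj_on[OF sorted] t(2) by simp
    moreover have "\<forall>i<n. \<forall>i'<n. v i \<le> v i' \<longrightarrow> key i \<le> key i'"
      using v0 n mn by (auto simp: key' intro!: bucket_mono)
    ultimately have out: "\<tau> (2, time_rank n v i) = real i + 1" if "i < n" for i
      using \<tau> that by blast
    show "permutation_output (map Suc t) \<tau>"
      unfolding permutation_output_def
    proof (intro allI impI)
      fix l assume "l < length (map Suc t)"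
      then have l: "l < length t" by simp
      then have "t ! l < n" using t(2) nth_mem by blast
      then show "\<tau> (2, l) = real (map Suc t ! l)"
        using out[of "t ! l"] time_rank_nth[OF t(2) sorted t(1) l] l by simp
    qed
  qed
  have "runs (permute S b) \<omega> (permutation_input n w)
    (100 * n + (160 * n + (200 * n + (k + 300 * (n + (\<Sum>i<n. collisions n key i))))))
    (100 + (160 * (r + 1) + (200 + (s + 300 * (M + 1))))) (max n p) ?Q"
    unfolding permute_def
  proof (rule runs_Seq[OF runs_draw[OF b(1) n]])
    fix \<tau>1 assume "\<tau>1 = drawn b n w (\<lambda>i. arrival (w (i + 1)) (sub 0 \<omega> [i, 0]))"
    then have \<tau>1: "\<tau>1 = drawn b n w v"
      by (simp add: v_def u)
    show "runs (Seq (reduce b) (Seq (keys b) (Seq S (place b)))) (sub 1 \<omega>) \<tau>1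
      (160 * n + (200 * n + (k + 300 * (n + (\<Sum>i<n. collisions n key i)))))
      (160 * (r + 1) + (200 + (s + 300 * (M + 1)))) (max n p) ?Q"
      unfolding \<tau>1
    proof (rule runs_Seq[OF runs_reduce[OF b(1) n r]])
      fix \<tau>2 :: store
      assume \<tau>2: "\<tau>2 (a_max b, 0) = Max (w ` {1..n}) \<and> \<tau>2 (a_min b, 0) = Min (w ` {1..n}) \<and>
        (\<forall>x i. x \<notin> {a_max b, a_min b, a_len b} \<longrightarrow> \<tau>2 (x, i) = drawn b n w v (x, i))"
      show "runs (Seq (keys b) (Seq S (place b))) (sub 1 (sub 1 \<omega>)) \<tau>2
        (200 * n + (k + 300 * (n + (\<Sum>i<n. collisions n key i))))
        (200 + (s + 300 * (M + 1))) (max n p) ?Q"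
      proof (rule runs_Seq[OF runs_keys[where mx = mx and mn = mn and K = K and key = key and v = v and n = n and w = w]])
        show "K = nat \<lfloor>2 * real n * ln (real n * (mx / mn))\<rfloor>"
          using K ratio(1) by simp
        fix \<tau>3 :: store
        assume \<tau>3: "agree {..<b} (sort_input n K key) \<tau>3 \<and> \<tau>3 (a_size b, 0) = real n \<and>
          (\<forall>i<n. \<tau>3 (a_time b, i) = v i \<and> \<tau>3 (a_key b, i) = real (key i))"
        \<comment> \<open>The sorter sees only arrays below \<open>b\<close>, where the store agrees
          with its standard input.\<close>
        have ex: "exec S (sub 0 (sub 1 (sub 1 (sub 1 \<omega>)))) \<tau>3 L k s p"
          using exec_agree[OF S(1) b(2)] \<tau>3 by blast
        show "runs (Seq S (place b)) (sub 1 (sub 1 (sub 1 \<omega>))) \<tau>3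
          (k + 300 * (n + (\<Sum>i<n. collisions n key i))) (s + 300 * (M + 1)) (max n p) ?Q"
        proof (rule runs_Seq)
          show "runs S (sub 0 (sub 1 (sub 1 (sub 1 \<omega>)))) \<tau>3 k s p (\<lambda>\<tau>. \<tau> = upd \<tau>3 L)"
            unfolding runs_def using ex by blast
          fix \<tau>4 assume \<tau>4: "\<tau>4 = upd \<tau>3 L"
          have "agree {..<b} (upd (sort_input n K key) L) \<tau>4"
            unfolding \<tau>4 using \<tau>3 agree_upd by blast
          then have "\<tau>4 (2, q) = real (\<pi> q)" if "q < n" for q
            using b(1) \<pi>(2)[OF that] by (simp add: agree_def)
          moreover have "\<tau>4 (x, i) = \<tau>3 (x, i)" if "b \<le> x" for x i
          proof -
            have "(x, i) \<notin> dom L"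
              using exec_writes[OF ex b(2)] that by auto
            then show ?thesis by (auto simp: \<tau>4 upd_def domIff)
          qed
          ultimately have "runs (place b) (sub 1 (sub 1 (sub 1 (sub 1 \<omega>)))) \<tau>4
            (300 * (n + (\<Sum>i<n. collisions n key i))) (300 * (M + 1)) n
            (\<lambda>\<tau>. inj_on v {..<n} \<longrightarrow> (\<forall>i<n. \<forall>i'<n. v i \<le> v i' \<longrightarrow> key i \<le> key i') \<longrightarrow>
              (\<forall>i<n. \<tau> (2, time_rank n v i) = real i + 1))"
            using \<tau>3 by (intro runs_place[where \<pi> = \<pi> and key = key and v = v, OF b(1) n \<pi>(1,3)] M) auto
          then show "runs (place b) (sub 1 (sub 1 (sub 1 (sub 1 \<omega>)))) \<tau>4
            (300 * (n + (\<Sum>i<n. collisions n key i))) (300 * (M + 1)) n ?Q"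
            by (rule runs_weaken) (use good in auto)
        qed auto
      qed (use b n \<tau>2 ratio key' in \<open>auto simp: mx_def mn_def\<close>)
    qed auto
  qed auto
  then show ?thesis
    by (rule runs_weaken) auto
qed

section \<open>Expected resources\<close>

definition key_bound :: "nat \<Rightarrow> (nat \<Rightarrow> real) \<Rightarrow> nat" where
  "key_bound n w = nat \<lfloor>2 * real n * ln (real n * weight_ratio n w)\<rfloor>"

definition deviates :: "source \<Rightarrow> nat \<Rightarrow> real" where
  "deviates \<omega> i = \<omega> [i, 0]"

definition bucket_keys :: "nat \<Rightarrow> (nat \<Rightarrow> real) \<Rightarrow> (nat \<Rightarrow> real) \<Rightarrow> nat \<Rightarrow> nat" where
  "bucket_keys n w u i =
    (if i < n then bucket n (key_bound n w) (Max (w ` {1..n})) (arrival (w (Suc i)) (u i)) else 0)"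

text \<open>To be applied to \<open>sub 1 \<omega>\<close>; leaving out this outermost step exhibits
  the sorter's deviates as a function of the branch disjoint from that of the times.\<close>

definition sorter_source :: "source \<Rightarrow> source" where
  "sorter_source \<omega> = sub 0 (sub 1 (sub 1 \<omega>))"

text \<open>Setting the keys beyond \<open>n\<close> to 0 makes the set finite, so that expectations
  and null sets can be treated one key sequence at a time.\<close>

definition padded_keys :: "nat \<Rightarrow> nat \<Rightarrow> (nat \<Rightarrow> nat) set" where
  "padded_keys n K = {key. \<forall>i. (i \<in> {..<n} \<longrightarrow> key i \<in> {..K}) \<and> (i \<notin> {..<n} \<longrightarrow> key i = 0)}"

definition moment :: "nat \<Rightarrow> (nat \<Rightarrow> nat) \<Rightarrow> real" where
  "moment n key = (\<Sum>j<n. 2 ^ collisions n key j)"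

lemma finite_padded_keys: "finite (padded_keys n K)"
  unfolding padded_keys_def by (rule finite_set_of_finite_funs) auto

lemma padded_keys_subset: "padded_keys n K \<subseteq> key_seqs n K"
  by (auto simp: padded_keys_def key_seqs_def)

lemma bucket_keys_padded: "bucket_keys n w u \<in> padded_keys n (key_bound n w)"
  by (auto simp: padded_keys_def bucket_keys_def bucket_def)

lemma measurable_bucket_keys:
  assumes "\<And>i. i < n \<Longrightarrow> (\<lambda>x. u x i) \<in> borel_measurable M"
  shows "(\<lambda>x. bucket_keys n w (u x)) \<in> measurable M (count_space (padded_keys n (key_bound n w)))"
proof -
  have *: "(\<lambda>x. bucket_keys n w (u x) i) \<in> measurable M (count_space UNIV)" for i
  proof (cases "i < n")
    case True
    note [measurable] = assms[OF True]
    show ?thesis unfolding bucket_keys_def by measurable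
  qed (simp add: bucket_keys_def)
  have "(\<lambda>x. bucket_keys n w (u x)) -` {f} \<inter> space M \<in> sets M" for f
  proof -
    note [measurable] = *
    have "(\<lambda>x. bucket_keys n w (u x)) -` {f} \<inter> space M = {x \<in> space M. \<forall>i. bucket_keys n w (u x) i = f i}"
      by auto
    also have "\<dots> \<in> sets M" by measurable
    finally show ?thesis .
  qed
  then show ?thesis
    unfolding measurable_count_space_eq2[OF finite_padded_keys] using bucket_keys_padded by auto
qed

lemma measurable_deviates [measurable]: "(\<lambda>\<omega>. deviates \<omega> i) \<in> borel_measurable rand"
  unfolding deviates_def by measurable

lemma measurable_of_bucket_keys:
  assumes "\<And>i. i < n \<Longrightarrow> (\<lambda>x. u x i) \<in> borel_measurable M"
  shows "(\<lambda>x. F (bucket_keys n w (u x)) :: ennreal) \<in> borel_measurable M"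
  by (rule measurable_compose[OF measurable_bucket_keys[OF assms]]) auto

lemma distr_coordinates:
  assumes "inj f"
  shows "distr rand (\<Pi>\<^sub>M i\<in>I. unif) (\<lambda>\<omega>. \<lambda>i\<in>I. \<omega> (f i)) = (\<Pi>\<^sub>M i\<in>I. unif)"
  unfolding rand_def
  by (rule distr_PiM_reindex) (use assms in \<open>auto intro: prob_space_uniform_measure inj_on_subset\<close>)

lemma measurable_coordinates:
  "(\<lambda>\<omega>. \<lambda>i\<in>I. \<omega> (f i)) \<in> measurable rand (\<Pi>\<^sub>M i\<in>I. unif)"
  by (rule measurable_restrict) (simp add: measurable_cong_sets[OF refl, of unif borel])

lemma deviates_sub: "deviates (sub 0 \<omega>) i = \<omega> [0, i, 0]"
  by (simp add: deviates_def sub_def)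

text \<open>The keys depend on the \<open>n\<close> nodes \<open>[0, i, 0]\<close> only, whose joint
  law is the finite product to which the bound on collisions applies. The maximal weight divided by
  any weight is at most \<open>weight_ratio\<close>, as the bucket estimate demands.\<close>

lemma nn_integral_moment:
  assumes w: "positive_weights n w"
  shows "(\<integral>\<^sup>+\<omega>. ennreal (moment n (bucket_keys n w (deviates (sub 0 \<omega>)))) \<partial>rand) \<le> ennreal (27 * real n)"
proof -
  let ?f = "\<lambda>i::nat. [0, i, 0]"
  let ?c = "\<lambda>\<omega>. \<lambda>i\<in>{..<n}. \<omega> (?f i)"
  let ?mx = "Max (w ` {1..n})" and ?mn = "Min (w ` {1..n})"
  define h where "h = (\<lambda>i u. bucket n (key_bound n w) ?mx (arrival (w (Suc i)) u))"
  have n: "1 \<le> n" and pos: "\<And>i. i \<in> {1..n} \<Longrightarrow> 0 < w i"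
    using w by (auto simp: positive_weights_def)
  have moment_h: "moment n (bucket_keys n w u) =
      (\<Sum>j<n. 2 ^ card {i. i < n \<and> i \<noteq> j \<and> h i (u i) = h j (u j)})" for u
    unfolding moment_def collisions_def
    by (intro sum.cong arg_cong[where f = "\<lambda>A. 2 ^ card A"]) (auto simp: bucket_keys_def h_def)
  have "(\<integral>\<^sup>+\<omega>. ennreal (moment n (bucket_keys n w (deviates (sub 0 \<omega>)))) \<partial>rand) =
      (\<integral>\<^sup>+\<omega>. ennreal (moment n (bucket_keys n w (?c \<omega>))) \<partial>rand)"
    unfolding moment_h deviates_sub
    by (intro nn_integral_cong arg_cong[where f = ennreal] sum.cong arg_cong[where f = "\<lambda>A. 2 ^ card A"]) auto
  also have "\<dots> = (\<integral>\<^sup>+u. ennreal (moment n (bucket_keys n w u)) \<partial>distr rand (\<Pi>\<^sub>M i\<in>{..<n}. unif) ?c)"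
    by (intro nn_integral_distr[symmetric] measurable_coordinates measurable_of_bucket_keys) auto
  also have "\<dots> = (\<integral>\<^sup>+u. ennreal (moment n (bucket_keys n w u)) \<partial>(\<Pi>\<^sub>M i\<in>{..<n}. unif))"
    by (subst distr_coordinates) (auto simp: inj_on_def)
  also have "\<dots> \<le> ennreal (27 * real n)"
    unfolding moment_h
  proof (rule nn_integral_collisions[OF n])
    show "h i \<in> measurable borel (count_space UNIV)" for i
      unfolding h_def by measurable
    show "h i u \<le> key_bound n w" for i u
      by (simp add: h_def bucket_def)
    fix i \<kappa> assume i: "i < n"
    have "w (Suc i) \<in> w ` {1..n}" using i by auto
    moreover have "0 < ?mn"
      using n pos by (subst Min_gr_iff) auto
    moreover have "?mn \<le> w (Suc i)" "w (Suc i) \<le> ?mx"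
      using \<open>w (Suc i) \<in> w ` {1..n}\<close> by auto
    moreover have "0 < w (Suc i)" using pos i by auto
    ultimately have "?mx / w (Suc i) \<le> weight_ratio n w"
      unfolding weight_ratio_def by (intro divide_left_mono mult_pos_pos) linarith+
    then show "emeasure unif {u. h i u = \<kappa>} \<le> ennreal (3 / real n)"
      unfolding h_def using n pos i \<open>w (Suc i) \<le> ?mx\<close>
      by (intro emeasure_bucket[where U = "weight_ratio n w"]) (auto simp: key_bound_def)
  qed
  finally show ?thesis .
qed

lemma measurable_by_keys:
  assumes g: "\<And>f. g f \<in> borel_measurable rand"
  shows "(\<lambda>\<omega>. g (bucket_keys n w (deviates (sub 0 \<omega>))) (sorter_source (sub 1 \<omega>))) \<in> borel_measurable rand"
proof (rule measurable_compose_countable'[where I = "padded_keys n (key_bound n w)" and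
    f = "\<lambda>f \<omega>. g f (sorter_source (sub 1 \<omega>))" and g = "\<lambda>\<omega>. bucket_keys n w (deviates (sub 0 \<omega>))"])
  show "(\<lambda>\<omega>. g f (sorter_source (sub 1 \<omega>))) \<in> borel_measurable rand" for f
    unfolding sorter_source_def by (intro measurable_compose[OF _ g]) measurable
  show "(\<lambda>\<omega>. bucket_keys n w (deviates (sub 0 \<omega>))) \<in> measurable rand (count_space (padded_keys n (key_bound n w)))"
    by (rule measurable_bucket_keys) (simp add: deviates_sub)
qed (simp add: countable_finite finite_padded_keys)

text \<open>The keys are independent of the deviates drawn by the sorter.\<close>

lemma nn_integral_by_keys:
  assumes g: "\<And>f. g f \<in> borel_measurable rand"
    and B: "\<And>f. f \<in> padded_keys n (key_bound n w) \<Longrightarrow> (\<integral>\<^sup>+\<omega>. g f \<omega> \<partial>rand) \<le> B"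
  shows "(\<integral>\<^sup>+\<omega>. g (bucket_keys n w (deviates (sub 0 \<omega>))) (sorter_source (sub 1 \<omega>)) \<partial>rand) \<le> B"
proof -
  let ?F = "padded_keys n (key_bound n w)"
  let ?A = "\<lambda>f. {\<omega>. bucket_keys n w (deviates \<omega>) = f}"
  have A: "?A f \<in> sets rand" if "f \<in> ?F" for f
    using measurable_sets[OF measurable_bucket_keys[of n deviates rand w], of "{f}"] that
    by (simp add: vimage_def)
  have m: "(\<lambda>\<omega>. g f (sorter_source \<omega>)) \<in> borel_measurable rand" for f
    unfolding sorter_source_def by (intro measurable_compose[OF _ g]) measurable
  have g_eq: "(\<integral>\<^sup>+\<omega>. g f (sorter_source \<omega>) \<partial>rand) = (\<integral>\<^sup>+\<omega>. g f \<omega> \<partial>rand)" for f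
  proof -
    have "(\<lambda>\<omega>. g f (sub 0 \<omega>)) \<in> borel_measurable rand" "(\<lambda>\<omega>. g f (sub 0 (sub 1 \<omega>))) \<in> borel_measurable rand"
      by (intro measurable_compose[OF _ g]; measurable)+
    then show ?thesis
      unfolding sorter_source_def
      using nn_integral_sub[of "\<lambda>\<omega>. g f (sub 0 (sub 1 \<omega>))" 1] nn_integral_sub[of "\<lambda>\<omega>. g f (sub 0 \<omega>)" 1]
        nn_integral_sub[OF g, of f 0] by simp
  qed
  \<comment> \<open>Splitting by the finitely many key sequences turns the integrand into a sum of
    products, one factor depending on \<open>sub 0 \<omega>\<close> and the other on
    \<open>sub 1 \<omega>\<close>.\<close>
  have "g (bucket_keys n w (deviates (sub 0 \<omega>))) (sorter_source (sub 1 \<omega>)) =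
      (\<Sum>f\<in>?F. indicator (?A f) (sub 0 \<omega>) * g f (sorter_source (sub 1 \<omega>)))" for \<omega>
  proof -
    let ?k = "bucket_keys n w (deviates (sub 0 \<omega>))"
    have "(\<Sum>f\<in>?F. indicator (?A f) (sub 0 \<omega>) * g f (sorter_source (sub 1 \<omega>))) =
        (\<Sum>f\<in>?F. if f = ?k then g f (sorter_source (sub 1 \<omega>)) else 0)"
      by (intro sum.cong) (auto simp: indicator_def)
    also have "\<dots> = g ?k (sorter_source (sub 1 \<omega>))"
      using bucket_keys_padded by (simp add: finite_padded_keys)
    finally show ?thesis by simp
  qed
  then have "(\<integral>\<^sup>+\<omega>. g (bucket_keys n w (deviates (sub 0 \<omega>))) (sorter_source (sub 1 \<omega>)) \<partial>rand) =
      (\<integral>\<^sup>+\<omega>. (\<Sum>f\<in>?F. indicator (?A f) (sub 0 \<omega>) * g f (sorter_source (sub 1 \<omega>))) \<partial>rand)"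
    by simp
  also have "\<dots> = (\<Sum>f\<in>?F. \<integral>\<^sup>+\<omega>. indicator (?A f) (sub 0 \<omega>) * g f (sorter_source (sub 1 \<omega>)) \<partial>rand)"
  proof (rule nn_integral_sum)
    fix f assume "f \<in> ?F"
    from A[OF this] have [measurable]: "(\<lambda>\<omega>. indicator (?A f) (sub 0 \<omega>) :: ennreal) \<in> borel_measurable rand"
      by (intro measurable_compose[OF measurable_sub] borel_measurable_indicator)
    have [measurable]: "(\<lambda>\<omega>. g f (sorter_source (sub 1 \<omega>))) \<in> borel_measurable rand"
      by (rule measurable_compose[OF measurable_sub m])
    show "(\<lambda>\<omega>. indicator (?A f) (sub 0 \<omega>) * g f (sorter_source (sub 1 \<omega>))) \<in> borel_measurable rand"
      by measurable
  qed
  also have "\<dots> = (\<Sum>f\<in>?F. emeasure rand (?A f) * (\<integral>\<^sup>+\<omega>. g f \<omega> \<partial>rand))"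
    using A by (intro sum.cong refl) (subst nn_integral_sub_mult, auto intro: m simp: g_eq)
  also have "\<dots> \<le> (\<Sum>f\<in>?F. emeasure rand (?A f) * B)"
    using B by (intro sum_mono mult_left_mono) auto
  also have "\<dots> = (\<Sum>f\<in>?F. emeasure rand (?A f)) * B"
    by (simp add: sum_distrib_right)
  also have "(\<Sum>f\<in>?F. emeasure rand (?A f)) = emeasure rand (\<Union>f\<in>?F. ?A f)"
    using A finite_padded_keys by (intro sum_emeasure) (auto simp: disjoint_family_on_def)
  also have "\<dots> * B \<le> 1 * B"
    by (intro mult_right_mono rand.emeasure_le_1) auto
  finally show ?thesis by simp
qed

text \<open>A sorter may fail on a null set for each fixed input, whereas the input here is random.
  Finitely many inputs occur, so the null sets can be united.\<close>

lemma AE_sorted: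
  assumes S: "integer_sorter S" and n: "1 \<le> n"
  shows "AE \<omega> in rand. produces S
    (sort_input n (key_bound n w) (bucket_keys n w (deviates (sub 0 \<omega>)))) (sorter_source (sub 1 \<omega>))
    (sorted_output n (bucket_keys n w (deviates (sub 0 \<omega>))))"
proof -
  let ?F = "padded_keys n (key_bound n w)"
  have "AE \<omega> in rand. \<forall>f\<in>?F. produces S (sort_input n (key_bound n w) f) (sorter_source (sub 1 \<omega>)) (sorted_output n f)"
  proof (rule AE_finite_allI[OF finite_padded_keys])
    fix f assume "f \<in> ?F"
    then have "AE \<omega> in rand. produces S (sort_input n (key_bound n w) f) \<omega> (sorted_output n f)"
      using S n padded_keys_subset unfolding integer_sorter_def by blast
    from AE_sub[OF AE_sub[OF AE_sub[OF this]]]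
    show "AE \<omega> in rand. produces S (sort_input n (key_bound n w) f) (sorter_source (sub 1 \<omega>)) (sorted_output n f)"
      unfolding sorter_source_def by (rule AE_sub)
  qed
  then show ?thesis
    by eventually_elim (use bucket_keys_padded in blast)
qed

section \<open>Lower bounds for every integer sorter\<close>

lemma exec_work_pos: "exec c \<omega> \<sigma> L k s p \<Longrightarrow> 1 \<le> k"
  by (induction rule: exec.induct) auto

text \<open>The worst case is at least the case of constant key 0, and already there the permutation
  of item numbers has to be written. The work is at least \<open>n - 1\<close> and at least 1, hence
  at least \<open>n / 2\<close>. This absorbs the linear and logarithmic overhead into the cost of
  sorting.\<close>

lemma sort_ge:
  assumes S: "integer_sorter S" and n: "1 \<le> n"
  shows "ennreal (real n / 2) \<le> sort_work S n K" "ennreal ((1 + log 2 (real n)) / 3) \<le> sort_span S n K"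
proof -
  let ?\<sigma> = "sort_input n K (\<lambda>_. 0)"
  have third: "x / 3 \<le> y" if "x \<le> 3 * y" for x y :: real
    using that by simp
  have key: "(\<lambda>_. 0) \<in> key_seqs n K"
    by (simp add: key_seqs_def)
  have AE: "AE \<omega> in rand. produces S ?\<sigma> \<omega> (sorted_output n (\<lambda>_. 0))"
    using S n key unfolding integer_sorter_def by blast
  have "(\<integral>\<^sup>+\<omega>. ennreal (real n / 2) \<partial>rand) \<le> expected_work S ?\<sigma>"
    unfolding expected_work_def
  proof (rule nn_integral_mono_AE)
    from AE show "AE \<omega> in rand. ennreal (real n / 2) \<le> run_work S ?\<sigma> \<omega>"
    proof eventually_elim
      case (elim \<omega>)
      then obtain L k s p where e: "exec S \<omega> ?\<sigma> L k s p" "sorted_output n (\<lambda>_. 0) (upd ?\<sigma> L)"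
        unfolding produces_def by blast
      have "n - 1 \<le> k" by (rule sorter_writes[OF e])
      moreover have "1 \<le> k"
        by (rule exec_work_pos[OF e(1)])
      ultimately have "real n / 2 \<le> real k" by linarith
      then show ?case
        unfolding run_work_eq[OF e(1)] by (simp add: ennreal_of_nat_eq_real_of_nat)
    qed
  qed
  then have "ennreal (real n / 2) \<le> expected_work S ?\<sigma>"
    by (simp add: rand.emeasure_space_1[simplified])
  also have "\<dots> \<le> sort_work S n K"
    unfolding sort_work_def by (rule SUP_upper[OF key])
  finally show "ennreal (real n / 2) \<le> sort_work S n K" .
  have "(\<integral>\<^sup>+\<omega>. ennreal ((1 + log 2 (real n)) / 3) \<partial>rand) \<le> expected_span S ?\<sigma>"
    unfolding expected_span_def
  proof (rule nn_integral_mono_AE)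
    from AE show "AE \<omega> in rand. ennreal ((1 + log 2 (real n)) / 3) \<le> run_span S ?\<sigma> \<omega>"
    proof eventually_elim
      case (elim \<omega>)
      then obtain L k s p where e: "exec S \<omega> ?\<sigma> L k s p" "sorted_output n (\<lambda>_. 0) (upd ?\<sigma> L)"
        unfolding produces_def by blast
      have "1 + log 2 (real n) \<le> 3 * real (s + nat \<lceil>log 2 (real p)\<rceil>)"
        using log_le_span[OF n sorter_writes[OF e], of s p] exec_resources[OF e(1)] by blast
      then have "ennreal ((1 + log 2 (real n)) / 3) \<le> ennreal (real (s + nat \<lceil>log 2 (real p)\<rceil>))"
        by (intro ennreal_leI third)
      then show ?case
        unfolding run_span_eq[OF e(1)] by (simp only: ennreal_of_nat_eq_real_of_nat)
    qed
  qed
  then have "ennreal ((1 + log 2 (real n)) / 3) \<le> expected_span S ?\<sigma>"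
    by (simp add: rand.emeasure_space_1[simplified])
  also have "\<dots> \<le> sort_span S n K"
    unfolding sort_span_def by (rule SUP_upper[OF key])
  finally show "ennreal ((1 + log 2 (real n)) / 3) \<le> sort_span S n K" .
qed

text \<open>A single summand gives \<open>2 ^ c \<le> moment\<close>, hence a bound on every bucket
  at once. Its logarithm is split into that of \<open>n\<close> and that of
  \<open>moment / n\<close>; replacing the latter by \<open>moment / n\<close> itself leaves a
  quantity of bounded expectation.\<close>

lemma collisions_le_moment:
  assumes "1 \<le> n"
  shows "(\<Sum>i<n. real (collisions n key i)) \<le> moment n key"
    "i < n \<Longrightarrow> real (collisions n key i) \<le> log 2 (real n) + moment n key / real n"
proof -
  have le: "real c \<le> 2 ^ c" for c :: nat
    using of_nat_less_two_power[of c, where 'a = real] by simp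
  show "(\<Sum>i<n. real (collisions n key i)) \<le> moment n key"
    unfolding moment_def by (intro sum_mono le)
  assume i: "i < n"
  have "2 ^ collisions n key i \<le> moment n key"
    unfolding moment_def using i by (intro member_le_sum) auto
  then have m: "2 ^ collisions n key i \<le> moment n key" "0 < moment n key"
    using zero_less_power[of "2 :: real" "collisions n key i"] by linarith+
  have "real (collisions n key i) = log 2 (2 ^ collisions n key i)"
    by simp
  also have "\<dots> \<le> log 2 (moment n key)"
    using m by (intro log_mono) auto
  also have "\<dots> = log 2 (real n) + log 2 (moment n key / real n)"
    using m assms by (simp add: log_divide)
  also have "log 2 (moment n key / real n) \<le> moment n key / real n"
  proof -
    define y where "y = moment n key / real n"
    have "0 < y" unfolding y_def using m assms by simp
    have "y \<le> 2 powr y"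
    proof -
      have "2 / 3 * y \<le> ln 2 * y" using ln2_ge_two_thirds \<open>0 < y\<close> by (intro mult_right_mono) auto
      moreover have "1 + ln 2 * y + (ln 2 * y)\<^sup>2 / 2 \<le> exp (ln 2 * y)"
        using \<open>0 < y\<close> by (intro exp_lower_Taylor_quadratic) auto
      moreover have "(2 / 3 * y)\<^sup>2 \<le> (ln 2 * y)\<^sup>2"
        using \<open>2 / 3 * y \<le> ln 2 * y\<close> \<open>0 < y\<close> by (intro power_mono) auto
      \<comment> \<open>The difference of the two sides is
        \<open>2 / 9 * (y - 3 / 4)^2 + 7 / 8\<close>.\<close>
      moreover have "y \<le> 1 + 2 / 3 * y + (2 / 3 * y)\<^sup>2 / 2"
        using zero_le_power2[of "y - 3 / 4"] by (simp add: power2_eq_square algebra_simps)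
      ultimately show ?thesis by (simp add: powr_def mult.commute)
    qed
    then show ?thesis
      using \<open>0 < y\<close> unfolding y_def[symmetric] by (subst log_le_iff) auto
  qed
  finally show "real (collisions n key i) \<le> log 2 (real n) + moment n key / real n" by simp
qed

text \<open>A pathwise comparison, from which both the costs and the correctness follow by
  integration. It holds wherever the sorter succeeds on the keys that have been drawn.\<close>

lemma AE_permute:
  assumes S: "integer_sorter S" and b: "3 \<le> b" "uses {..<b} S" and w: "positive_weights n w"
  defines "K \<equiv> key_bound n w" and "\<sigma> \<equiv> permutation_input n w"
  shows "AE \<omega> in rand.
    run_work (permute S b) \<sigma> \<omega> \<le>
      run_work S (sort_input n K (bucket_keys n w (deviates (sub 0 \<omega>)))) (sorter_source (sub 1 \<omega>)) +
      ennreal (1000 * (real n + moment n (bucket_keys n w (deviates (sub 0 \<omega>))))) \<and>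
    run_span (permute S b) \<sigma> \<omega> \<le>
      run_span S (sort_input n K (bucket_keys n w (deviates (sub 0 \<omega>)))) (sorter_source (sub 1 \<omega>)) +
      ennreal (4000 * (1 + log 2 (real n)) + 1000 * (moment n (bucket_keys n w (deviates (sub 0 \<omega>))) / real n)) \<and>
    (\<forall>t. distinct t \<longrightarrow> set t = {..<n} \<longrightarrow> ascending (\<lambda>i. w (Suc i)) 0 t (deviates (sub 0 \<omega>)) \<longrightarrow>
      produces (permute S b) \<sigma> \<omega> (permutation_output (map Suc t)))"
proof -
  have n: "1 \<le> n" using w by (simp add: positive_weights_def)
  define r where "r = nat \<lceil>log 2 (real n)\<rceil>"
  have log0: "0 \<le> log 2 (real n)" using n by simp
  then have r: "real r \<le> log 2 (real n) + 1" unfolding r_def by linarith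
  have "log 2 (real n) \<le> real r" unfolding r_def by linarith
  then have "real n \<le> 2 powr real r"
    using n by (subst (asm) log_le_iff) auto
  then have "real n \<le> real (2 ^ r)" by (simp add: powr_realpow)
  then have n_r: "n \<le> 2 ^ r" by (simp only: of_nat_le_iff)
  from AE_sorted[OF S n, of w] show ?thesis
  proof eventually_elim
    case (elim \<omega>)
    define u where "u = deviates (sub 0 \<omega>)"
    define key where "key = bucket_keys n w u"
    define M where "M = Max (collisions n key ` {..<n})"
    obtain L k s p where e: "exec S (sorter_source (sub 1 \<omega>)) (sort_input n K key) L k s p"
      "sorted_output n key (upd (sort_input n K key) L)"
      using elim unfolding produces_def u_def[symmetric] key_def[symmetric] K_def[symmetric] by blast
    have M: "collisions n key i \<le> M" if "i < n" for i
      unfolding M_def using that by (intro Max_ge) auto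
    have "M \<in> collisions n key ` {..<n}"
      unfolding M_def using n by (intro Max_in) (auto simp: lessThan_empty_iff)
    then have M_le: "real M \<le> log 2 (real n) + moment n key / real n"
      using collisions_le_moment(2)[OF n] by auto
    have "runs (permute S b) \<omega> \<sigma> (k + 1000 * (n + (\<Sum>i<n. collisions n key i)))
      (s + 1000 * (r + M + 1)) (max n p)
      (\<lambda>\<tau>. \<forall>t. distinct t \<longrightarrow> set t = {..<n} \<longrightarrow> ascending (\<lambda>i. w (Suc i)) 0 t u \<longrightarrow>
      permutation_output (map Suc t) \<tau>)"
      unfolding \<sigma>_def
    proof (rule runs_permute[OF b w n_r])
      show "K = nat \<lfloor>2 * real n * ln (real n * weight_ratio n w)\<rfloor>"
        by (simp add: K_def key_bound_def)
      show "u = (\<lambda>i. sub 0 \<omega> [i, 0])"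
        by (simp add: u_def deviates_def[abs_def])
      show "key = (\<lambda>i. if i < n then bucket n K (Max (w ` {1..n})) (arrival (w (Suc i)) (u i)) else 0)"
        by (auto simp: key_def bucket_keys_def K_def)
      show "exec S (sub 0 (sub 1 (sub 1 (sub 1 \<omega>)))) (sort_input n K key) L k s p"
        using e(1) by (simp add: sorter_source_def)
    qed (use M e(2) in auto)
    then obtain L' k' s' p' where run: "exec (permute S b) \<omega> \<sigma> L' k' s' p'"
      "k' \<le> k + 1000 * (n + (\<Sum>i<n. collisions n key i))" "s' \<le> s + 1000 * (r + M + 1)" "p' \<le> max n p"
      "\<forall>t. distinct t \<longrightarrow> set t = {..<n} \<longrightarrow> ascending (\<lambda>i. w (Suc i)) 0 t u \<longrightarrow>
        permutation_output (map Suc t) (upd \<sigma> L')"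
      unfolding runs_def by blast
    have "real k' \<le> real (k + 1000 * (n + (\<Sum>i<n. collisions n key i)))"
      using run(2) by (simp only: of_nat_le_iff)
    also have "\<dots> \<le> real k + 1000 * (real n + moment n key)"
      using collisions_le_moment(1)[OF n, of key] by simp
    finally have work: "real k' \<le> real k + 1000 * (real n + moment n key)" .
    have mom: "0 \<le> moment n key" by (simp add: moment_def sum_nonneg)
    have p: "1 \<le> p" "1 \<le> p'" using exec_resources[OF e(1)] exec_resources[OF run(1)] by auto
    have "log 2 (real p') \<le> log 2 (real (max n p))"
      using p run(4) by (intro log_mono) auto
    \<comment> \<open>The start-up time belongs to the larger of the two processor numbers; bounding
      it by the product turns it into a sum of logarithms.\<close>
    also have "\<dots> \<le> log 2 (real n * real p)"
    proof (intro log_mono)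
      have "n * 1 \<le> n * p" "1 * p \<le> n * p" using n p by (auto intro: mult_le_mono)
      then have "max n p \<le> n * p" by simp
      then show "real (max n p) \<le> real n * real p" by (metis of_nat_le_iff of_nat_mult)
    qed (use n p in auto)
    also have "\<dots> = log 2 (real n) + log 2 (real p)"
      using n p by (simp add: log_mult)
    finally have "nat \<lceil>log 2 (real p')\<rceil> \<le> r + nat \<lceil>log 2 (real p)\<rceil>"
      unfolding r_def using log0 p by linarith
    then have "s' + nat \<lceil>log 2 (real p')\<rceil> \<le> (s + nat \<lceil>log 2 (real p)\<rceil>) + (1000 * (r + M + 1) + r)"
      using run(3) by linarith
    then have "real (s' + nat \<lceil>log 2 (real p')\<rceil>) \<le> real ((s + nat \<lceil>log 2 (real p)\<rceil>) + (1000 * (r + M + 1) + r))"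
      by (simp only: of_nat_le_iff)
    also have "\<dots> = real (s + nat \<lceil>log 2 (real p)\<rceil>) + (1001 * real r + 1000 * real M + 1000)"
      by simp
    \<comment> \<open>Both \<open>r\<close> and \<open>M\<close> are logarithmic, up to 1 and
      \<open>moment / n\<close>; 2001 of each kind is rounded up to 4000.\<close>
    also have "1001 * real r + 1000 * real M + 1000 \<le>
        4000 * (1 + log 2 (real n)) + 1000 * (moment n key / real n)"
      using r M_le log0 by simp
    finally have span: "real (s' + nat \<lceil>log 2 (real p')\<rceil>) \<le> real (s + nat \<lceil>log 2 (real p)\<rceil>) +
        (4000 * (1 + log 2 (real n)) + 1000 * (moment n key / real n))" by simp
    have "run_work (permute S b) \<sigma> \<omega> \<le> run_work S (sort_input n K key) (sorter_source (sub 1 \<omega>)) +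
        ennreal (1000 * (real n + moment n key))"
      unfolding run_work_eq[OF run(1)] run_work_eq[OF e(1)] ennreal_of_nat_eq_real_of_nat
      using ennreal_leI[OF work] mom by (subst (asm) ennreal_plus) auto
    moreover have "run_span (permute S b) \<sigma> \<omega> \<le> run_span S (sort_input n K key) (sorter_source (sub 1 \<omega>)) +
        ennreal (4000 * (1 + log 2 (real n)) + 1000 * (moment n key / real n))"
      unfolding run_span_eq[OF run(1)] run_span_eq[OF e(1)] ennreal_of_nat_eq_real_of_nat
      using ennreal_leI[OF span] mom log0 by (subst (asm) ennreal_plus) auto
    moreover have "produces (permute S b) \<sigma> \<omega> (permutation_output (map Suc t))"
      if "distinct t" "set t = {..<n}" "ascending (\<lambda>i. w (Suc i)) 0 t u" for t
      unfolding produces_def using run(1,5) that by blast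
    ultimately show ?case
      unfolding u_def[symmetric] key_def[symmetric] by blast
  qed
qed

section \<open>Passing to expectations\<close>

lemma nn_integral_affine:
  assumes "f \<in> borel_measurable rand" "g \<in> borel_measurable rand"
  shows "(\<integral>\<^sup>+\<omega>. f \<omega> + (a + c * g \<omega>) \<partial>rand) = (\<integral>\<^sup>+\<omega>. f \<omega> \<partial>rand) + (a + c * (\<integral>\<^sup>+\<omega>. g \<omega> \<partial>rand))"
  using assms by (simp add: nn_integral_add nn_integral_cmult rand.emeasure_space_1[simplified])

lemma expected_work_permute:
  assumes S: "integer_sorter S" and b: "3 \<le> b" "uses {..<b} S" and w: "positive_weights n w"
  shows "expected_work (permute S b) (permutation_input n w) \<le> ennreal 150000 * sort_work S n (key_bound n w)"
proof -
  let ?K = "key_bound n w"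
  let ?key = "\<lambda>\<omega>. bucket_keys n w (deviates (sub 0 \<omega>))"
  have n: "1 \<le> n" using w by (simp add: positive_weights_def)
  have mom: "0 \<le> moment n key" for key by (simp add: moment_def sum_nonneg)
  have [measurable]: "(\<lambda>\<omega>. ennreal (moment n (?key \<omega>))) \<in> borel_measurable rand"
    by (rule measurable_of_bucket_keys) (simp add: deviates_sub)
  have [measurable]: "(\<lambda>\<omega>. run_work S (sort_input n ?K (?key \<omega>)) (sorter_source (sub 1 \<omega>))) \<in> borel_measurable rand"
    by (rule measurable_by_keys[where g = "\<lambda>f. run_work S (sort_input n ?K f)"]) (rule measurable_run_work)
  have "expected_work (permute S b) (permutation_input n w) \<le>
    (\<integral>\<^sup>+\<omega>. run_work S (sort_input n ?K (?key \<omega>)) (sorter_source (sub 1 \<omega>)) +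
      (ennreal (1000 * real n) + 1000 * ennreal (moment n (?key \<omega>))) \<partial>rand)"
    unfolding expected_work_def
  proof (rule nn_integral_mono_AE)
    from AE_permute[OF assms] show "AE \<omega> in rand. run_work (permute S b) (permutation_input n w) \<omega> \<le>
      run_work S (sort_input n ?K (?key \<omega>)) (sorter_source (sub 1 \<omega>)) +
      (ennreal (1000 * real n) + 1000 * ennreal (moment n (?key \<omega>)))"
    proof eventually_elim
      case (elim \<omega>)
      have "ennreal (1000 * (real n + moment n (?key \<omega>))) = ennreal (1000 * real n) + 1000 * ennreal (moment n (?key \<omega>))"
        using mom by (simp add: distrib_left ennreal_mult)
      with elim show ?case by simp
    qed
  qed
  also have "\<dots> = (\<integral>\<^sup>+\<omega>. run_work S (sort_input n ?K (?key \<omega>)) (sorter_source (sub 1 \<omega>)) \<partial>rand) +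
      (ennreal (1000 * real n) + 1000 * (\<integral>\<^sup>+\<omega>. ennreal (moment n (?key \<omega>)) \<partial>rand))"
    by (rule nn_integral_affine) measurable
  also have "\<dots> \<le> sort_work S n ?K + (ennreal (1000 * real n) + 1000 * ennreal (27 * real n))"
  proof (intro add_mono mult_left_mono order_refl nn_integral_moment[OF w])
    show "(\<integral>\<^sup>+\<omega>. run_work S (sort_input n ?K (?key \<omega>)) (sorter_source (sub 1 \<omega>)) \<partial>rand) \<le> sort_work S n ?K"
    proof (rule nn_integral_by_keys[where g = "\<lambda>f. run_work S (sort_input n ?K f)"])
      fix f assume "f \<in> padded_keys n ?K"
      then show "(\<integral>\<^sup>+\<omega>. run_work S (sort_input n ?K f) \<omega> \<partial>rand) \<le> sort_work S n ?K"
        using padded_keys_subset unfolding sort_work_def expected_work_def[symmetric]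
        by (intro SUP_upper) auto
    qed (rule measurable_run_work)
  qed auto
  \<comment> \<open>The overhead is \<open>28000 * n\<close>, written as a multiple of the lower
    bound \<open>n / 2\<close> on the work of sorting.\<close>
  also have "ennreal (1000 * real n) + 1000 * ennreal (27 * real n) = ennreal 56000 * ennreal (real n / 2)"
    by (simp flip: ennreal_mult ennreal_plus ennreal_numeral)
  also have "sort_work S n ?K + \<dots> \<le> 1 * sort_work S n ?K + ennreal 56000 * sort_work S n ?K"
    using sort_ge(1)[OF S n] by (intro add_mono mult_left_mono) auto
  also have "\<dots> = (1 + ennreal 56000) * sort_work S n ?K"
    by (simp only: distrib_right)
  also have "\<dots> \<le> ennreal 150000 * sort_work S n ?K"
    by (intro mult_right_mono) auto
  finally show ?thesis .
qed

lemma expected_span_permute: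
  assumes S: "integer_sorter S" and b: "3 \<le> b" "uses {..<b} S" and w: "positive_weights n w"
  shows "expected_span (permute S b) (permutation_input n w) \<le> ennreal 150000 * sort_span S n (key_bound n w)"
proof -
  let ?K = "key_bound n w"
  let ?key = "\<lambda>\<omega>. bucket_keys n w (deviates (sub 0 \<omega>))"
  let ?l = "1 + log 2 (real n)"
  have n: "1 \<le> n" using w by (simp add: positive_weights_def)
  then have l: "1 \<le> ?l" by simp
  have mom: "0 \<le> moment n key" for key by (simp add: moment_def sum_nonneg)
  have [measurable]: "(\<lambda>\<omega>. ennreal (moment n (?key \<omega>))) \<in> borel_measurable rand"
    by (rule measurable_of_bucket_keys) (simp add: deviates_sub)
  have [measurable]: "(\<lambda>\<omega>. run_span S (sort_input n ?K (?key \<omega>)) (sorter_source (sub 1 \<omega>))) \<in> borel_measurable rand"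
    by (rule measurable_by_keys[where g = "\<lambda>f. run_span S (sort_input n ?K f)"]) (rule measurable_run_span)
  have "expected_span (permute S b) (permutation_input n w) \<le>
    (\<integral>\<^sup>+\<omega>. run_span S (sort_input n ?K (?key \<omega>)) (sorter_source (sub 1 \<omega>)) +
      (ennreal (4000 * ?l) + ennreal (1000 / real n) * ennreal (moment n (?key \<omega>))) \<partial>rand)"
    unfolding expected_span_def
  proof (rule nn_integral_mono_AE)
    from AE_permute[OF assms] show "AE \<omega> in rand. run_span (permute S b) (permutation_input n w) \<omega> \<le>
      run_span S (sort_input n ?K (?key \<omega>)) (sorter_source (sub 1 \<omega>)) +
      (ennreal (4000 * ?l) + ennreal (1000 / real n) * ennreal (moment n (?key \<omega>)))"
    proof eventually_elim
      case (elim \<omega>)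
      have "ennreal (4000 * ?l + 1000 * (moment n (?key \<omega>) / real n)) =
          ennreal (4000 * ?l) + ennreal (1000 / real n * moment n (?key \<omega>))"
        using mom l by (subst ennreal_plus) auto
      also have "ennreal (1000 / real n * moment n (?key \<omega>)) = ennreal (1000 / real n) * ennreal (moment n (?key \<omega>))"
        using mom by (intro ennreal_mult) auto
      finally show ?case using elim by simp
    qed
  qed
  also have "\<dots> = (\<integral>\<^sup>+\<omega>. run_span S (sort_input n ?K (?key \<omega>)) (sorter_source (sub 1 \<omega>)) \<partial>rand) +
      (ennreal (4000 * ?l) + ennreal (1000 / real n) * (\<integral>\<^sup>+\<omega>. ennreal (moment n (?key \<omega>)) \<partial>rand))"
    by (rule nn_integral_affine) measurable
  also have "\<dots> \<le> sort_span S n ?K + (ennreal (4000 * ?l) + ennreal (1000 / real n) * ennreal (27 * real n))"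
  proof (intro add_mono mult_left_mono order_refl nn_integral_moment[OF w])
    show "(\<integral>\<^sup>+\<omega>. run_span S (sort_input n ?K (?key \<omega>)) (sorter_source (sub 1 \<omega>)) \<partial>rand) \<le> sort_span S n ?K"
    proof (rule nn_integral_by_keys[where g = "\<lambda>f. run_span S (sort_input n ?K f)"])
      fix f assume "f \<in> padded_keys n ?K"
      then show "(\<integral>\<^sup>+\<omega>. run_span S (sort_input n ?K f) \<omega> \<partial>rand) \<le> sort_span S n ?K"
        using padded_keys_subset unfolding sort_span_def expected_span_def[symmetric]
        by (intro SUP_upper) auto
    qed (rule measurable_run_span)
  qed auto
  also have "ennreal (4000 * ?l) + ennreal (1000 / real n) * ennreal (27 * real n) = ennreal (4000 * ?l + 27000)"
  proof -
    have "ennreal (1000 / real n) * ennreal (27 * real n) = ennreal (1000 / real n * (27 * real n))"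
      by (intro ennreal_mult[symmetric]) auto
    also have "\<dots> = ennreal 27000" using n by simp
    finally show ?thesis using l by (subst ennreal_plus) auto
  qed
  \<comment> \<open>Since \<open>?l \<ge> 1\<close>, the overhead is at most
    \<open>31000 * ?l\<close>, written as a multiple of the lower bound \<open>?l / 3\<close> on the
    span of sorting.\<close>
  also have "\<dots> \<le> ennreal (93000 * (?l / 3))"
    using l by (intro ennreal_leI) simp
  also have "\<dots> = ennreal 93000 * ennreal (?l / 3)"
    using l by (intro ennreal_mult) auto
  also have "sort_span S n ?K + \<dots> \<le> 1 * sort_span S n ?K + ennreal 93000 * sort_span S n ?K"
    using sort_ge(2)[OF S n] by (intro add_mono mult_left_mono) auto
  also have "\<dots> = (1 + ennreal 93000) * sort_span S n ?K"
    by (simp only: distrib_right)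
  also have "\<dots> \<le> ennreal 150000 * sort_span S n ?K"
    by (intro mult_right_mono) auto
  finally show ?thesis by (simp add: add_left_mono)
qed

section \<open>Correctness of the distribution\<close>

lemma prob_ascending:
  assumes "distinct t" "\<And>i. i \<in> set t \<Longrightarrow> 0 < l i"
  shows "emeasure rand {\<omega>. ascending l 0 t (deviates (sub 0 \<omega>))} = ennreal (order_prob l t)"
proof -
  let ?c = "\<lambda>\<omega>. \<lambda>i\<in>set t. \<omega> [0, i, 0]"
  let ?P = "\<Pi>\<^sub>M i\<in>set t. unif"
  let ?A = "{u \<in> space ?P. ascending l 0 t u}"
  have A: "?A \<in> sets ?P"
    by (intro predE ascending_measurable) (auto intro: measurable_unif_component)
  have "emeasure ?P ?A = emeasure (distr rand ?P ?c) ?A"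
    by (subst distr_coordinates) (auto simp: inj_on_def)
  also have "\<dots> = emeasure rand (?c -` ?A \<inter> space rand)"
    by (rule emeasure_distr[OF measurable_coordinates A])
  also have "?c -` ?A \<inter> space rand = {\<omega>. ascending l 0 t (deviates (sub 0 \<omega>))}"
  proof -
    have "?c \<omega> \<in> space ?P" for \<omega>
      by (simp add: space_PiM)
    moreover have "ascending l 0 t (?c \<omega>) \<longleftrightarrow> ascending l 0 t (deviates (sub 0 \<omega>))" for \<omega>
      by (intro ascending_cong) (simp add: deviates_sub)
    ultimately show ?thesis by auto
  qed
  finally show ?thesis
    using emeasure_ascending[OF assms, where x = 0] by simp
qed

text \<open>If the times ascend along \<open>t\<close>, then almost surely \<open>t\<close> is
  output, which bounds each probability from below only. The lower bounds sum to 1 and different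
  outputs exclude each other, so there is no slack: every bound is attained and all other lists have
  probability 0. Ties between times thus need no treatment.\<close>

lemma permute_solves:
  assumes S: "integer_sorter S" and b: "3 \<le> b" "uses {..<b} S"
  shows "solves_weighted_random_permutation (permute S b)"
  unfolding solves_weighted_random_permutation_def
proof (intro allI impI)
  fix n w and t :: "nat list"
  assume w: "positive_weights n w" and len: "length t = n"
  let ?p = "weighted_random_permutation w n"
  define A where "A = (\<lambda>t. {\<omega>. produces (permute S b) (permutation_input n w) \<omega> (permutation_output t)})"
  define T where "T = {t. distinct t \<and> set t = {1..n}}"
  have pos: "\<forall>i\<in>{1..n}. 0 < w i"
    using w by (simp add: positive_weights_def)
  have A: "A t \<in> rand.events" for t
    unfolding A_def by (rule produces_permutation_measurable)
  have T: "finite T"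
    unfolding T_def by (rule finite_subset[OF _ finite_subset_distinct[of "{1..n}"]]) auto
  have len_T: "length t = n" if "t \<in> T" for t
    using that distinct_card[of t] by (simp add: T_def)
  \<comment> \<open>By determinism a source has a single final store, and its first \<open>n\<close>
    output cells determine the list.\<close>
  have disj: "A t1 \<inter> A t2 = {}" if len12: "length t1 = n" "length t2 = n" and ne: "t1 \<noteq> t2" for t1 t2
  proof -
    obtain l where "l < n" "t1 ! l \<noteq> t2 ! l"
      using ne nth_equalityI[of t1 t2] unfolding len12 by blast
    moreover have "t1 ! l = t2 ! l" if "\<omega> \<in> A t1" "\<omega> \<in> A t2" for \<omega>
    proof -
      obtain L k s p where "exec (permute S b) \<omega> (permutation_input n w) L k s p"
        "permutation_output t1 (upd (permutation_input n w) L)"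
        using \<open>\<omega> \<in> A t1\<close> unfolding A_def produces_def by blast
      moreover obtain L' k' s' p' where "exec (permute S b) \<omega> (permutation_input n w) L' k' s' p'"
        "permutation_output t2 (upd (permutation_input n w) L')"
        using \<open>\<omega> \<in> A t2\<close> unfolding A_def produces_def by blast
      ultimately have "real (t1 ! l) = real (t2 ! l)"
        using exec_deterministic \<open>l < n\<close> len12
        unfolding permutation_output_def by metis
      then show ?thesis by simp
    qed
    ultimately show ?thesis by blast
  qed
  have ge: "pmf ?p t \<le> rand.prob (A t)" if t: "t \<in> T" for t
  proof -
    \<comment> \<open>Items are numbered from 1 in the problem and from 0 in the arrays.\<close>
    define t' where "t' = map (\<lambda>i. i - 1) t"
    have tt': "t = map Suc t'"
      using t by (auto simp: t'_def T_def intro!: map_idI[symmetric])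
    have t': "distinct t'" "set t' = {..<n}"
    proof -
      show "distinct t'" using t tt' by (simp add: T_def distinct_map)
      have "Suc ` set t' = Suc ` {..<n}"
        using t tt' by (simp add: T_def image_Suc_lessThan)
      then show "set t' = {..<n}" by (simp add: inj_image_eq_iff)
    qed
    have "pmf ?p t = order_prob (\<lambda>i. w (Suc i)) t'"
      using pmf_weighted_random_permutation[OF pos, of t] t order_prob_map_Suc[of w t']
      by (simp add: T_def flip: tt')
    then have "ennreal (pmf ?p t) = emeasure rand {\<omega>. ascending (\<lambda>i. w (Suc i)) 0 t' (deviates (sub 0 \<omega>))}"
      using pos t' by (subst prob_ascending) auto
    also have "\<dots> \<le> emeasure rand (A t)"
    proof (rule emeasure_mono_AE[OF _ A])
      from AE_permute[OF S b w] show "AE \<omega> in rand. \<omega> \<in> {\<omega>. ascending (\<lambda>i. w (Suc i)) 0 t' (deviates (sub 0 \<omega>))} \<longrightarrow> \<omega> \<in> A t"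
        by eventually_elim (use t' in \<open>auto simp: A_def tt'\<close>)
    qed
    finally show ?thesis
      by (simp add: rand.emeasure_eq_measure)
  qed
  have total: "(\<Sum>t\<in>T. pmf ?p t) = 1"
    using set_pmf_weighted_random_permutation[OF pos] T by (intro sum_pmf_eq_1) (auto simp: T_def)
  have sum_le: "(\<Sum>t\<in>T'. rand.prob (A t)) \<le> 1" if "finite T'" "\<And>t. t \<in> T' \<Longrightarrow> length t = n" for T'
  proof -
    have "(\<Sum>t\<in>T'. rand.prob (A t)) = rand.prob (\<Union>t\<in>T'. A t)"
      using that disj by (intro rand.finite_measure_finite_Union[symmetric])
        (auto simp: A disjoint_family_on_def)
    then show ?thesis by simp
  qed
  have "rand.prob (A t) = pmf ?p t"
  proof (cases "t \<in> T")
    case True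
    \<comment> \<open>All summands are nonnegative, so a nonpositive sum makes each of them
      vanish.\<close>
    have "(\<Sum>t\<in>T. rand.prob (A t) - pmf ?p t) \<le> 0"
      using sum_le[OF T len_T] total by (simp add: sum_subtractf)
    moreover have "rand.prob (A t) - pmf ?p t \<le> (\<Sum>t\<in>T. rand.prob (A t) - pmf ?p t)"
      using T True ge by (intro member_le_sum) auto
    ultimately show ?thesis using ge[OF True] by linarith
  next
    case False
    \<comment> \<open>The permutations exhaust the total mass, and \<open>A t\<close> is disjoint
      from their events because \<open>t\<close> has length \<open>n\<close> too.\<close>
    have "1 \<le> (\<Sum>t\<in>T. rand.prob (A t))"
      unfolding total[symmetric] by (rule sum_mono[OF ge])
    moreover have "rand.prob (A t) + (\<Sum>t\<in>T. rand.prob (A t)) \<le> 1"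
      using sum_le[of "insert t T"] T False len len_T by auto
    ultimately have "rand.prob (A t) = 0"
      using measure_nonneg[of rand "A t"] by linarith
    moreover have "t \<notin> set_pmf ?p"
      using False set_pmf_weighted_random_permutation[OF pos] by (auto simp: T_def)
    ultimately show ?thesis by (simp add: set_pmf_iff)
  qed
  then show "measure rand {\<omega>. produces (permute S b) (permutation_input n w) \<omega> (permutation_output t)} = pmf ?p t"
    by (simp add: A_def)
qed

theorem theorem14:
  shows "\<exists>c C :: real. 0 < c \<and> 0 < C \<and>
    (\<forall>S. integer_sorter S \<longrightarrow>
      (\<exists>P. solves_weighted_random_permutation P \<and>
        (\<forall>n w. positive_weights n w \<longrightarrow>
          (let \<sigma> = permutation_input n w;
               K = nat \<lfloor>c * real n * ln (real n * weight_ratio n w)\<rfloor>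
           in run_work P \<sigma> \<in> borel_measurable rand \<and>
              run_span P \<sigma> \<in> borel_measurable rand \<and>
              expected_work P \<sigma> \<le> ennreal C * sort_work S n K \<and>
              expected_span P \<sigma> \<le> ennreal C * sort_span S n K))))"
\<comment> \<open>The 2 is the factor in the key range: clamping at the square of
  \<open>n * U\<close> makes the upper tail small enough. The constant 150000 serves work (56001)
  and span (93001) alike.\<close>
proof (rule exI[of _ 2], rule exI[of _ 150000], intro conjI allI impI)
  fix S assume S: "integer_sorter S"
  obtain N where "uses {..<N} S"
    using ex_uses by blast
  \<comment> \<open>Private arrays must lie beyond those of the sorter and beyond the arrays 0, 1
    and 2 of the input and output conventions.\<close>
  then have b: "3 \<le> max 3 N" "uses {..<max 3 N} S"
    by (auto intro: uses_mono)
  show "\<exists>P. solves_weighted_random_permutation P \<and>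
        (\<forall>n w. positive_weights n w \<longrightarrow>
          (let \<sigma> = permutation_input n w;
               K = nat \<lfloor>2 * real n * ln (real n * weight_ratio n w)\<rfloor>
           in run_work P \<sigma> \<in> borel_measurable rand \<and>
              run_span P \<sigma> \<in> borel_measurable rand \<and>
              expected_work P \<sigma> \<le> ennreal 150000 * sort_work S n K \<and>
              expected_span P \<sigma> \<le> ennreal 150000 * sort_span S n K))"
    using permute_solves[OF S b] expected_work_permute[OF S b] expected_span_permute[OF S b]
    measurable_run_work measurable_run_span
    unfolding Let_def key_bound_def by blast
qed auto

end
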